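(* Let $K_1,K_2,\dots,K_l$ be 2-bridge knots. Then $K_1,\dots,K_l$ are pairwise incomparable and $\{K_1,K_2,\dots,K_l\}$ has an upper bound with respect to the Ohtsuki-Riley-Sakuma partial order if and only if there are vectors $\mathbf{a}_1,\dots,\mathbf{a}_l\in\mathcal{S}_{even}$ with $K_i=\Phi(\hat{\mathbf{a}}_i)$ such that for each $i$ $$\mathbf{a}_i=(\mathbf{w}^{p_i},\mathbf{e}),$$ where $p_1,\dots,p_l$ are nonnegative integers, $\mathbf{e}$ is some (possibly empty) vector in $\mathcal{S}_{even}$, $\mathbf{w}=(\mathbf{e},\mathbf{m},\mathbf{e}^{-1},\mathbf{n})$, $m$ and $n$ are even integers ($\mathbf{e}$, $m$, $n$ being the same for all $i$), and $2p_i+1$ does not divide $2p_j+1$ for all $i\neq j$.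
   Context: 2-bridge knots: for coprime integers $p,q$ with $q$ odd, $K_{p/q}$ is the corresponding 2-bridge knot. Mirror images are not distinguished: $K_{p/q}$ and $K_{p'/q'}$ are regarded as equal (equivalent) iff $q'=q$ and $p'\equiv p^{\pm1}$ or $p'\equiv -p^{\pm1} \pmod q$. Continued fractions: $r+[a_1,\dots,a_n]=r+\cfrac{1}{a_1+\cfrac{1}{a_2+\cdots+\cfrac{1}{a_n}}}$. Expanded even vectors: $\mathcal{S}$ is the set of integer vectors $(a_1,\dots,a_n)$ such that each $a_i\in\{-2,0,2\}$; $a_1\neq0$ and $a_n\neq 0$; and if $a_i=0$ then $a_{i-1}=a_{i+1}=\pm2$. $\mathcal{S}_{even}$ is the set of those of even length; the empty vector is also admitted (it represents the unknot, $0+[\,]=0/1$). $\mathbf{b}^{-1}$ denotes $\mathbf{b}$ read backwards, $(\mathbf{a},\mathbf{b})$ denotes concatenation, and $\mathbf{w}^{p}$ denotes the concatenation of $p$ copies of $\mathbf{w}$. Vectors $\mathbf{a},\mathbf{b}\in\mathcal{S}$ are equivalent if $\mathbf{a}=\pm\mathbf{b}$ or $\mathbf{a}=\pm\mathbf{b}^{-1}$; the class of $\mathbf{a}$ is $\hat{\mathbf{a}}$, and $\hat{\mathcal S}_{even}$ is the set of classes of vectors of even length. $\Phi(\hat{\mathbf{a}})=K_{p/q}$ where $p/q=0+[\mathbf{a}]$; on $\hat{\mathcal S}_{even}$ this is a well-defined bijection onto the equivalence classes of 2-bridge knots. For an even integer $m$, the boldface $\mathbf{m}$ denotes the vector $(0)$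 if $m=0$, and otherwise the vector $\pm(2,0,2,0,\dots,0,2)$ whose entries sum to $m$. In particular $\mathbf{2c_i}$ is the vector of this type with sum $2c_i$. Parsing: for $\mathbf{a},\mathbf{c}\in\mathcal{S}$, $\mathbf{c}$ parses with respect to $\mathbf{a}$ if $\mathbf{c}=(\epsilon_1\mathbf{a},\mathbf{2c_1},\epsilon_2\mathbf{a}^{-1},\mathbf{2c_2},\epsilon_3\mathbf{a},\mathbf{2c_3},\dots,\epsilon_n\mathbf{a}^{(-1)^{n-1}})$ for some $n\geq1$, where $\epsilon_1=1$, $\epsilon_i\in\{-1,1\}$, each $c_i$ is an integer, and $\epsilon_i=\epsilon_{i+1}$ whenever $c_i=0$. $\hat{\mathbf{c}}$ parses with respect to $\hat{\mathbf{a}}$ if some representative of $\hat{\mathbf{c}}$ parses with respect to some representative of $\hat{\mathbf{a}}$. Ohtsuki-Riley-Sakuma partial order: for 2-bridge knots $K_1=\Phi(\hat{\mathbf{c}})$, $K_2=\Phi(\hat{\mathbf{a}})$ with $\hat{\mathbf c},\hat{\mathbf a}\in\hat{\mathcal S}_{even}$, $K_1\ge K_2$ means $\hat{\mathbf{c}}$ parses with respect to $\hat{\mathbf{a}}$. Two knots are incomparable if neither is $\ge$ the other. A 2-bridge knot $J$ is an upper bound of a set of 2-bridge knots if $J\ge K$ for every $K$ in the set. *)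

theory Defs
  imports Complex_Main "HOL-Number_Theory.Cong"
begin

section \<open>Two-bridge knots up to mirror image\<close>

text \<open>The fraction \<open>p/q\<close> is a rational number with odd denominator; \<^const>\<open>quotient_of\<close>
  returns the coprime pair \<open>(p, q)\<close> with \<open>q > 0\<close>. Since \<open>p\<close> is a unit modulo \<open>q\<close>,
  \<open>p' \<equiv> \<plusminus>p\<^sup>-\<^sup>1\<close> is written \<open>p' * p \<equiv> \<plusminus>1\<close>. Two-bridge knots are the classes of such
  fractions.\<close>

definition same_knot :: "rat \<Rightarrow> rat \<Rightarrow> bool" where
  "same_knot r r' \<longleftrightarrow>
     (let (p, q) = quotient_of r; (p', q') = quotient_of r'
      in odd q \<and> q' = q \<and>
         ([p' = p] (mod q) \<or> [p' * p = 1] (mod q) \<or>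
          [p' = - p] (mod q) \<or> [p' * p = - 1] (mod q)))"

lemma same_knot_iff:
  assumes "coprime p q" "q \<noteq> 0" "coprime p' q'" "q' \<noteq> 0"
  shows "same_knot (of_int p / of_int q) (of_int p' / of_int q') \<longleftrightarrow>
     odd q \<and> \<bar>q'\<bar> = \<bar>q\<bar> \<and>
         ([p' = p] (mod q) \<or> [p' * p = 1] (mod q) \<or>
          [p' = - p] (mod q) \<or> [p' * p = - 1] (mod q))"
proof -
  have *: "quotient_of (of_int a / of_int b) = (sgn b * a, \<bar>b\<bar>)"
    if "coprime a b" "b \<noteq> 0" for a b :: int
  proof -
    have "quotient_of (of_int a / of_int b) = Rat.normalize (a, b)"
      by (metis Fract_of_int_quotient quotient_of_Fract)
    also have "\<dots> = (sgn b * a, \<bar>b\<bar>)"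
      using that by (auto simp: Rat.normalize_def Let_def sgn_if)
    finally show ?thesis .
  qed
  have neg: "[- x = y] (mod q) \<longleftrightarrow> [x = - y] (mod q)" for x y
    by (metis add.inverse_inverse cong_minus_minus_iff)
  show ?thesis
    using assms
    by (auto simp: same_knot_def * sgn_if abs_if neg cong_minus_minus_iff split: if_splits)
qed

lemma same_knot_sym: "same_knot r s \<Longrightarrow> same_knot s r"
proof -
  assume *: "same_knot r s"
  obtain p q where pq: "quotient_of r = (p, q)" by force
  obtain p' q' where pq': "quotient_of s = (p', q')" by force
  have neg: "[x = - y] (mod q) \<longleftrightarrow> [y = - x] (mod q)" for x y
    by (metis add.inverse_inverse cong_minus_minus_iff cong_sym_eq)
  show ?thesis
    using * unfolding same_knot_def Let_def pq pq' prod.case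
    by (metis cong_sym_eq mult.commute neg)
qed

lemma same_knot_trans:
  assumes "same_knot r s" "same_knot s t"
  shows "same_knot r t"
proof -
  obtain a q where aq: "quotient_of r = (a, q)" by force
  obtain b q' where bq: "quotient_of s = (b, q')" by force
  obtain c q'' where cq: "quotient_of t = (c, q'')" by force
  have [simp]: "q' = q" "q'' = q" and odd: "odd q"
    using assms by (auto simp: same_knot_def aq bq cq)
  have "coprime b q"
    using quotient_of_coprime[OF bq] by simp
  have "\<exists>u. \<bar>u\<bar> = 1 \<and> ([b = u * a] (mod q) \<or> [b * a = u] (mod q))"
    using assms(1) unfolding same_knot_def aq bq Let_def prod.case
    by (metis abs_minus_cancel abs_one mult_1 mult_minus1)
  then obtain u where u: "\<bar>u\<bar> = 1" and U: "[b = u * a] (mod q) \<or> [b * a = u] (mod q)"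
    by blast
  have "\<exists>v. \<bar>v\<bar> = 1 \<and> ([c = v * b] (mod q) \<or> [c * b = v] (mod q))"
    using assms(2) unfolding same_knot_def cq bq Let_def prod.case
    by (metis \<open>q' = q\<close> abs_minus_cancel abs_one mult_1 mult_minus1)
  then obtain v where v: "\<bar>v\<bar> = 1" and V: "[c = v * b] (mod q) \<or> [c * b = v] (mod q)"
    by blast
  have "u * u = 1" "v * v = 1"
    using u v by (metis abs_mult_self_eq mult_1)+
  have cancel: "[x = y] (mod q)" if "[x * b = y * b] (mod q)" for x y
    using that \<open>coprime b q\<close> by (meson cong_mult_rcancel coprime_commute)
  have "[c = (v * u) * a] (mod q) \<or> [c * a = v * u] (mod q)"
    using U V
  proof (elim disjE)
    assume "[b = u * a] (mod q)" "[c = v * b] (mod q)"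
    then have "[c = v * (u * a)] (mod q)"
      by (meson cong_scalar_left cong_trans)
    then show ?thesis by (simp add: mult.assoc)
  next
    assume 1: "[b = u * a] (mod q)" and 2: "[c * b = v] (mod q)"
    have "[c * (u * a) = v] (mod q)"
      using 1 2 by (meson cong_scalar_left cong_sym cong_trans)
    then have "[u * (c * (u * a)) = u * v] (mod q)"
      by (rule cong_scalar_left)
    moreover have "u * (c * (u * a)) = c * a"
      using \<open>u * u = 1\<close> by algebra
    ultimately show ?thesis by (simp only: mult.commute[of u v] simp_thms)
  next
    assume 1: "[b * a = u] (mod q)" and 2: "[c = v * b] (mod q)"
    have "[c * a = v * b * a] (mod q)"
      using 2 by (rule cong_scalar_right)
    moreover have "[v * (b * a) = v * u] (mod q)"
      using 1 by (rule cong_scalar_left)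
    ultimately show ?thesis
      by (metis cong_trans mult.assoc)
  next
    assume 1: "[b * a = u] (mod q)" and 2: "[c * b = v] (mod q)"
    have "[v * u * (b * a) = v * u * u] (mod q)"
      using 1 by (rule cong_scalar_left)
    moreover have "v * u * u = v"
      using \<open>u * u = 1\<close> by algebra
    ultimately have "[v * u * a * b = c * b] (mod q)"
      using 2 by (metis cong_sym cong_trans mult.assoc mult.commute)
    then show ?thesis using cancel cong_sym by blast
  qed
  moreover have "v * u = 1 \<or> v * u = - 1"
    using u v by (auto simp: abs_if split: if_splits)
  ultimately show ?thesis
    using odd by (auto simp: same_knot_def aq cq)
qed

quotient_type two_bridge_knot = rat / partial: same_knot
proof (rule part_equivpI)
  show "\<exists>r. same_knot r r"
    by (rule exI[of _ 0]) (simp add: same_knot_def)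
  show "symp same_knot"
    by (rule sympI) (rule same_knot_sym)
  show "transp same_knot"
    by (rule transpI) (rule same_knot_trans)
qed

definition knot :: "rat \<Rightarrow> two_bridge_knot" where
  "knot r = abs_two_bridge_knot r"

lemma knot_eq_iff:
  assumes "odd (snd (quotient_of r))" "odd (snd (quotient_of s))"
  shows "knot r = knot s \<longleftrightarrow> same_knot r s"
proof -
  have "same_knot r r" "same_knot s s"
    using assms by (auto simp: same_knot_def split: prod.splits)
  then show ?thesis
    unfolding knot_def using Quotient_rel[OF Quotient_two_bridge_knot] by blast
qed


section \<open>Expanded even vectors\<close>

text \<open>\<open>cfrac [a\<^sub>1, \<dots>, a\<^sub>n] = 0 + [a\<^sub>1, \<dots>, a\<^sub>n]\<close>. No division by zero occurs on \<open>vecs\<close>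
  (\<open>cfrac_vecs_even\<close> below).\<close>

fun cfrac :: "int list \<Rightarrow> rat" where
  "cfrac [] = 0"
| "cfrac (a # as) = 1 / (of_int a + cfrac as)"

definition vecs :: "int list set" where
  "vecs = {a. set a \<subseteq> {-2, 0, 2} \<and> (a \<noteq> [] \<longrightarrow> hd a \<noteq> 0 \<and> last a \<noteq> 0) \<and>
     (\<forall>i. 0 < i \<and> Suc i < length a \<and> a ! i = 0 \<longrightarrow>
          a ! (i - 1) = a ! Suc i \<and> a ! Suc i \<in> {-2, 2})}"

definition vecs_even :: "int list set" where
  "vecs_even = {a \<in> vecs. even (length a)}"

definition scale :: "int \<Rightarrow> int list \<Rightarrow> int list" where
  "scale \<epsilon> a = map ((*) \<epsilon>) a"

lemma scale_1: "scale 1 a = a"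
  unfolding scale_def by (rule map_idI) simp

definition vec_rel :: "(int list \<times> int list) set" where
  "vec_rel = {(a, b). a \<in> vecs \<and> b \<in> vecs \<and>
     (\<exists>\<epsilon>\<in>{-1, 1}. a = scale \<epsilon> b \<or> a = scale \<epsilon> (rev b))}"

definition vclass :: "int list \<Rightarrow> int list set" where
  "vclass a = vec_rel `` {a}"

definition vclasses_even :: "int list set set" where
  "vclasses_even = vecs_even // vec_rel"

text \<open>The map is constant on each class of even vectors (\<open>Phi_vclass\<close> below).\<close>

definition Phi :: "int list set \<Rightarrow> two_bridge_knot" where
  "Phi A = the_elem ((\<lambda>a. knot (cfrac a)) ` A)"


section \<open>Parsing and the Ohtsuki-Riley-Sakuma order\<close>

text \<open>\<open>\<plusminus>(2, 0, 2, \<dots>, 0, 2)\<close> with \<open>\<bar>m\<bar>/2\<close> nonzero entries has length \<open>\<bar>m\<bar> - 1\<close>. Used for even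
  \<open>m\<close> only.\<close>

definition bold :: "int \<Rightarrow> int list" where
  "bold m = (if m = 0 then [0]
     else map (\<lambda>i. if even i then 2 * sgn m else 0) [0..<nat \<bar>m\<bar> - 1])"

lemma sum_list_bold:
  assumes "even m"
  shows "sum_list (bold m) = m"
proof (cases "m = 0")
  case False
  have *: "sum_list (map (\<lambda>i. if even i then 2 * s else 0) [0..<2 * k + 1]) = 2 * (int k + 1) * s"
    for k and s :: int
  proof (induction k)
    case (Suc k)
    have "[0..<2 * Suc k + 1] = [0..<2 * k + 1] @ [2 * k + 1, 2 * k + 2]"
      by simp
    then show ?case using Suc by (simp add: algebra_simps del: upt_Suc)
  qed simp
  obtain j where j: "m = 2 * j" using assms by blast
  define k where "k = nat \<bar>j\<bar> - 1"
  have k: "nat \<bar>m\<bar> - 1 = 2 * k + 1" "int k + 1 = \<bar>j\<bar>"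
    using False j by (auto simp: k_def)
  have "sum_list (bold m) = 2 * \<bar>j\<bar> * sgn m"
    using False *[where k = k and s = "sgn m"] k by (simp add: bold_def del: upt_Suc)
  then show ?thesis using j by (auto simp: abs_if sgn_if split: if_splits)
qed (simp add: bold_def)

definition parses :: "int list \<Rightarrow> int list \<Rightarrow> bool" where
  "parses c a \<longleftrightarrow> c \<in> vecs \<and> a \<in> vecs \<and>
     (\<exists>n \<epsilon> k. 1 \<le> n \<and> \<epsilon> 1 = 1 \<and> (\<forall>i\<in>{1..n}. \<epsilon> i \<in> {-1, 1}) \<and>
        (\<forall>i\<in>{1..<n}. k i = 0 \<longrightarrow> \<epsilon> i = \<epsilon> (Suc i)) \<and>
        (let blk = (\<lambda>i. scale (\<epsilon> i) (if odd i then a else rev a))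
         in c = concat (map (\<lambda>i. blk i @ bold (2 * k i)) [1..<n]) @ blk n))"

definition class_parses :: "int list set \<Rightarrow> int list set \<Rightarrow> bool" where
  "class_parses C A \<longleftrightarrow> (\<exists>c\<in>C. \<exists>a\<in>A. parses c a)"

definition ors_ge :: "two_bridge_knot \<Rightarrow> two_bridge_knot \<Rightarrow> bool" where
  "ors_ge K1 K2 \<longleftrightarrow>
     (\<exists>C\<in>vclasses_even. \<exists>A\<in>vclasses_even. K1 = Phi C \<and> K2 = Phi A \<and> class_parses C A)"

definition incomparable :: "two_bridge_knot \<Rightarrow> two_bridge_knot \<Rightarrow> bool" where
  "incomparable K1 K2 \<longleftrightarrow> \<not> ors_ge K1 K2 \<and> \<not> ors_ge K2 K1"

definition upper_bound :: "two_bridge_knot \<Rightarrow> two_bridge_knot set \<Rightarrow> bool" where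
  "upper_bound J \<K> \<longleftrightarrow> (\<forall>K\<in>\<K>. ors_ge J K)"


section \<open>Well-definedness of \<open>Phi\<close>\<close>

text \<open>The product of the matrices \<open>(0, 1; 1, a\<^sub>i)\<close>, in row order; its second column is the
  numerator and denominator of the continued fraction.\<close>

fun cmat :: "int list \<Rightarrow> int \<times> int \<times> int \<times> int" where
  "cmat [] = (1, 0, 0, 1)"
| "cmat (a # as) = (case cmat as of (w, x, y, z) \<Rightarrow> (y, z, w + a * y, x + a * z))"

lemma cmat_snoc:
  "cmat (as @ [a]) = (case cmat as of (w, x, y, z) \<Rightarrow> (x, w + a * x, z, y + a * z))"
  by (induction as) (auto simp: algebra_simps split: prod.splits)

lemma cmat_rev: "cmat (rev as) = (case cmat as of (w, x, y, z) \<Rightarrow> (w, y, x, z))"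
  by (induction as) (auto simp: cmat_snoc split: prod.splits)

lemma cmat_det: "cmat as = (w, x, y, z) \<Longrightarrow> w * z - x * y = (- 1) ^ length as"
proof (induction as arbitrary: w x y z)
  case (Cons a as)
  obtain w' x' y' z' where *: "cmat as = (w', x', y', z')" by (metis prod.exhaust)
  have "w' * z' - x' * y' = (- 1) ^ length as" using Cons.IH[OF *] .
  moreover have "w = y'" "x = z'" "y = w' + a * y'" "z = x' + a * z'"
    using Cons.prems * by auto
  ultimately show ?case by (simp add: algebra_simps)
qed auto

lemma cmat_parity:
  assumes "\<forall>a\<in>set as. even a" "cmat as = (w, x, y, z)"
  shows "even (length as) \<longleftrightarrow> odd z" "even (length as) \<longleftrightarrow> even x"
  using assms by (induction as arbitrary: w x y z) (auto split: prod.splits)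

lemma cfrac_scale: "\<epsilon> \<in> {-1, 1} \<Longrightarrow> cfrac (scale \<epsilon> a) = of_int \<epsilon> * cfrac a"
proof (induction a)
  case (Cons b a)
  have "1 / (- of_int b - cfrac a) = - (1 / (of_int b + cfrac a))"
    by (metis diff_conv_add_uminus divide_minus_right minus_add_distrib)
  then show ?case using Cons by (auto simp: scale_def)
qed (auto simp: scale_def)

definition suffixes_ok :: "int list \<Rightarrow> bool" where
  "suffixes_ok a \<longleftrightarrow> set a \<subseteq> {-2, 0, 2} \<and> (a \<noteq> [] \<longrightarrow> last a \<noteq> 0) \<and>
     (\<forall>i. 0 < i \<and> Suc i < length a \<and> a ! i = 0 \<longrightarrow>
          a ! (i - 1) = a ! Suc i \<and> a ! Suc i \<in> {-2, 2}) \<and>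
     (a \<noteq> [] \<and> hd a = 0 \<longrightarrow> a ! 1 \<noteq> 0)"

lemma suffixes_ok_Cons:
  assumes "suffixes_ok (b # a)"
  shows "suffixes_ok a" "b \<in> {-2, 0, 2}" "b = 0 \<Longrightarrow> a \<noteq> [] \<and> hd a \<noteq> 0"
    "a \<noteq> [] \<Longrightarrow> hd a = 0 \<Longrightarrow> b \<noteq> 0 \<and> a ! 1 = b"
proof -
  have *: "a ! i = 0 \<Longrightarrow> Suc i < length a \<Longrightarrow> (b # a) ! i = a ! Suc i \<and> a ! Suc i \<in> {-2, 2}" for i
    using assms unfolding suffixes_ok_def by (auto dest: spec[of _ "Suc i"])
  have l: "a \<noteq> [] \<Longrightarrow> hd a = 0 \<Longrightarrow> Suc 0 < length a"
    using assms unfolding suffixes_ok_def by (cases a) (auto split: if_splits)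
  have h: "a \<noteq> [] \<Longrightarrow> hd a = 0 \<Longrightarrow> b = a ! 1 \<and> a ! 1 \<in> {-2, 2}"
    using *[of 0] l by (auto simp: hd_conv_nth)
  have "a ! (i - 1) = a ! Suc i \<and> a ! Suc i \<in> {-2, 2}"
    if "0 < i" "Suc i < length a" "a ! i = 0" for i
    using *[of i] that by (cases i) auto
  then show "suffixes_ok a"
    using assms h unfolding suffixes_ok_def by (auto split: if_splits)
  show "b \<in> {-2, 0, 2}" "b = 0 \<Longrightarrow> a \<noteq> [] \<and> hd a \<noteq> 0"
    using assms unfolding suffixes_ok_def by (auto simp: hd_conv_nth split: if_splits)
  show "a \<noteq> [] \<Longrightarrow> hd a = 0 \<Longrightarrow> b \<noteq> 0 \<and> a ! 1 = b"
    using h by auto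
qed

lemma cfrac_bound:
  assumes "suffixes_ok a"
  shows "a \<noteq> [] \<Longrightarrow> hd a \<noteq> 0 \<Longrightarrow> \<bar>cfrac a\<bar> < 1 \<and> sgn (cfrac a) = of_int (sgn (hd a))"
    "a \<noteq> [] \<Longrightarrow> hd a = 0 \<Longrightarrow> \<bar>cfrac a\<bar> > 1 \<and> sgn (cfrac a) = of_int (sgn (a ! 1))"
proof -
  have inv: "\<bar>1 / x\<bar> < 1 \<and> sgn (1 / x) = sgn x" if "1 < \<bar>x\<bar>" for x :: rat
    using that by (auto simp: abs_divide sgn_divide)
  have inv': "1 < \<bar>1 / x\<bar> \<and> sgn (1 / x) = sgn x" if "\<bar>x\<bar> < 1" "x \<noteq> 0" for x :: rat
    using that by (auto simp: abs_divide sgn_divide)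
  have "(a \<noteq> [] \<and> hd a \<noteq> 0 \<longrightarrow> \<bar>cfrac a\<bar> < 1 \<and> sgn (cfrac a) = of_int (sgn (hd a))) \<and>
    (a \<noteq> [] \<and> hd a = 0 \<longrightarrow> \<bar>cfrac a\<bar> > 1 \<and> sgn (cfrac a) = of_int (sgn (a ! 1)))"
    using assms
  proof (induction a)
    case (Cons b a)
    note ok = suffixes_ok_Cons[OF Cons.prems]
    note IH = Cons.IH[OF ok(1)]
    show ?case
    proof (cases "b = 0")
      case True
      then have a: "a \<noteq> []" "hd a \<noteq> 0" using ok(3) by auto
      then have c: "\<bar>cfrac a\<bar> < 1" "sgn (cfrac a) = of_int (sgn (hd a))" using IH by auto
      then have "cfrac a \<noteq> 0" using a by (metis of_int_0_eq_iff sgn_0_0)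
      then have "1 < \<bar>1 / cfrac a\<bar> \<and> sgn (1 / cfrac a) = of_int (sgn (hd a))"
        using inv'[of "cfrac a"] c by simp
      moreover have "cfrac (b # a) = 1 / cfrac a" "(b # a) ! 1 = hd a"
        using True a by (simp_all add: hd_conv_nth)
      ultimately show ?thesis using True by (metis list.sel(1))
    next
      case False
      then have b: "b = 2 \<or> b = - 2" using ok(2) by auto
      have "a = [] \<or> \<bar>cfrac a\<bar> < 1 \<or> sgn (cfrac a) = of_int (sgn b)"
        using IH ok(4) by (cases "hd a = 0") auto
      then have *: "1 < \<bar>of_int b + cfrac a\<bar> \<and> sgn (of_int b + cfrac a) = of_int (sgn b)"
        using b by (elim disjE) (auto simp: abs_if sgn_if split: if_splits)
      then have "\<bar>1 / (of_int b + cfrac a)\<bar> < 1 \<and>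
          sgn (1 / (of_int b + cfrac a)) = of_int (sgn b)"
        using inv[of "of_int b + cfrac a"] by metis
      then show ?thesis using False by (metis cfrac.simps(2) list.sel(1))
    qed
  qed simp
  then show "a \<noteq> [] \<Longrightarrow> hd a \<noteq> 0 \<Longrightarrow> \<bar>cfrac a\<bar> < 1 \<and> sgn (cfrac a) = of_int (sgn (hd a))"
    "a \<noteq> [] \<Longrightarrow> hd a = 0 \<Longrightarrow> \<bar>cfrac a\<bar> > 1 \<and> sgn (cfrac a) = of_int (sgn (a ! 1))"
    by blast+
qed

lemma vecs_suffixes_ok: "a \<in> vecs \<Longrightarrow> suffixes_ok a"
  by (auto simp: vecs_def suffixes_ok_def)

lemma cfrac_nonzero:
  assumes "suffixes_ok (b # a)"
  shows "of_int b + cfrac a \<noteq> 0"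
proof -
  have "cfrac (b # a) \<noteq> 0"
  proof (cases "b = 0")
    case True
    then show ?thesis using cfrac_bound(2)[OF assms] by auto
  next
    case False
    then show ?thesis using cfrac_bound(1)[OF assms] by (auto simp: sgn_if split: if_splits)
  qed
  then show ?thesis by auto
qed

lemma cfrac_cmat:
  assumes "suffixes_ok a" "cmat a = (w, x, y, z)"
  shows "z \<noteq> 0 \<and> cfrac a = of_int x / of_int z"
  using assms
proof (induction a arbitrary: w x y z)
  case (Cons b a)
  obtain w' x' y' z' where *: "cmat a = (w', x', y', z')" by (metis prod.exhaust)
  have IH: "z' \<noteq> 0" "cfrac a = of_int x' / of_int z'"
    using Cons.IH[OF _ *] suffixes_ok_Cons(1)[OF Cons.prems(1)] by auto
  have xz: "x = z'" "z = x' + b * z'" using Cons.prems * by auto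
  have eq: "(of_int b + cfrac a) * of_int z' = of_int z"
    using IH xz by (simp add: field_simps)
  then have "z \<noteq> 0"
    using cfrac_nonzero[OF Cons.prems(1)] IH(1) by (metis mult_eq_0_iff of_int_0_eq_iff)
  moreover have "cfrac (b # a) = of_int x / of_int z"
    unfolding eq[symmetric] xz(1) using IH(1) by simp
  ultimately show ?case by blast
qed auto

lemma cfrac_vecs_even:
  assumes "a \<in> vecs_even" "cmat a = (w, x, y, z)"
  shows "cfrac a = of_int x / of_int z" "odd z" "coprime x z" "coprime y z" "w * z - x * y = 1"
proof -
  have a: "suffixes_ok a" "even (length a)"
    using assms vecs_suffixes_ok by (auto simp: vecs_even_def)
  then have "\<forall>b\<in>set a. even b" by (auto simp: suffixes_ok_def)
  then show "odd z" using cmat_parity assms(2) a by blast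
  show "cfrac a = of_int x / of_int z" using cfrac_cmat a assms by blast
  show det: "w * z - x * y = 1" using cmat_det[OF assms(2)] a by simp
  then show "coprime x z" "coprime y z"
    by (metis coprimeI dvd_diff dvd_mult dvd_mult2)+
qed

lemma vec_rel_even: "(a, b) \<in> vec_rel \<Longrightarrow> a \<in> vecs_even \<Longrightarrow> b \<in> vecs_even"
  by (auto simp: vec_rel_def vecs_even_def scale_def)

lemma knot_cfrac_cong:
  assumes "(a, b) \<in> vec_rel" "a \<in> vecs_even"
  shows "knot (cfrac a) = knot (cfrac b)"
proof -
  have b: "b \<in> vecs_even" using vec_rel_even assms by blast
  obtain w x y z where B: "cmat b = (w, x, y, z)" by (metis prod.exhaust)
  note B' = cfrac_vecs_even[OF b B]
  obtain w' x' y' z' where A: "cmat a = (w', x', y', z')" by (metis prod.exhaust)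
  note A' = cfrac_vecs_even[OF assms(2) A]
  have z: "z \<noteq> 0" "z' \<noteq> 0" using A'(2) B'(2) by auto
  obtain \<epsilon> where e: "\<epsilon> \<in> {-1, 1}" and ab: "a = scale \<epsilon> b \<or> a = scale \<epsilon> (rev b)"
    using assms(1) by (auto simp: vec_rel_def)
  have refl: "same_knot r r" if "r = of_int p / of_int q" "coprime p q" "odd q" for r p q
    using same_knot_iff[of p q p q] that by auto
  have xy: "[x * y = - 1] (mod z)"
    using B'(5) by (metis cong_iff_dvd_diff diff_minus_eq_add dvd_triv_right diff_eq_eq add.commute)
  have "same_knot (cfrac a) (cfrac b)"
    using ab
  proof
    assume "a = scale \<epsilon> b"
    then have "cfrac a = of_int (\<epsilon> * x) / of_int z"
      using B'(1) e by (simp add: cfrac_scale)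
    moreover have "coprime (\<epsilon> * x) z" using e B'(3) by auto
    ultimately show ?thesis
      using e B' z same_knot_iff[of "\<epsilon> * x" z x z] by auto
  next
    assume a: "a = scale \<epsilon> (rev b)"
    have "scale \<epsilon> a = rev b"
      using e a by (auto simp: scale_def comp_def)
    moreover have "cmat (rev b) = (w, y, x, z)" by (simp add: cmat_rev B)
    moreover have "rev b \<in> vecs_even"
    proof -
      have "rev b \<in> vecs"
      proof -
        have "b \<in> vecs" using b by (simp add: vecs_even_def)
        then have b1: "set b \<subseteq> {-2, 0, 2}" "b \<noteq> [] \<Longrightarrow> hd b \<noteq> 0 \<and> last b \<noteq> 0"
          and b2: "\<And>i. 0 < i \<Longrightarrow> Suc i < length b \<Longrightarrow> b ! i = 0 \<Longrightarrow>
            b ! (i - 1) = b ! Suc i \<and> b ! Suc i \<in> {-2, 2}"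
          unfolding vecs_def by auto
        have "rev b ! (i - 1) = rev b ! Suc i \<and> rev b ! Suc i \<in> {-2, 2}"
          if i: "0 < i" "Suc i < length b" "rev b ! i = 0" for i
        proof -
          define j where "j = length b - Suc i"
          have j: "0 < j" "Suc j < length b" "rev b ! i = b ! j" "rev b ! (i - 1) = b ! Suc j"
            "rev b ! Suc i = b ! (j - 1)"
            using i by (auto simp: j_def rev_nth Suc_diff_Suc)
          then show ?thesis using b2[of j] i by auto
        qed
        then show ?thesis
          using b1 by (auto simp: vecs_def hd_rev last_rev)
      qed
      then show ?thesis using b by (simp add: vecs_even_def)
    qed
    ultimately have "cfrac (rev b) = of_int y / of_int z"
      using cfrac_vecs_even(1) by blast
    then have "cfrac a = of_int (\<epsilon> * y) / of_int z"
      using a e by (simp add: cfrac_scale)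
    moreover have "coprime (\<epsilon> * y) z" using e B'(4) by auto
    moreover have "[x * (\<epsilon> * y) = 1] (mod z) \<or> [x * (\<epsilon> * y) = - 1] (mod z)"
      using e xy cong_minus_minus_iff[of "x * y" "-1" z] by auto
    ultimately show ?thesis
      using B' z same_knot_iff[of "\<epsilon> * y" z x z] by auto
  qed
  then show ?thesis
    unfolding knot_def using Quotient_rel_abs[OF Quotient_two_bridge_knot] by blast
qed

lemma Phi_vclass:
  assumes "a \<in> vecs_even"
  shows "Phi (vclass a) = knot (cfrac a)"
proof -
  have "(a, a) \<in> vec_rel"
    using assms scale_1[of a] unfolding vec_rel_def vecs_even_def by fastforce
  then have "a \<in> vclass a"
    by (simp add: vclass_def)
  moreover have "knot (cfrac b) = knot (cfrac a)" if "b \<in> vclass a" for b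
    using knot_cfrac_cong[OF _ assms, of b] that by (simp add: vclass_def)
  ultimately have "(\<lambda>b. knot (cfrac b)) ` vclass a = {knot (cfrac a)}"
    by blast
  then show ?thesis by (simp add: Phi_def)
qed

end

theory Submission
  imports Defs "HOL-Library.Sublist"
begin

text \<open>
  Forward direction. Let \<open>c\<close> represent an upper bound and suppose that it parses both into
  \<open>a\<close>-blocks and into \<open>b\<close>-blocks, where \<open>a\<close> is shorter than \<open>b\<close> and \<open>b\<close> does not parse with
  respect to \<open>a\<close>. Passing to a suffix of \<open>c\<close>, the first \<open>b\<close>-gap lies inside an \<open>a\<close>-block. The
  part of \<open>c\<close> after this gap is then read in three ways (from the end of \<open>b\<close>, and continuing the
  two pieces of the broken \<open>a\<close>-block), and comparing the readings step by step gives
  \<open>b = (a, d, g) = (f, h, a)\<close> with palindromes \<open>f\<close>, \<open>g\<close> and gaps \<open>d\<close>, \<open>h\<close>. For more than two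
  incomparable knots the gaps \<open>d\<close>, \<open>h\<close> do not depend on the pair, and a Euclidean descent on the
  longest vector, whose step replaces the longest and second longest by the second longest and a
  difference, shows that all vectors are \<open>(e, d, e\<^sup>-\<^sup>1, h, e, d, \<dots>, e)\<close> for one \<open>e\<close>. The
  descent can also end in powers of a palindrome \<open>(f, 2x)\<close> (when \<open>d = 0\<close> or \<open>h = 0\<close>); these have
  the required form unless exponents of both parities occur, and then they have no common upper
  bound.

  Backward direction. The vector \<open>(w\<^sup>N, e)\<close> with \<open>2N + 1 = \<Prod>(2p\<^sub>i + 1)\<close> gives an upper bound.
  For incomparability, the denominator of a vector divides the denominator of everything that
  parses with respect to it, and the denominators of \<open>(w\<^sup>p, e)\<close> are a multiple of the Lucas-type
  sequence \<open>V\<^sub>0 = 1\<close>, \<open>V\<^sub>1 = T - 1\<close>, \<open>V\<^sub>p\<^sub>+\<^sub>2 = T V\<^sub>p\<^sub>+\<^sub>1 - V\<^sub>p\<close>, for which \<open>V\<^sub>q\<close> divides \<open>V\<^sub>p\<close> only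
  if \<open>2q + 1\<close> divides \<open>2p + 1\<close>.
\<close>

section \<open>Gaps and the recursive form of parsing\<close>

text \<open>The vector \<open>(w^p, e)\<close> consists of 2p + 1 blocks, alternately
  \<open>e\<close> and its reversal. Grouping these blocks turns divisibility of the odd numbers
  into a parsing; denominators, which are invariants of the knot up to sign, give the converse
  independently of representatives. The combinatorics rests on unique reading: gaps have odd length
  and alternate between nonzero and zero entries, while blocks begin and end with nonzero entries,
  so where a gap ends is forced (\<open>prefix_gap\<close>). The readings in the overview can be
  compared because they are readings of one vector: after its first gap \<open>c\<close> continues
  with the reversal of \<open>b\<close> up to sign, which is also what is met when walking left from
  that gap, and what \<open>c\<close> read from its far end begins with. The obstacle is the zero
  gap. Since \<open>x, 0, x\<close> is the same vector as the gap \<open>2x\<close>, a zero gap of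
  one parsing can be hidden inside a gap of the other; this causes the cases where boundaries do not
  match and is the origin of the exceptional powers. Signs are controlled by two rules: a zero gap
  preserves the sign of the block, and a zero entry has equal neighbours.\<close>

abbreviation unit_sign :: "int \<Rightarrow> bool" where
  "unit_sign e \<equiv> e = 1 \<or> e = -1"

text \<open>Indexing by half the entry sum removes all evenness conditions on gap sums.\<close>

definition gap :: "int \<Rightarrow> int list" where
  "gap j = bold (2 * j)"

lemma length_gap: "length (gap j) = (if j = 0 then 1 else 2 * nat \<bar>j\<bar> - 1)"
  by (auto simp: gap_def bold_def nat_abs_mult_distrib)

lemma nth_gap: "i < length (gap j) \<Longrightarrow> gap j ! i = (if even i then 2 * sgn j else 0)"
  by (auto simp: gap_def bold_def sgn_mult less_Suc_eq)

lemma gap_0 [simp]: "gap 0 = [0]"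
  by (simp add: gap_def bold_def)

lemma gap_neq_Nil [simp]: "gap j \<noteq> []"
  using length_gap[of j] by (cases "gap j") (auto split: if_splits)

lemma odd_length_gap [simp]: "odd (length (gap j))"
  by (auto simp: length_gap)

lemma gap_eqI:
  assumes "length xs = length (gap j)" "\<And>i. i < length xs \<Longrightarrow> xs ! i = (if even i then 2 * sgn j else 0)"
  shows "xs = gap j"
  using assms by (intro nth_equalityI) (auto simp: nth_gap)

lemma rev_gap [simp]: "rev (gap j) = gap j"
proof (rule gap_eqI)
  fix i assume "i < length (rev (gap j))"
  moreover from this have "even (length (gap j) - Suc i) \<longleftrightarrow> even i"
    using odd_length_gap[of j] by (auto simp: even_diff_nat)
  ultimately show "rev (gap j) ! i = (if even i then 2 * sgn j else 0)"
    by (auto simp: rev_nth nth_gap)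
qed simp

lemma hd_gap [simp]: "hd (gap j) = 2 * sgn j"
  using nth_gap[of 0 j] by (simp add: hd_conv_nth)

lemma last_gap [simp]: "last (gap j) = 2 * sgn j"
  by (metis hd_gap hd_rev rev_gap)

lemma length_scale [simp]: "length (scale e a) = length a"
  by (simp add: scale_def)

lemma scale_append [simp]: "scale e (a @ b) = scale e a @ scale e b"
  by (simp add: scale_def)

lemma rev_scale: "rev (scale e a) = scale e (rev a)"
  by (simp add: scale_def rev_map)

lemma scale_scale [simp]: "scale e (scale e' a) = scale (e * e') a"
  by (simp add: scale_def mult.assoc)

lemma scale_one [simp]: "scale 1 a = a"
  by (rule scale_1)

lemma scale_Nil [simp]: "scale e [] = []"
  by (simp add: scale_def)

lemma scale_eq_Nil [simp]: "scale e a = [] \<longleftrightarrow> a = []"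
  by (simp add: scale_def)

lemma hd_scale: "a \<noteq> [] \<Longrightarrow> hd (scale e a) = e * hd a"
  by (simp add: scale_def hd_map)

lemma last_scale: "a \<noteq> [] \<Longrightarrow> last (scale e a) = e * last a"
  by (simp add: scale_def last_map)

lemma scale_gap: "unit_sign e \<Longrightarrow> scale e (gap j) = gap (e * j)"
  by (rule gap_eqI) (auto simp: scale_def length_gap nth_gap)

lemma scale_inj: "unit_sign e \<Longrightarrow> scale e a = scale e b \<longleftrightarrow> a = b"
proof -
  assume e: "unit_sign e"
  have "scale e (scale e x) = x" for x using e by auto
  then show ?thesis by metis
qed

lemma sgn_length_gap_eq:
  assumes "sgn i = sgn j" "length (gap i) = length (gap j)"
  shows "i = j"
  using assms by (auto simp: length_gap sgn_if split: if_splits)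

text \<open>The condition on what follows a gap that makes the end of the gap recognisable.\<close>

definition nz :: "int list \<Rightarrow> bool" where
  "nz X \<longleftrightarrow> X \<noteq> [] \<and> hd X \<noteq> 0"

lemma nz_append [simp]: "X \<noteq> [] \<Longrightarrow> nz (X @ Y) \<longleftrightarrow> nz X"
  by (simp add: nz_def)

lemma nz_scale [simp]: "unit_sign e \<Longrightarrow> nz (scale e X) \<longleftrightarrow> nz X"
  by (auto simp: nz_def hd_scale)

lemma prefix_nth: "prefix xs ys \<Longrightarrow> i < length xs \<Longrightarrow> ys ! i = xs ! i"
  by (auto simp: prefix_def nth_append)

text \<open>The first entry gives the sign, with 0 for \<open>gap 0\<close>. If one gap were
  shorter, the nonzero entry after it would face an odd position of the longer gap, where the entry
  is 0, because gap lengths are odd. This makes reading a parsing from left to right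
  deterministic.\<close>

lemma prefix_gap:
  assumes "prefix (gap i @ X) (gap j @ Y)" "nz X" "nz Y"
  shows "i = j \<and> prefix X Y"
proof -
  let ?U = "gap i @ X" and ?V = "gap j @ Y"
  have nth: "?V ! t = ?U ! t" if "t < length ?U" for t
    using prefix_nth[OF assms(1) that] .
  have len: "length ?U \<le> length ?V"
    using assms(1) prefix_length_le by blast
  have X: "X \<noteq> []" "X ! 0 \<noteq> 0" and Y: "Y \<noteq> []" "Y ! 0 \<noteq> 0"
    using assms by (auto simp: nz_def hd_conv_nth)
  have pos: "0 < length (gap i)" "0 < length (gap j)" by simp_all
  have "sgn i = sgn j"
    using nth[of 0] pos by (simp add: nth_append nth_gap)
  moreover have "\<not> length (gap i) < length (gap j)"
  proof
    assume l: "length (gap i) < length (gap j)"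
    have "gap j ! length (gap i) = X ! 0"
      using nth[of "length (gap i)"] X(1) l by (simp add: nth_append)
    then show False
      using nth_gap[OF l] X by simp
  qed
  moreover have "\<not> length (gap j) < length (gap i)"
  proof
    assume l: "length (gap j) < length (gap i)"
    have "Y ! 0 = gap i ! length (gap j)"
      using nth[of "length (gap j)"] l by (simp add: nth_append)
    then show False
      using nth_gap[OF l] Y by simp
  qed
  ultimately have "i = j"
    by (meson linorder_neqE_nat sgn_length_gap_eq)
  then show ?thesis using assms(1) by simp
qed

lemma gap_append_eq:
  assumes "gap i @ X = gap j @ Y" "nz X" "nz Y"
  shows "i = j \<and> X = Y"
  using prefix_gap[of i X j Y] assms by auto

text \<open>Nonzero entries sit at even positions, so a cut behind one of them leaves a gap on
  either side of a single 0. This is how a gap of one parsing can meet a zero gap of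
  another.\<close>

lemma gap_split:
  assumes "gap j = U @ V" "U \<noteq> []" "V \<noteq> []" "last U \<noteq> 0"
  obtains u v where "U = gap u" "V = 0 # gap v" "j = u + v" "u \<noteq> 0" "v \<noteq> 0" "sgn u = sgn j" "sgn v = sgn j"
proof -
  have len: "length (gap j) = length U + length V" using assms(1) by simp
  have nU: "U ! i = (if even i then 2 * sgn j else 0)" if "i < length U" for i
    using nth_gap[of i j] that len assms(1) by (simp add: nth_append)
  have nV: "V ! i = (if even (length U + i) then 2 * sgn j else 0)" if "i < length V" for i
    using nth_gap[of "length U + i" j] that len assms(1) by (simp add: nth_append)
  have "last U = U ! (length U - 1)" using assms(2) by (simp add: last_conv_nth)
  then have oU: "odd (length U)"
    using nU[of "length U - 1"] assms(2,4) by (cases "length U") (auto split: if_splits)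
  have eV: "even (length V)" using odd_length_gap[of j] oU len by simp
  have j: "j \<noteq> 0"
    using len assms(2,3) by (auto simp: length_gap) (metis One_nat_def add_is_1 length_0_conv)
  define u where "u = sgn j * int ((length U + 1) div 2)"
  define v where "v = sgn j * int (length V div 2)"
  have sj: "sgn j = 1 \<or> sgn j = -1" using j by (auto simp: sgn_if)
  have hU: "length U = 2 * ((length U + 1) div 2) - 1" "0 < (length U + 1) div 2"
    using oU by presburger+
  have hV: "length V = 2 * (length V div 2)" "0 < length V div 2"
    using eV assms(3) by (auto elim!: evenE) (cases V; auto)
  have su: "sgn u = sgn j" "u \<noteq> 0" "nat \<bar>u\<bar> = (length U + 1) div 2"
    using hU(2) sj unfolding u_def by (auto simp: sgn_mult abs_mult)
  have sv: "sgn v = sgn j" "v \<noteq> 0" "nat \<bar>v\<bar> = length V div 2"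
    using hV(2) sj unfolding v_def by (auto simp: sgn_mult abs_mult)
  have 1: "U = gap u"
    by (rule gap_eqI) (use su hU nU in \<open>auto simp: length_gap\<close>)
  obtain x V' where V: "V = x # V'" using assms(3) by (cases V) auto
  have "x = 0" using nV[of 0] V oU by simp
  have 2: "V' = gap v"
  proof (rule gap_eqI)
    show "length V' = length (gap v)" using sv hV V by (auto simp: length_gap)
    fix i assume "i < length V'"
    then show "V' ! i = (if even i then 2 * sgn v else 0)"
      using nV[of "Suc i"] oU V sv by simp
  qed
  have 3: "j = u + v"
  proof -
    have "2 * nat \<bar>j\<bar> - 1 = length U + length V" using len j by (simp add: length_gap)
    then have "nat \<bar>j\<bar> = (length U + 1) div 2 + length V div 2"
      using oU eV hU hV by linarith
    then have "\<bar>j\<bar> = int ((length U + 1) div 2) + int (length V div 2)" by linarith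
    then show ?thesis unfolding u_def v_def
      by (metis distrib_left sgn_mult_abs)
  qed
  show ?thesis
    by (rule that[OF 1 _ 3 su(2) sv(2) su(1) sv(1)]) (simp add: V \<open>x = 0\<close> 2)
qed

text \<open>The source of the exceptional family: a zero gap between two copies of
  \<open>gap x\<close> is invisible.\<close>

lemma gap_double:
  assumes "x \<noteq> 0"
  shows "gap (2 * x) = gap x @ 0 # gap x"
proof (rule gap_eqI[symmetric])
  have l: "length (gap x) = 2 * nat \<bar>x\<bar> - 1" "length (gap (2 * x)) = 4 * nat \<bar>x\<bar> - 1" "0 < nat \<bar>x\<bar>"
    using assms by (auto simp: length_gap abs_mult nat_mult_distrib)
  then show "length (gap x @ 0 # gap x) = length (gap (2 * x))"
    by simp
  fix i assume i: "i < length (gap x @ 0 # gap x)"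
  have s: "sgn (2 * x) = sgn x" by (simp add: sgn_mult)
  have "\<exists>t. i = length (gap x) + Suc t" if "length (gap x) < i"
    using that less_iff_Suc_add by auto
  then consider "i < length (gap x)" | "i = length (gap x)" | t where "i = length (gap x) + Suc t" "t < length (gap x)"
    using i by (auto simp: not_less_iff_gr_or_eq) (metis less_iff_Suc_add nat_neq_iff add_less_cancel_left Suc_less_eq)
  then show "(gap x @ 0 # gap x) ! i = (if even i then 2 * sgn (2 * x) else 0)"
  proof cases
    case 3
    then have "(gap x @ 0 # gap x) ! i = gap x ! t" by (simp add: nth_append)
    then show ?thesis using 3 nth_gap[of t x] odd_length_gap[of x] s by simp
  qed (use odd_length_gap[of x] in \<open>auto simp: nth_append nth_gap s\<close>)
qed

text \<open>Removing the first block and gap reverses the block and allows a global sign on the rest.\<close>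

inductive pars :: "int list \<Rightarrow> int list \<Rightarrow> bool" where
  pars_base: "pars S S"
| pars_step: "pars (rev S) W \<Longrightarrow> unit_sign e \<Longrightarrow> (k = 0 \<longrightarrow> e = 1) \<Longrightarrow> pars S (S @ gap k @ scale e W)"

lemma pars_iff:
  "pars S Y \<longleftrightarrow> Y = S \<or> (\<exists>k e W. Y = S @ gap k @ scale e W \<and> unit_sign e \<and> (k = 0 \<longrightarrow> e = 1) \<and> pars (rev S) W)"
  by (subst pars.simps) auto

text \<open>Nonemptiness gives every block a nonzero first entry from which its sign can be read;
  the empty vector is handled separately.\<close>

definition block :: "int list \<Rightarrow> bool" where
  "block A \<longleftrightarrow> A \<noteq> [] \<and> hd A \<noteq> 0 \<and> last A \<noteq> 0 \<and> even (length A)"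

lemma block_rev [simp]: "block (rev A) \<longleftrightarrow> block A"
  by (auto simp: block_def hd_rev last_rev)

lemma block_nz: "block A \<Longrightarrow> nz A"
  by (simp add: block_def nz_def)

lemma pars_prefix: "pars S Y \<Longrightarrow> prefix S Y"
  by (auto elim: pars.cases)

lemma pars_nz: "pars S Y \<Longrightarrow> block S \<Longrightarrow> nz Y"
  by (metis pars_prefix block_nz prefix_def nz_append nz_def)

section \<open>Two parsings of one vector\<close>

text \<open>Here \<open>z\<close> may be empty, since the descent can reach the empty vector. For
  \<open>S\<close> of even length, evenness of \<open>z\<close> makes \<open>f\<close> and
  \<open>g\<close> odd in length.\<close>

definition balanced :: "int \<Rightarrow> int \<Rightarrow> int list \<Rightarrow> int list \<Rightarrow> bool" where
  "balanced d h S z \<longleftrightarrow> even (length z) \<and>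
     (\<exists>f g. S = z @ gap d @ g \<and> S = f @ gap h @ z \<and> rev f = f \<and> rev g = g)"

lemma prefix_split:
  assumes "prefix Y (U @ X)" "length U \<le> length Y"
  obtains Y1 where "Y = U @ Y1" "prefix Y1 X"
  using assms by (metis prefixI prefix_length_prefix prefix_def same_prefix_prefix)

lemma prefix_hd: "prefix X Y \<Longrightarrow> X \<noteq> [] \<Longrightarrow> hd X = hd Y"
  by (auto simp: prefix_def)

lemma pars_append: "pars S Y \<Longrightarrow> \<exists>T. Y = S @ T"
  using pars_prefix by (auto simp: prefix_def)

text \<open>\<open>Y\<close> begins with \<open>rev A\<close>, so the readings that begin with
  \<open>g\<close> and with \<open>rev z\<close> must follow the two decompositions of
  \<open>rev A\<close>; this fixes their gaps, and first entries of blocks fix their signs. The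
  unknown sign \<open>s\<close> is only visible beyond \<open>rev A\<close>, hence the bound on the
  length of \<open>Y\<close>.\<close>

lemma walk_step:
  assumes A: "block A" and A1: "rev A = g @ gap d @ scale s (rev z)" and A2: "rev A = rev z @ gap h @ f"
    and s: "unit_sign s" and f: "f \<noteq> []" "rev f = f"
    and Z: "prefix Y (rev z @ gap k' @ scale e3 Zt)" "pars A Zt" "unit_sign e3"
    and G: "prefix Y (g @ gap k @ scale e2 Gt)" "pars (rev A) Gt" "unit_sign e2"
    and E: "prefix Y (rev A @ gap k1 @ scale e1 Et)" "pars A Et" "unit_sign e1" "k1 = 0 \<longrightarrow> e1 = 1"
    and len: "length A + 2 \<le> length Y"
  shows "k' = h" "e3 = 1" "k = d" "e2 = 1" "scale s (rev z) = rev z"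
proof -
  have Af: "A = f @ gap h @ z"
    by (metis A2 append_assoc f(2) rev_append rev_gap rev_rev_ident)
  have hA: "hd A \<noteq> 0" "A \<noteq> []" "last A \<noteq> 0" using A by (auto simp: block_def)
  have hf: "hd f = hd A" using f(1) by (simp add: Af)
  have nzf: "nz (f @ X)" for X using f(1) hf hA by (simp add: nz_def)
  obtain Y1 where Y1: "Y = rev A @ Y1" "prefix Y1 (gap k1 @ scale e1 Et)"
    by (rule prefix_split[OF E(1)]) (use len in auto)
  have l1: "2 \<le> length Y1" using len Y1 by simp
  obtain tZ where tZ: "Zt = A @ tZ" using pars_append[OF Z(2)] by blast
  obtain tG where tG: "Gt = rev A @ tG" using pars_append[OF G(2)] by blast
  obtain tE where tE: "Et = A @ tE" using pars_append[OF E(2)] by blast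
  have "prefix (gap h @ (f @ Y1)) (gap k' @ scale e3 Zt)"
    using Z(1) Y1(1) by (simp add: A2)
  moreover have "nz (scale e3 Zt)" using Z(3) hA by (auto simp: tZ nz_def hd_scale)
  ultimately have k': "h = k'" and pZ: "prefix (f @ Y1) (scale e3 Zt)"
    using prefix_gap[OF _ nzf] by blast+
  show "k' = h" using k' by simp
  have "hd (f @ Y1) = hd (scale e3 Zt)" using prefix_hd[OF pZ] f(1) by simp
  then show e3: "e3 = 1" using f(1) hf hA Z(3) by (auto simp: tZ hd_scale)
  have pY1: "prefix Y1 (gap h @ z @ tZ)"
    using pZ by (simp add: e3 tZ Af)
  have hY1: "hd Y1 = 2 * sgn h" using prefix_hd[OF pY1] l1 by (cases Y1) auto
  have pG0: "prefix (gap d @ (scale s (rev z) @ Y1)) (gap k @ scale e2 Gt)"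
    using G(1) Y1(1) by (simp add: A1)
  have lz: "z \<noteq> [] \<Longrightarrow> last z \<noteq> 0" using hA by (simp add: Af)
  have h0: "z = [] \<Longrightarrow> h \<noteq> 0" using hA by (auto simp: Af)
  have "nz (scale s (rev z) @ Y1)"
  proof (cases "z = []")
    case True
    then show ?thesis using h0 hY1 l1 by (cases Y1) (auto simp: nz_def sgn_if)
  next
    case False
    then show ?thesis using lz s by (auto simp: nz_def hd_scale hd_rev)
  qed
  moreover have "nz (scale e2 Gt)"
    using G(3) hA by (auto simp: tG nz_def hd_scale hd_rev)
  ultimately have "d = k" and pG: "prefix (scale s (rev z) @ Y1) (scale e2 Gt)"
    using prefix_gap[OF pG0] by blast+
  then show "k = d" by simp
  have hG: "hd (scale s (rev z) @ Y1) = e2 * hd (rev A)"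
    using prefix_hd[OF pG] l1 hA by (cases Y1) (auto simp: tG hd_scale)
  have "e2 = 1 \<and> scale s (rev z) = rev z"
  proof (cases "z = []")
    case True
    then have "2 * sgn h = e2 * (2 * sgn h)"
      using hG hY1 A2 by simp
    then show ?thesis using True h0 G(3) by (auto simp: sgn_if split: if_splits)
  next
    case False
    have "hd (rev A) = last z" using False by (simp add: A2 hd_rev)
    then have es: "e2 = s"
      using hG False lz s G(3) by (auto simp: hd_scale hd_rev)
    have pY2: "prefix Y1 (scale s (gap h @ f @ tG))"
      using pG by (simp add: tG A2 es)
    \<comment> \<open>With the wrong sign the first entry after \<open>rev A\<close> equals its own
      negative, so \<open>h\<close> and \<open>k1\<close> vanish. A zero gap keeps the sign, and the
      next entry \<open>y1\<close> would be both \<open>hd A\<close> and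
      \<open>- hd f\<close>.\<close>
    have "s = 1"
    proof (rule ccontr)
      assume "s \<noteq> 1"
      then have sm: "s = -1" using s by simp
      have "hd Y1 = s * (2 * sgn h)" using prefix_hd[OF pY2] l1 by (cases Y1) (auto simp: hd_scale)
      then have "h = 0" using hY1 sm by (auto simp: sgn_if split: if_splits)
      have "hd Y1 = 2 * sgn k1" using prefix_hd[OF Y1(2)] l1 by (cases Y1) auto
      then have "k1 = 0" using hY1 \<open>h = 0\<close> by (auto simp: sgn_if split: if_splits)
      then have "e1 = 1" using E(4) by simp
      obtain y0 y1 ys where Y1e: "Y1 = y0 # y1 # ys" using l1
        by (metis One_nat_def Suc_1 Suc_le_length_iff)
      have "y1 = hd A"
        using Y1(2) \<open>k1 = 0\<close> \<open>e1 = 1\<close> hA by (cases A) (auto simp: Y1e tE)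
      moreover have "y1 = - hd f"
        using pY2 \<open>h = 0\<close> f(1) by (cases f) (auto simp: Y1e sm scale_def)
      ultimately show False using hf hA by simp
    qed
    then show ?thesis using es by simp
  qed
  then show "e2 = 1" "scale s (rev z) = rev z" by auto
qed

text \<open>The two outcomes of stripping \<open>A\<inverse>\<close> and a gap from \<open>Y\<close> repeatedly: each step exchanges the roles
  of \<open>(A, z, d, g, f, h)\<close> and \<open>(A\<inverse>, z\<inverse>, h, f, g, d)\<close>, hence the split by the parity of the length.\<close>

definition walked :: "int list \<Rightarrow> int \<Rightarrow> int \<Rightarrow> int list \<Rightarrow> bool" where
  "walked A d h Y \<longleftrightarrow>
     (\<exists>p q. Y = rev A @ gap h @ p \<and> rev p = p \<and> Y = q @ gap d @ rev A \<and> rev q = q \<and> even (length Y)) \<or>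
     (\<exists>p. Y = rev A @ gap h @ p \<and> rev Y = Y \<and> rev (A @ gap d @ rev p) = A @ gap d @ rev p \<and> odd (length Y))"

text \<open>Since \<open>rev z, h, A\<close> equals \<open>rev A, h, z\<close> and
  \<open>g, d, rev A\<close> equals \<open>rev A, h, f\<close>, stripping \<open>rev A\<close> and
  \<open>gap h\<close> turns the three readings into readings of the same kind for the reversed
  data. By the last premise, \<open>Y\<close> is all of one of the two inner readings, so the
  induction stops where that reading does.\<close>

lemma walk:
  assumes "block A" "A = z @ gap d @ g" "A = f @ gap h @ z" "rev f = f" "rev g = g" "even (length z)"
    and "prefix Y (rev A @ gap k1 @ scale e1 Et)" "pars A Et" "unit_sign e1" "k1 = 0 \<longrightarrow> e1 = 1"
    and "prefix Y (g @ gap k @ scale e2 Gt)" "pars (rev A) Gt" "unit_sign e2"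
    and "prefix Y (rev z @ gap k' @ scale e3 Zt)" "pars A Zt" "unit_sign e3"
    and "length (g @ gap k @ scale e2 Gt) \<le> length Y \<or> length (rev z @ gap k' @ scale e3 Zt) \<le> length Y"
  shows "walked A d h Y"
  using assms
proof (induction "length Y" arbitrary: A z d g f h Y k1 e1 Et k e2 Gt k' e3 Zt rule: less_induct)
  case less
  note A = less.prems(1) and Ag = less.prems(2) and Af = less.prems(3) and pf = less.prems(4)
    and pg = less.prems(5) and ez = less.prems(6) and E = less.prems(7-10) and G = less.prems(11-13)
    and Z = less.prems(14-16) and ex = less.prems(17)
  have hA: "hd A \<noteq> 0" "A \<noteq> []" "last A \<noteq> 0" "even (length A)" using A by (auto simp: block_def)
  have rA1: "rev A = g @ gap d @ rev z" by (simp add: Ag pg)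
  have rA2: "rev A = rev z @ gap h @ f" by (simp add: Af pf)
  have of: "odd (length f)" "odd (length g)"
    using ez hA(4) odd_length_gap[of h] odd_length_gap[of d] arg_cong[OF Af, of length] arg_cong[OF Ag, of length]
    by (simp_all, presburger+)
  have f: "f \<noteq> []" "g \<noteq> []" using of by auto
  have hf: "hd f = hd A" using f(1) by (simp add: Af)
  have lenZ: "length A \<le> length Zt" "length A \<le> length Gt"
    using prefix_length_le[OF pars_prefix[OF Z(2)]] prefix_length_le[OF pars_prefix[OF G(2)]] by auto
  show ?case
  \<comment> \<open>End of the reading through \<open>rev z\<close>: here \<open>Y\<close> is the
    palindrome \<open>rev z, h, f, h, z\<close> of odd length.\<close>
  proof (cases "Zt = A \<and> length (rev z @ gap k' @ scale e3 Zt) \<le> length Y")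
    case True
    then have Y: "Y = rev z @ gap k' @ scale e3 A"
      using Z(1) by (metis append_eq_append_conv prefix_def append_Nil2 prefix_length_le le_antisym)
    obtain Y1 where Y1: "Y = rev A @ Y1"
      by (rule prefix_split[OF E(1)]) (use Y in auto)
    have "gap h @ (f @ Y1) = gap k' @ scale e3 A" using Y Y1 by (simp add: rA2)
    then have "h = k' \<and> f @ Y1 = scale e3 A"
      by (rule gap_append_eq) (use f hf hA Z(3) in \<open>auto simp: nz_def hd_scale\<close>)
    moreover from this have "e3 = 1"
      using Z(3) hf hA f by (metis hd_append2 hd_scale mult_minus1 neg_equal_zero)
    ultimately have Y': "Y = rev z @ gap h @ f @ gap h @ z" using Y Af by simp
    then have "Y = rev A @ gap h @ z" "rev Y = Y" "odd (length Y)"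
      using ez pf of by (simp_all add: rA2)
    moreover have "rev (A @ gap d @ rev z) = A @ gap d @ rev z"
      by (simp add: Ag pg)
    ultimately show ?thesis unfolding walked_def by blast
  next
    case nZ: False
    have tails: "Zt = A \<or> (\<exists>k e W. Zt = A @ gap k @ scale e W \<and> unit_sign e \<and> (k = 0 \<longrightarrow> e = 1) \<and> pars (rev A) W)"
      using Z(2) pars_iff by blast
    have gtails: "Gt = rev A \<or> (\<exists>k e W. Gt = rev A @ gap k @ scale e W \<and> unit_sign e \<and> (k = 0 \<longrightarrow> e = 1) \<and> pars A W)"
      using G(2) pars_iff[of "rev A"] by simp
    have etails: "Et = A \<or> (\<exists>k e W. Et = A @ gap k @ scale e W \<and> unit_sign e \<and> (k = 0 \<longrightarrow> e = 1) \<and> pars (rev A) W)"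
      using E(2) pars_iff by blast
    have lW: "length A \<le> length W" if "pars A W \<or> pars (rev A) W" for W
      using that pars_prefix prefix_length_le by fastforce
    have l1: "1 \<le> length (gap x)" for x by (simp add: Suc_leI)
    have lf: "1 \<le> length f" "1 \<le> length g" using f by (simp_all add: Suc_leI)
    have lA: "length A = length f + length (gap h) + length z" using arg_cong[OF Af, of length] by simp
    have lA': "length A = length g + length (gap d) + length z" using arg_cong[OF Ag, of length] by simp
    have Zl: "2 * length A + 1 \<le> length Zt" if ne: "Zt \<noteq> A"
    proof -
      obtain x e W where W: "Zt = A @ gap x @ scale e W" "pars (rev A) W" using ne tails by blast
      then show ?thesis using lW[of W] l1[of x] by simp
    qed
    have Gl: "2 * length A + 1 \<le> length Gt" if ne: "Gt \<noteq> rev A"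
    proof -
      obtain x e W where W: "Gt = rev A @ gap x @ scale e W" "pars A W" using ne gtails by blast
      then show ?thesis using lW[of W] l1[of x] by simp
    qed
    have len: "length A + 2 \<le> length Y"
      using ex
    proof
      assume "length (g @ gap k @ scale e2 Gt) \<le> length Y"
      then show ?thesis using lenZ(2) lf(2) l1[of k] by simp
    next
      assume a: "length (rev z @ gap k' @ scale e3 Zt) \<le> length Y"
      then have "Zt \<noteq> A" using nZ by blast
      then show ?thesis using a Zl hA(2) l1[of k'] by simp
    qed
    have st: "k' = h" "e3 = 1" "k = d" "e2 = 1"
      using walk_step[OF A _ rA2 _ f(1) pf Z G E len, where s = 1 and d = d] rA1 by simp_all
    have gD: "g @ gap d @ rev A = rev A @ gap h @ f"
      by (simp add: rA1) (simp add: rA2 flip: rA1)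
    show ?thesis
    \<comment> \<open>End of the reading through \<open>g\<close>: here \<open>Y\<close> is both
      \<open>g, d, rev A\<close> and \<open>rev A, h, f\<close>, with palindromes \<open>g\<close>
      and \<open>f\<close>.\<close>
    proof (cases "Gt = rev A \<and> length (g @ gap k @ scale e2 Gt) \<le> length Y")
      case True
      then have "Y = g @ gap d @ rev A"
        using G(1) st by (metis append_eq_append_conv prefix_def append_Nil2 prefix_length_le le_antisym scale_one)
      moreover have "even (length Y)" using calculation of hA(4) by simp
      ultimately show ?thesis unfolding walked_def using gD pf pg by metis
    next
      case nG: False
      obtain tZ where tZ: "Zt = A @ tZ" using pars_append[OF Z(2)] by blast
      obtain tG where tG: "Gt = rev A @ tG" using pars_append[OF G(2)] by blast
      have zZ: "rev z @ gap h @ Zt = (rev A @ gap h) @ z @ tZ"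
        unfolding tZ by (subst Af) (simp add: rA2)
      have gG: "g @ gap d @ Gt = (rev A @ gap h) @ f @ tG"
        using gD tG by (metis append_assoc)
      have ex': "length (f @ tG) + length (rev A @ gap h) \<le> length Y \<and> Gt \<noteq> rev A \<or>
          length (z @ tZ) + length (rev A @ gap h) \<le> length Y \<and> Zt \<noteq> A"
        using ex nZ nG arg_cong[OF zZ, of length] arg_cong[OF gG, of length] st by auto
      have gt: "length A < length (z @ tZ) \<or> Zt = A" "length A < length (f @ tG) \<or> Gt = rev A"
        using Zl Gl tZ tG by auto
      have big: "length (rev A @ gap h) + length A < length Y"
        using ex' gt by linarith
      obtain Y2 where Y2: "Y = (rev A @ gap h) @ Y2" and pZ: "prefix Y2 (z @ tZ)"
        by (rule prefix_split[of Y "rev A @ gap h" "z @ tZ"]) (use Z(1) zZ st big in auto)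
      have pG: "prefix Y2 (f @ tG)"
        using G(1) gG st Y2 by simp
      have lY2: "length A < length Y2" using big Y2 by simp
      then have "Y2 \<noteq> []" by auto
      have hY2: "hd Y2 = hd A" using prefix_hd[OF pG \<open>Y2 \<noteq> []\<close>] f(1) hf by simp
      obtain tE where tE: "Et = A @ tE" using pars_append[OF E(2)] by blast
      have "prefix (gap h @ Y2) (gap k1 @ scale e1 Et)" using E(1) Y2 by simp
      moreover have "nz Y2" "nz (scale e1 Et)"
        using hY2 \<open>Y2 \<noteq> []\<close> hA E(3) by (auto simp: nz_def tE hd_scale)
      ultimately have "h = k1" and pE': "prefix Y2 (scale e1 Et)"
        using prefix_gap by blast+
      have "e1 = 1"
        using prefix_hd[OF pE' \<open>Y2 \<noteq> []\<close>] hY2 hA E(3) by (auto simp: tE hd_scale)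
      then have pE: "prefix Y2 Et" using pE' by simp
      have "Et \<noteq> A" using pE lY2 prefix_length_le by fastforce
      then obtain kE eE WE where WE: "Et = A @ gap kE @ scale eE WE" "unit_sign eE"
        "kE = 0 \<longrightarrow> eE = 1" "pars (rev A) WE" using etails by blast
      have "Gt \<noteq> rev A" using pG lY2 prefix_length_le[OF pG] lA tG by auto
      then obtain kG eG WG where WG: "tG = gap kG @ scale eG WG" "unit_sign eG" "pars A WG"
        using gtails tG by auto
      have "Zt \<noteq> A" using pZ lY2 prefix_length_le[OF pZ] lA tZ by auto
      then obtain kZ eZ WZ where WZ: "tZ = gap kZ @ scale eZ WZ" "unit_sign eZ" "pars (rev A) WZ"
        using tails tZ by auto
      have w: "walked (rev A) h d Y2"
      proof (rule less.hyps[of Y2 "rev A" "rev z" h f g d kE eE WE kG eG WG kZ eZ WZ])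
        show "length Y2 < length Y" using Y2 hA by simp
        show "length (f @ gap kG @ scale eG WG) \<le> length Y2 \<or> length (rev (rev z) @ gap kZ @ scale eZ WZ) \<le> length Y2"
          using ex' Y2 WG(1) WZ(1) by auto
        show "prefix Y2 (f @ gap kG @ scale eG WG)" "prefix Y2 (rev (rev z) @ gap kZ @ scale eZ WZ)"
          using pG pZ WG WZ by auto
        show "prefix Y2 (rev (rev A) @ gap kE @ scale eE WE)" using pE WE by simp
        show "pars (rev (rev A)) WG" using WG(3) by (simp only: rev_rev_ident)
        show "block (rev A)" "even (length (rev z))" using A ez by simp_all
      qed (fact rA1 rA2 pf pg WE WG WZ)+
      then consider
          p q where "Y2 = A @ gap d @ p" "rev p = p" "Y2 = q @ gap h @ A" "rev q = q" "even (length Y2)"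
        | p where "Y2 = A @ gap d @ p" "rev Y2 = Y2" "rev (rev A @ gap h @ rev p) = rev A @ gap h @ rev p" "odd (length Y2)"
        unfolding walked_def rev_rev_ident by blast
      then show ?thesis
      proof cases
        case 1
        have "rev Y2 = rev A @ gap h @ q" "rev Y2 = p @ gap d @ rev A"
          using 1 by (metis append_assoc rev_append rev_gap)+
        then have "rev Y = Y" "rev (A @ gap d @ rev Y2) = A @ gap d @ rev Y2"
          using Y2 1 by simp_all
        moreover have "odd (length Y)"
          using Y2 1(5) hA(4) by simp
        ultimately show ?thesis unfolding walked_def using Y2 by auto
      next
        case 2
        have "Y2 = rev p @ gap d @ rev A" using 2 by (metis append_assoc rev_append rev_gap)
        then have "Y = (rev A @ gap h @ rev p) @ gap d @ rev A" using Y2 by simp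
        moreover have "even (length Y)" using Y2 2(4) hA(4) by simp
        ultimately show ?thesis unfolding walked_def using Y2 2 by auto
      qed
    qed
  qed
qed

section \<open>Concatenation, reversal and cutting of parsings\<close>

lemma scale_cancel: "unit_sign e \<Longrightarrow> scale e (scale e a) = a"
  by auto

lemma pars_length_le: "pars S Y \<Longrightarrow> length S \<le> length Y"
  by (simp add: pars_prefix prefix_length_le)

lemma pars_hd: "pars S Y \<Longrightarrow> S \<noteq> [] \<Longrightarrow> hd Y = hd S"
  by (metis pars_prefix prefix_hd)

lemma pars_neq_Nil: "pars S Y \<Longrightarrow> S \<noteq> [] \<Longrightarrow> Y \<noteq> []"
  by (metis pars_prefix prefix_Nil)

text \<open>Blocks have even and gaps odd length, so \<open>V\<close> has even length exactly if its
  last block has the orientation of \<open>S\<close>. The sign rule at a zero gap is expressed by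
  entries, \<open>e * hd W = last V\<close>, so that the accumulated sign of the last block need not
  be tracked.\<close>

lemma pars_append_pars:
  assumes "pars S V" "block S" "pars (if even (length V) then rev S else S) W" "unit_sign e"
    "k = 0 \<longrightarrow> e * hd W = last V"
  shows "pars S (V @ gap k @ scale e W)"
  using assms
proof (induction arbitrary: e W k rule: pars.induct)
  case (pars_base S)
  then have S: "even (length S)" "hd (rev S) = last S" "last S \<noteq> 0" "rev S \<noteq> []"
    by (auto simp: block_def hd_rev)
  have W: "pars (rev S) W" using pars_base.prems(2) S by simp
  have "hd W = last S" using pars_hd[OF W] S by simp
  then have "k = 0 \<longrightarrow> e = 1" using pars_base.prems(4) S by auto
  then show ?case using W pars_base.prems(3) by (intro pars.pars_step)
next
  case (pars_step S V' e' k')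
  have V': "V' \<noteq> []" using pars_neq_Nil[OF pars_step.hyps(1)] pars_step.prems(1) by (simp add: block_def)
  have ev: "even (length (S @ gap k' @ scale e' V')) \<longleftrightarrow> odd (length V')"
    using pars_step.prems(1) by (auto simp: block_def)
  have "pars (rev S) (V' @ gap (e' * k) @ scale (e' * e) W)"
  proof (rule pars_step.IH)
    show "pars (if even (length V') then rev (rev S) else rev S) W"
      using pars_step.prems(2) ev by auto
    have "last (S @ gap k' @ scale e' V') = e' * last V'" using V' by (simp add: last_scale)
    then show "e' * k = 0 \<longrightarrow> e' * e * hd W = last V'"
      using pars_step.hyps(2) pars_step.prems(4) by auto
  qed (use pars_step in auto)
  then have "pars S (S @ gap k' @ scale e' (V' @ gap (e' * k) @ scale (e' * e) W))"
    using pars_step.hyps by (intro pars.pars_step)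
  moreover have "scale e' (gap (e' * k)) = gap k" "e' * (e' * e) = e"
    using pars_step.hyps(2) by (auto simp: scale_gap)
  ultimately show ?case by simp
qed

text \<open>The first block of the reversal may carry the sign -1, whereas \<open>pars\<close>
  normalises it to 1; hence the factor \<open>e\<close>.\<close>

lemma pars_rev:
  assumes "pars S Y" "block S"
  shows "\<exists>e. unit_sign e \<and> pars (if even (length Y) then rev S else S) (scale e (rev Y))"
  using assms
proof (induction rule: pars.induct)
  case (pars_base S)
  then show ?case by (intro exI[of _ 1]) (auto simp: block_def pars.pars_base)
next
  case (pars_step S W e k)
  then obtain e' where e': "unit_sign e'"
    and p: "pars (if even (length W) then rev (rev S) else rev S) (scale e' (rev W))" by auto
  let ?T = "if even (length W) then S else rev S"
  have W: "W \<noteq> []" "hd W = last S"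
    using pars_neq_Nil[OF pars_step.hyps(1)] pars_hd[OF pars_step.hyps(1)] pars_step.prems
    by (auto simp: block_def hd_rev)
  have eS: "even (length S)" "S \<noteq> []" using pars_step.prems by (auto simp: block_def)
  have "pars ?T (scale e' (rev W) @ gap (e' * e * k) @ scale (e' * e) (rev S))"
  proof (rule pars_append_pars)
    show "pars (if even (length (scale e' (rev W))) then rev ?T else ?T) (rev S)"
      by (auto simp: pars.pars_base)
    show "e' * e * k = 0 \<longrightarrow> e' * e * hd (rev S) = last (scale e' (rev W))"
      using W e' pars_step.hyps(2,3) eS by (auto simp: last_scale last_rev hd_rev)
  qed (use p e' pars_step in auto)
  moreover have "scale (e' * e) (rev (S @ gap k @ scale e W)) =
      scale e' (rev W) @ gap (e' * e * k) @ scale (e' * e) (rev S)"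
    using e' pars_step.hyps(2) by (auto simp: rev_scale scale_gap)
  moreover have "?T = (if even (length (S @ gap k @ scale e W)) then rev S else S)"
    using eS by auto
  ultimately show ?case using e' pars_step.hyps(2) by (intro exI[of _ "e' * e"]) auto
qed

text \<open>Unique reading of gaps and signs: a parsing of \<open>V @ T\<close> has to repeat the
  one of \<open>V\<close>, so it also has a block ending where \<open>V\<close> ends.\<close>

lemma pars_sync:
  assumes "pars S V" "block S" "pars S (V @ T)" "T \<noteq> []"
  shows "\<exists>k e W. T = gap k @ scale e W \<and> unit_sign e \<and> (k = 0 \<longrightarrow> e * hd W = last V) \<and>
    pars (if even (length V) then rev S else S) W"
  using assms
proof (induction arbitrary: T rule: pars.induct)
  case (pars_base S)
  then obtain k e W where "T = gap k @ scale e W" "unit_sign e" "k = 0 \<longrightarrow> e = 1" "pars (rev S) W"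
    using pars_iff[of S "S @ T"] by (metis append_self_conv same_append_eq)
  moreover from this have "hd W = last S"
    using pars_hd[of "rev S" W] pars_base by (auto simp: block_def hd_rev)
  moreover have "even (length S)" using pars_base(1) by (simp add: block_def)
  ultimately show ?case by (intro exI[of _ k] exI[of _ e] exI[of _ W]) auto
next
  case (pars_step S V' e k)
  have S: "S \<noteq> []" "even (length S)" "last S \<noteq> 0" using pars_step.prems by (auto simp: block_def)
  have "(S @ gap k @ scale e V') @ T \<noteq> S" by simp
  then obtain k' e' W' where W'0: "(S @ gap k @ scale e V') @ T = S @ gap k' @ scale e' W'"
    and W': "unit_sign e'" "pars (rev S) W'"
    using pars_step.prems(2) pars_iff[of S "(S @ gap k @ scale e V') @ T"] by blast
  have hds: "hd V' = last S" "hd W' = last S" "V' \<noteq> []" "W' \<noteq> []"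
    using pars_hd[OF pars_step.hyps(1)] pars_hd[OF W'(2)] pars_neq_Nil[OF pars_step.hyps(1)] pars_neq_Nil[OF W'(2)] S
    by (auto simp: hd_rev)
  have "k = k' \<and> scale e V' @ T = scale e' W'"
    by (rule gap_append_eq) (use W'0 W'(1) hds S pars_step.hyps(2) in \<open>auto simp: nz_def hd_scale\<close>)
  then have eq: "scale e V' @ T = scale e' W'" by simp
  have "hd (scale e V' @ T) = e * last S" using hds by (simp add: hd_scale)
  moreover have "hd (scale e' W') = e' * last S" using hds by (simp add: hd_scale)
  ultimately have "e = e'" using eq S by simp
  then have "scale e (scale e V' @ T) = scale e (scale e W')" using eq by simp
  then have "V' @ scale e T = W'"
    using pars_step.hyps(2) by (simp only: scale_append scale_cancel)
  then have "pars (rev S) (V' @ scale e T)" using W' by simp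
  then obtain k2 e2 W2 where W2: "scale e T = gap k2 @ scale e2 W2" "unit_sign e2" "k2 = 0 \<longrightarrow> e2 * hd W2 = last V'"
      "pars (if even (length V') then rev (rev S) else rev S) W2"
    using pars_step.IH[of "scale e T"] pars_step.prems(1,3) by (metis block_rev scale_eq_Nil)
  have "T = scale e (scale e T)" using pars_step.hyps(2) by auto
  also have "\<dots> = gap (e * k2) @ scale (e * e2) W2"
    using pars_step.hyps(2) W2(1) by (simp add: scale_gap)
  finally have "T = gap (e * k2) @ scale (e * e2) W2" .
  moreover have "pars (if even (length (S @ gap k @ scale e V')) then rev S else S) W2"
    using W2(4) S by auto
  moreover have "e * k2 = 0 \<longrightarrow> e * e2 * hd W2 = last (S @ gap k @ scale e V')"
    using W2(3) hds pars_step.hyps(2) by (auto simp: last_scale)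
  ultimately show ?case using W2(2) pars_step.hyps(2)
    by (intro exI[of _ "e * k2"] exI[of _ "e * e2"] exI[of _ W2]) auto
qed

text \<open>Where a cut \<open>Y = b @ R\<close> of a parsed vector can fall when \<open>b\<close> does not end with a block: inside
  (or just before) the block \<open>X @ X'\<close>, or properly inside a gap.\<close>

definition in_block :: "int list \<Rightarrow> int list \<Rightarrow> int list \<Rightarrow> bool" where
  "in_block S b R \<longleftrightarrow> (\<exists>L X X' M s. b = L @ X \<and> R = X' @ M \<and> X' \<noteq> [] \<and> unit_sign s \<and>
     X @ X' = scale s (if even (length L) then S else rev S) \<and>
     (L = [] \<and> s = 1 \<or>
       (\<exists>V k. L = V @ gap k \<and> pars S V \<and> (k = 0 \<longrightarrow> last V = hd (X @ X')))) \<and>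
     (M = [] \<or> (\<exists>k e W. M = gap k @ scale e W \<and> unit_sign e \<and> (k = 0 \<longrightarrow> e * hd W = last X') \<and>
       pars (if even (length L) then rev S else S) W)))"

definition in_gap :: "int list \<Rightarrow> int list \<Rightarrow> int list \<Rightarrow> bool" where
  "in_gap S b R \<longleftrightarrow> (\<exists>V k1 k2 k s W. b = V @ k1 \<and> gap k = k1 @ k2 \<and> k1 \<noteq> [] \<and> k2 \<noteq> [] \<and> pars S V \<and>
     R = k2 @ scale s W \<and> unit_sign s \<and> pars (if even (length V) then rev S else S) W)"

lemma in_block_step:
  assumes "in_block (rev S) b' (scale e R)" "unit_sign e" "k = 0 \<longrightarrow> e = 1" "block S"
    and "\<And>V. pars (rev S) V \<Longrightarrow> pars S (S @ gap k @ scale e V)"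
  shows "in_block S (S @ gap k @ scale e b') R"
proof -
  have S: "S \<noteq> []" "even (length S)" "last S \<noteq> 0" using assms by (auto simp: block_def)
  obtain L X X' M s where *: "b' = L @ X" "scale e R = X' @ M" "X' \<noteq> []" "unit_sign s"
    "X @ X' = scale s (if even (length L) then rev S else S)"
    "L = [] \<and> s = 1 \<or> (\<exists>V k. L = V @ gap k \<and> pars (rev S) V \<and> (k = 0 \<longrightarrow> last V = hd (X @ X')))"
    "M = [] \<or> (\<exists>k e W. M = gap k @ scale e W \<and> unit_sign e \<and> (k = 0 \<longrightarrow> e * hd W = last X') \<and>
       pars (if even (length L) then S else rev S) W)"
    using assms(1) unfolding in_block_def rev_rev_ident by (elim exE conjE) (rule that; assumption)
  let ?L = "S @ gap k @ scale e L"
  have ev: "even (length ?L) \<longleftrightarrow> odd (length L)" using S by simp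
  have XX: "X @ X' \<noteq> []" using *(3) by simp
  have h1: "scale e X @ scale e X' = scale (e * s) (if even (length ?L) then S else rev S)"
    using arg_cong[OF *(5), of "scale e"] ev by (cases "even (length L)") (simp_all only: scale_append scale_scale if_True if_False simp_thms)
  have h2: "\<exists>V k. ?L = V @ gap k \<and> pars S V \<and> (k = 0 \<longrightarrow> last V = hd (scale e X @ scale e X'))"
    using *(6)
  proof
    assume l: "L = [] \<and> s = 1"
    then have "scale e X @ scale e X' = scale e (rev S)" using arg_cong[OF *(5), of "scale e"] by simp
    then show ?thesis using l assms(3) S
      by (intro exI[of _ S] exI[of _ k]) (auto simp: pars.pars_base hd_scale hd_rev)
  next
    assume "\<exists>V k. L = V @ gap k \<and> pars (rev S) V \<and> (k = 0 \<longrightarrow> last V = hd (X @ X'))"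
    then obtain V k2 where V: "L = V @ gap k2" "pars (rev S) V" "k2 = 0 \<longrightarrow> last V = hd (X @ X')" by blast
    have "V \<noteq> []" using pars_neq_Nil[OF V(2)] S by simp
    moreover have "hd (scale e X @ scale e X') = e * hd (X @ X')"
      using XX hd_scale[of "X @ X'" e] by simp
    ultimately show ?thesis using V assms(2,5)
      by (intro exI[of _ "S @ gap k @ scale e V"] exI[of _ "e * k2"]) (auto simp: scale_gap last_scale)
  qed
  have h3: "scale e M = [] \<or> (\<exists>k e' W. scale e M = gap k @ scale e' W \<and> unit_sign e' \<and> (k = 0 \<longrightarrow> e' * hd W = last (scale e X')) \<and>
       pars (if even (length ?L) then rev S else S) W)"
    using *(7)
  proof
    assume "\<exists>k e W. M = gap k @ scale e W \<and> unit_sign e \<and> (k = 0 \<longrightarrow> e * hd W = last X') \<and>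
       pars (if even (length L) then S else rev S) W"
    then obtain k2 e2 W where V: "M = gap k2 @ scale e2 W" "unit_sign e2" "k2 = 0 \<longrightarrow> e2 * hd W = last X'"
      "pars (if even (length L) then S else rev S) W" by blast
    have "X' \<noteq> []" by (fact *(3))
    show ?thesis
    proof (rule disjI2, intro exI conjI)
      show "scale e M = gap (e * k2) @ scale (e * e2) W" using V(1) assms(2) by (simp add: scale_gap)
      show "unit_sign (e * e2)" using V(2) assms(2) by auto
      show "e * k2 = 0 \<longrightarrow> e * e2 * hd W = last (scale e X')"
        using V(3) assms(2) \<open>X' \<noteq> []\<close> by (auto simp: last_scale)
      show "pars (if even (length ?L) then rev S else S) W" using V(4) ev by auto
    qed
  qed simp
  have h4: "R = scale e X' @ scale e M"
    using arg_cong[OF *(2), of "scale e"] assms(2) by (simp only: scale_append scale_cancel)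
  show ?thesis
    unfolding in_block_def
  proof (intro exI conjI)
    show "S @ gap k @ scale e b' = ?L @ scale e X" using *(1) by simp
    show "R = scale e X' @ scale e M" by (fact h4)
    show "scale e X' \<noteq> []" using *(3) by simp
    show "unit_sign (e * s)" using *(4) assms(2) by auto
    show "?L = [] \<and> e * s = 1 \<or>
       (\<exists>V k. ?L = V @ gap k \<and> pars S V \<and> (k = 0 \<longrightarrow> last V = hd (scale e X @ scale e X')))"
      using h2 by blast
  qed (fact h1 h3)+
qed

lemma in_gap_step:
  assumes "in_gap (rev S) b' (scale e R)" "unit_sign e" "block S"
    and "\<And>V. pars (rev S) V \<Longrightarrow> pars S (S @ gap k @ scale e V)"
  shows "in_gap S (S @ gap k @ scale e b') R"
proof -
  have S: "even (length S)" using assms by (auto simp: block_def)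
  obtain V k1 k2 k' s W where *: "b' = V @ k1" "gap k' = k1 @ k2" "k1 \<noteq> []" "k2 \<noteq> []" "pars (rev S) V"
     "scale e R = k2 @ scale s W" "unit_sign s" "pars (if even (length V) then S else rev S) W"
    using assms(1) unfolding in_gap_def rev_rev_ident by blast
  have "R = scale e k2 @ scale (e * s) W"
    using arg_cong[OF *(6), of "scale e"] unfolding scale_cancel[OF assms(2)] by simp
  moreover have "gap (e * k') = scale e k1 @ scale e k2"
    using arg_cong[OF *(2), of "scale e"] assms(2) by (simp only: scale_append scale_gap)
  moreover have "pars (if even (length (S @ gap k @ scale e V)) then rev S else S) W"
    using *(8) S by auto
  moreover have "unit_sign (e * s)" using *(7) assms(2) by auto
  moreover have "S @ gap k @ scale e b' = (S @ gap k @ scale e V) @ scale e k1" using *(1) by simp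
  moreover have "scale e k1 \<noteq> []" "scale e k2 \<noteq> []" using *(3,4) by simp_all
  ultimately show ?thesis
    unfolding in_gap_def using assms(4)[OF *(5)] by blast
qed

lemma pars_locate:
  assumes "pars S Y" "Y = b @ R" "R \<noteq> []" "block S"
  shows "pars S b \<or> in_block S b R \<or> in_gap S b R"
  using assms
proof (induction arbitrary: b R rule: pars.induct)
  case (pars_base S)
  have "in_block S b R"
    unfolding in_block_def
    by (intro exI[of _ "[]"] exI[of _ b] exI[of _ R] exI[of _ 1]) (use pars_base in auto)
  then show ?case by blast
next
  case (pars_step S W e k)
  have S: "S \<noteq> []" "even (length S)" "last S \<noteq> 0" using pars_step.prems by (auto simp: block_def)
  have W: "W \<noteq> []" "hd W = last S"
    using pars_neq_Nil[OF pars_step.hyps(1)] pars_hd[OF pars_step.hyps(1)] S by (auto simp: hd_rev)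
  note eq = pars_step.prems(1)
  consider "length b < length S" | "length b = length S"
    | "length S < length b" "length b < length S + length (gap k)" | "length S + length (gap k) \<le> length b"
    by linarith
  then show ?case
  proof cases
    case 1
    then obtain X' where X': "S = b @ X'" "R = X' @ gap k @ scale e W"
      using eq by (auto simp: append_eq_append_conv2)
    then have "X' \<noteq> []" using 1 by auto
    have "in_block S b R"
      unfolding in_block_def
    proof (intro exI conjI)
      show "b = [] @ b" "R = X' @ gap k @ scale e W" "X' \<noteq> []" "unit_sign 1" using X' \<open>X' \<noteq> []\<close> by auto
      show "b @ X' = scale 1 (if even (length []) then S else rev S)" using X' by simp
      show "gap k @ scale e W = [] \<or> (\<exists>k' e' W'. gap k @ scale e W = gap k' @ scale e' W' \<and> unit_sign e' \<and>
         (k' = 0 \<longrightarrow> e' * hd W' = last X') \<and> pars (if even (length []) then rev S else S) W')"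
      proof (rule disjI2, intro exI conjI)
        show "gap k @ scale e W = gap k @ scale e W" "unit_sign e" using pars_step.hyps by auto
        show "pars (if even (length []) then rev S else S) W" using pars_step.hyps by simp
        show "k = 0 \<longrightarrow> e * hd W = last X'" using pars_step.hyps W X' \<open>X' \<noteq> []\<close> by simp
      qed
    qed auto
    then show ?thesis by blast
  next
    case 2
    then have "b = S" using eq by (metis append_eq_append_conv)
    then show ?thesis by (simp add: pars.pars_base)
  next
    case 3
    then obtain k1 where k1: "b = S @ k1" "gap k @ scale e W = k1 @ R"
      using eq by (auto simp: append_eq_append_conv2)
    then obtain k2 where k2: "gap k = k1 @ k2" "R = k2 @ scale e W"
      using 3 by (auto simp: append_eq_append_conv2)
    have "in_gap S b R"
      unfolding in_gap_def
    proof (intro exI conjI)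
      show "b = S @ k1" "gap k = k1 @ k2" "R = k2 @ scale e W" using k1 k2 by simp_all
      show "k1 \<noteq> []" "k2 \<noteq> []" using 3 k1 k2 by auto
      show "pars (if even (length S) then rev S else S) W" using S pars_step.hyps by simp
    qed (fact pars_step.hyps pars.pars_base)+
    then show ?thesis by blast
  next
    case 4
    then obtain b0 where b0: "b = S @ gap k @ b0" "scale e W = b0 @ R"
      using eq by (auto simp: append_eq_append_conv2)
    then have b': "b = S @ gap k @ scale e (scale e b0)" "W = scale e b0 @ scale e R"
      using pars_step.hyps(2) scale_cancel by (simp, metis scale_append scale_cancel)
    let ?b = "scale e b0"
    have st: "pars S (S @ gap k @ scale e V)" if "pars (rev S) V" for V
      using that pars_step.hyps by (intro pars.pars_step)
    have "pars (rev S) ?b \<or> in_block (rev S) ?b (scale e R) \<or> in_gap (rev S) ?b (scale e R)"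
      using pars_step.IH[OF b'(2)] pars_step.prems by simp
    then show ?thesis
      using in_block_step[of S ?b e R k] in_gap_step[of S ?b e R k] st pars_step.hyps(2,3) pars_step.prems(3)
      unfolding b'(1) by blast
  qed
qed

section \<open>From a common upper bound to a balanced pair\<close>

lemma rev_vecs:
  assumes "b \<in> vecs"
  shows "rev b \<in> vecs"
proof -
  have b1: "set b \<subseteq> {-2, 0, 2}" "b \<noteq> [] \<Longrightarrow> hd b \<noteq> 0 \<and> last b \<noteq> 0"
    and b2: "\<And>i. 0 < i \<Longrightarrow> Suc i < length b \<Longrightarrow> b ! i = 0 \<Longrightarrow>
      b ! (i - 1) = b ! Suc i \<and> b ! Suc i \<in> {-2, 2}"
    using assms unfolding vecs_def by auto
  have "rev b ! (i - 1) = rev b ! Suc i \<and> rev b ! Suc i \<in> {-2, 2}"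
    if i: "0 < i" "Suc i < length b" "rev b ! i = 0" for i
  proof -
    define j where "j = length b - Suc i"
    have "0 < j" "Suc j < length b" "rev b ! i = b ! j" "rev b ! (i - 1) = b ! Suc j"
      "rev b ! Suc i = b ! (j - 1)"
      using i by (auto simp: j_def rev_nth Suc_diff_Suc)
    then show ?thesis using b2[of j] i by auto
  qed
  then show ?thesis
    using b1 by (auto simp: vecs_def hd_rev last_rev)
qed

text \<open>In an antipalindrome of odd length the middle entry is 0 and its neighbours are
  opposite, whereas a zero entry of an expanded even vector has equal nonzero neighbours.\<close>

lemma vecs_antipalindrome:
  assumes "r \<in> vecs" "prefix P r" "odd (length P)" "unit_sign s" "P = scale s (rev P)"
  shows "s = 1"
proof (rule ccontr)
  assume "s \<noteq> 1"
  then have P: "P = scale (-1) (rev P)" using assms(4,5) by auto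
  have nth: "P ! i = - P ! (length P - Suc i)" if "i < length P" for i
  proof -
    have "P ! i = scale (-1) (rev P) ! i" using P by simp
    then show ?thesis using that by (simp add: scale_def rev_nth)
  qed
  obtain c where c: "length P = 2 * c + 1" using assms(3) oddE by blast
  have "P \<noteq> []" using assms(3) by auto
  have "P ! c = 0" using nth[of c] c by (simp add: numeral_2_eq_2)
  have "r \<noteq> []" using \<open>P \<noteq> []\<close> assms(2) by auto
  then have "hd r \<noteq> 0" using assms(1) by (simp add: vecs_def)
  then have "P ! 0 \<noteq> 0" using prefix_hd[OF assms(2)] \<open>P \<noteq> []\<close> by (simp add: hd_conv_nth)
  then have "0 < c" using \<open>P ! c = 0\<close> by (cases c) auto
  have rP: "r ! i = P ! i" if "i < length P" for i using prefix_nth[OF assms(2) that] .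
  have "Suc c < length r" using c \<open>0 < c\<close> prefix_length_le[OF assms(2)] by simp
  then have "r ! (c - 1) = r ! Suc c \<and> r ! Suc c \<in> {-2, 2}"
    using assms(1) \<open>0 < c\<close> \<open>P ! c = 0\<close> rP[of c] c unfolding vecs_def by auto
  moreover have "r ! (c - 1) = P ! (c - 1)" "r ! Suc c = P ! Suc c"
    using rP c \<open>0 < c\<close> by auto
  moreover have "P ! (c - 1) = - P ! Suc c"
    using nth[of "c - 1"] c \<open>0 < c\<close> by (simp add: numeral_2_eq_2)
  ultimately show False by auto
qed

text \<open>The broken block is \<open>rev P, d, Q\<close> up to signs. As \<open>P\<close> and
  \<open>Q\<close> are prefixes of \<open>Y\<close>, they are also prefixes of \<open>rev a\<close>;
  these overlaps make \<open>P\<close> and the remainder \<open>f\<close> palindromes up to sign,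
  and \<open>vecs_antipalindrome\<close> removes the signs because both have odd length. Then
  \<open>walk\<close> applies with \<open>z = rev Q\<close> and \<open>g = P\<close>.\<close>

lemma pair_core:
  assumes a: "block a" "a \<in> vecs" and Y: "even (length Y)" "length a < length Y"
    and Ec: "prefix Y Ec" "pars (rev a) Ec"
    and rel: "scale s1 (rev a) = rev P @ gap d @ scale s Q" "unit_sign s1" "unit_sign s"
    and PQ: "odd (length P)" "even (length Q)"
    and G: "prefix Y (P @ gap k @ scale e2 Gt)" "pars (rev a) Gt" "unit_sign e2"
    and Z: "prefix Y (Q @ gap k' @ scale e3 Zt)" "pars a Zt" "unit_sign e3"
    and ex: "length (P @ gap k @ scale e2 Gt) \<le> length Y \<or> length (Q @ gap k' @ scale e3 Zt) \<le> length Y"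
  shows "\<exists>d h p q. Y = rev a @ gap h @ p \<and> rev p = p \<and> Y = q @ gap d @ rev a \<and> rev q = q"
proof -
  have ha: "a \<noteq> []" "hd a \<noteq> 0" "last a \<noteq> 0" "even (length a)" using a by (auto simp: block_def)
  have rav: "rev a \<in> vecs" using a rev_vecs by blast
  have la: "length a = length P + length (gap d) + length Q" using arg_cong[OF rel(1), of length] by simp
  obtain Y1 where Y1: "Y = rev a @ Y1"
    using Ec Y pars_prefix[OF Ec(2)] by (metis length_rev less_imp_le_nat prefix_length_prefix prefix_def)
  have pa: "prefix (rev a) Y" using Y1 by simp
  have "prefix P (rev a)"
    using prefix_length_prefix[OF _ prefix_order.trans[OF pa G(1)]] la by simp
  then obtain P' where P': "rev a = P @ P'" by (auto simp: prefix_def)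
  have "prefix Q (rev a)"
    using prefix_length_prefix[OF _ prefix_order.trans[OF pa Z(1)]] la by simp
  then obtain R where R: "rev a = Q @ R" by (auto simp: prefix_def)
  have "rev P = scale s1 P"
    using rel(1) P' by simp
  then have "P = scale s1 (rev P)" using scale_cancel[OF rel(2)] by metis
  then have s1: "s1 = 1"
    using vecs_antipalindrome[OF rav \<open>prefix P (rev a)\<close> PQ(1) rel(2)] by blast
  then have rP: "rev P = P" using \<open>rev P = scale s1 P\<close> by simp
  have A1: "rev a = P @ gap d @ scale s Q" using rel(1) s1 rP by simp
  have pR: "prefix R (gap k' @ scale e3 Zt)"
    using prefix_order.trans[OF pa Z(1)] R by simp
  have lR: "length R = length P + length (gap d)" using la arg_cong[OF R, of length] by simp
  have eR: "even (length R)" "R \<noteq> []" using lR PQ by auto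
  have lastR: "last R \<noteq> 0" using R eR ha by (metis last_appendR last_rev)
  \<comment> \<open>\<open>R\<close> has even length and ends with a nonzero entry, but nonempty
    prefixes of even length of a gap end with 0.\<close>
  have "length (gap k') < length R"
  proof (rule ccontr)
    assume "\<not> length (gap k') < length R"
    then have "prefix R (gap k')" using pR prefix_length_prefix[of R _ "gap k'"] by simp
    then have "gap k' ! (length R - 1) = last R"
      using prefix_nth[of R "gap k'" "length R - 1"] eR by (simp add: last_conv_nth)
    moreover have "gap k' ! (length R - 1) = 0"
      using nth_gap[of "length R - 1" k'] eR \<open>prefix R (gap k')\<close> prefix_length_le[of R "gap k'"]
      by (cases "length R") auto
    ultimately show False using lastR by simp
  qed
  then obtain f where f: "R = gap k' @ f" "prefix f (scale e3 Zt)"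
    using prefix_split[OF pR] by auto
  have of: "odd (length f)" using eR f by simp
  then have "f \<noteq> []" by auto
  have af: "a = rev f @ gap k' @ rev Q" using R f
    by (metis append_assoc rev_append rev_gap rev_rev_ident)
  obtain tZ where tZ: "Zt = a @ tZ" using pars_append[OF Z(2)] by blast
  have "scale e3 Zt = scale e3 (rev f) @ scale e3 (gap k' @ rev Q @ tZ)"
    unfolding tZ by (subst af) simp
  then obtain u where "f @ u = scale e3 (rev f) @ scale e3 (gap k' @ rev Q @ tZ)"
    using f(2) by (auto simp: prefix_def)
  then have "f = scale e3 (rev f)"
    by (metis append_eq_append_conv length_rev length_scale)
  then have rf: "rev f = scale e3 (rev (rev f))" by (metis rev_scale)
  then have e3: "e3 = 1"
    using vecs_antipalindrome[OF a(2) _ _ Z(3) rf] af of by (metis length_rev prefixI)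
  then have pf: "rev f = f" using rf by simp
  have "Ec \<noteq> rev a" using Ec(1) Y prefix_length_le by fastforce
  then obtain k1 e1 Et where Et: "Ec = rev a @ gap k1 @ scale e1 Et" "unit_sign e1" "k1 = 0 \<longrightarrow> e1 = 1" "pars a Et"
    using Ec(2) pars_iff[of "rev a" Ec] by auto
  have E: "prefix Y (rev a @ gap k1 @ scale e1 Et)" using Ec Et by simp
  have A2: "rev a = rev (rev Q) @ gap k' @ f" using R f by simp
  have len: "length a + 2 \<le> length Y"
    using Y ha by (metis Suc_leI add_2_eq_Suc' even_Suc le_neq_implies_less)
  have A1': "rev a = P @ gap d @ scale s (rev (rev Q))" using A1 by simp
  have Z': "prefix Y (rev (rev Q) @ gap k' @ scale e3 Zt)" using Z by simp
  have "scale s (rev (rev Q)) = rev (rev Q)"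
    by (rule walk_step(5)[OF a(1) A1' A2 rel(3) \<open>f \<noteq> []\<close> pf Z' Z(2,3) G E Et(4,2,3) len])
  then have "rev a = P @ gap d @ Q" using A1 by simp
  then have ag: "a = rev Q @ gap d @ P" using rP by (metis append_assoc rev_append rev_gap rev_rev_ident)
  have "walked a d k' Y"
    by (rule walk[OF a(1) ag _ pf rP _ E Et(4,2,3) G Z' Z(2,3)])
       (use af pf PQ ex in auto)
  then show ?thesis using Y unfolding walked_def by blast
qed

text \<open>Odd length of \<open>U\<close> means that its last block is a reversed one, so the block
  after the next gap is oriented like \<open>a\<close> again and an induction can restart
  there.\<close>

lemma common_end:
  assumes "block a" "pars a (scale s1 U)" "odd (length U)" "pars a (scale s2 (U @ R))"
    "unit_sign s1" "unit_sign s2" "R \<noteq> []"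
  shows "\<exists>k e W. R = gap k @ scale e W \<and> unit_sign e \<and> pars a W"
proof -
  have a: "a \<noteq> []" "hd a \<noteq> 0" using assms(1) by (auto simp: block_def)
  have "U \<noteq> []" using assms(3) by auto
  then have "s1 * hd U = hd a" "s2 * hd U = hd a"
    using pars_hd[OF assms(2) a(1)] pars_hd[OF assms(4) a(1)] by (auto simp: hd_scale)
  then have "s1 = s2" using a assms(5,6) by auto
  then have "pars a (scale s1 U @ scale s1 R)" using assms(4) by simp
  then obtain k e W where W: "scale s1 R = gap k @ scale e W" "unit_sign e"
      "pars (if even (length (scale s1 U)) then rev a else a) W"
    using pars_sync[OF assms(2,1)] assms(7) by (metis scale_eq_Nil)
  have "R = gap (s1 * k) @ scale (s1 * e) W"
    using arg_cong[OF W(1), of "scale s1"] unfolding scale_cancel[OF assms(5)]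
    by (simp add: scale_gap[OF assms(5)])
  moreover have "unit_sign (s1 * e)" using W(2) assms(5) by auto
  moreover have "pars a W" using W(3) assms(3) by simp
  ultimately show ?thesis by blast
qed

lemma pars_last:
  assumes "pars S V" "block S"
  shows "V \<noteq> []" "last V \<noteq> 0"
proof -
  have S: "S \<noteq> []" "hd S \<noteq> 0" "last S \<noteq> 0" using assms by (auto simp: block_def)
  show V: "V \<noteq> []" using pars_neq_Nil[OF assms(1)] S by simp
  obtain e where e: "pars (if even (length V) then rev S else S) (scale e (rev V))"
    using pars_rev[OF assms] by blast
  have "hd (scale e (rev V)) = hd (if even (length V) then rev S else S)"
    by (rule pars_hd[OF e]) (use S in auto)
  then have "hd (scale e (rev V)) \<noteq> 0" using S by (auto simp: hd_rev split: if_splits)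
  then show "last V \<noteq> 0" using V by (simp add: hd_scale hd_rev)
qed

lemma nz_pars: "pars a W \<Longrightarrow> block a \<or> block (rev a) \<Longrightarrow> unit_sign e \<Longrightarrow> nz (scale e W)"
  using pars_nz by auto

text \<open>The gap \<open>k1\<close> separates \<open>b\<close> from \<open>rev b\<close> up to
  sign. Hence the same vector is read leftwards, through \<open>X\<close> and the reversed parsing
  of \<open>V\<close>, and rightwards, through \<open>X''\<close> and the parsing of
  \<open>W\<close>. The third reading comes from the far end: \<open>c\<close> has an odd number of
  \<open>b\<close>-blocks, so \<open>rev c\<close> begins with \<open>rev b\<close> up to
  sign.\<close>

lemma pair_inside:
  assumes a: "block a" "a \<in> vecs" and b: "block b" "length a < length b"
    and pa: "pars a c" and pb: "pars b c" and ec: "even (length c)"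
    and c: "c = b @ gap k1 @ scale e2 (rev b @ R)" and e2: "unit_sign e2"
    and ab: "hd b = hd a"
    and bL: "b = L @ X" and s: "unit_sign s"
    and B: "X @ gap k1 @ X'' = scale s (if even (length L) then a else rev a)"
    and L: "L = V @ gap k" "pars a V"
    and R: "scale e2 (rev b @ R) = X'' @ gap k' @ scale e W" and e: "unit_sign e"
    and W: "pars (if even (length L) then rev a else a) W"
  shows "\<exists>d h. balanced d h b a"
proof -
  have ha: "a \<noteq> []" "hd a \<noteq> 0" "even (length a)" using a by (auto simp: block_def)
  have hb: "b \<noteq> []" "even (length b)" using b by (auto simp: block_def)
  obtain t0 where t0: "unit_sign t0" "pars (rev a) (scale t0 (rev c))"
    using pars_rev[OF pa a(1)] ec by auto
  obtain t1 where t1: "unit_sign t1" "pars (rev b) (scale t1 (rev c))"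
    using pars_rev[OF pb b(1)] ec by auto
  obtain t2 where t2: "unit_sign t2" "pars (if even (length V) then rev a else a) (scale t2 (rev V))"
    using pars_rev[OF L(2) a(1)] by auto
  \<comment> \<open>\<open>t0\<close> and \<open>t1\<close> normalise \<open>rev c\<close> for its
    parsings by \<open>rev a\<close> and by \<open>rev b\<close>; \<open>t\<close> compares the two
    normalisations.\<close>
  define t where "t = t0 * t1"
  have t: "unit_sign t" using t0 t1 by (auto simp: t_def)
  define Y where "Y = scale t (rev b)"
  have "prefix (rev b) (scale t1 (rev c))" using t1 pars_prefix by blast
  then obtain T where "scale t1 (rev c) = rev b @ T" by (auto simp: prefix_def)
  then have "scale t (scale t1 (rev c)) = Y @ scale t T" by (simp only: scale_append Y_def)
  then have "prefix Y (scale t (scale t1 (rev c)))" by (metis prefixI)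
  then have Ec: "prefix Y (scale t0 (rev c))" using t1 by (auto simp: t_def)
  have lY: "length Y = length b" by (simp add: Y_def)
  define P where "P = scale t (rev X)"
  define Q where "Q = scale (t * e2) X''"
  have XP: "scale t X = rev P" "rev X = scale t P"
    using scale_cancel[OF t] by (simp_all add: P_def rev_scale del: scale_scale)
  have te2: "unit_sign (t * e2)" using t e2 by auto
  have XQ: "X'' = scale (t * e2) Q" "scale t X'' = scale e2 Q"
    using t e2 by (auto simp: Q_def)
  have left: "Y = P @ gap (t * k) @ scale (t * t2) (scale t2 (rev V))"
    using t t2(1) by (auto simp: Y_def bL L(1) P_def scale_gap)
  have "scale (t * e2) (scale e2 (rev b @ R)) = Q @ gap (t * e2 * k') @ scale (t * e2 * e) W"
    unfolding R using te2 by (simp add: Q_def scale_gap)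
  then have "Y @ scale t R = Q @ gap (t * e2 * k') @ scale (t * e2 * e) W"
    using e2 by (auto simp: Y_def)
  then have right: "prefix Y (Q @ gap (t * e2 * k') @ scale (t * e2 * e) W)"
    by (metis prefixI)
  have lV: "even (length V) \<longleftrightarrow> odd (length L)" using L(1) by simp
  have lX: "length X + length L = length b" using bL by simp
  have lB: "length X + length (gap k1) + length X'' = length a"
    using arg_cong[OF B, of length] by (auto split: if_splits)
  have lP: "length P = length X" "length Q = length X''" by (simp_all add: P_def Q_def)
  have u: "unit_sign (t * s)" "unit_sign (t * t2)" "unit_sign (t * e2 * e)" "unit_sign (t * e2 * s)"
    using t s t2 e2 e by auto
  have "\<exists>d h p q. Y = rev a @ gap h @ p \<and> rev p = p \<and> Y = q @ gap d @ rev a \<and> rev q = q"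
  \<comment> \<open>The orientation of the broken block decides which of its pieces,
    \<open>X\<close> or \<open>X''\<close>, has odd length and so takes the role of \<open>P\<close>
    in \<open>pair_core\<close>.\<close>
  proof (cases "even (length L)")
    case False
    have rel: "scale (t * s) (rev a) = rev P @ gap (t * k1) @ scale e2 Q"
      using arg_cong[OF B, of "scale t"] False XP XQ(2) by (simp add: scale_gap[OF t])
    show ?thesis
    proof (rule pair_core[OF a _ _ Ec t0(2) rel u(1) e2])
      show "prefix Y (P @ gap (t * k) @ scale (t * t2) (scale t2 (rev V)))" using left by simp
      show "pars (rev a) (scale t2 (rev V))" using t2(2) lV False by simp
      show "prefix Y (Q @ gap (t * e2 * k') @ scale (t * e2 * e) W)" by (fact right)
      show "pars a W" using W False by simp
      show "odd (length P)" "even (length Q)"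
        using lP lX lB False hb(2) ha(3) odd_length_gap[of k1] by (simp_all, presburger+)
    qed (use lY b hb u left in auto)
  next
    case True
    have "rev (X @ gap k1 @ X'') = scale s (rev a)" using B True by (simp add: rev_scale)
    then have "scale (t * e2) (rev X'' @ gap k1 @ rev X) = scale (t * e2 * s) (rev a)" by simp
    moreover have "scale (t * e2) (rev X'') = rev Q" by (simp add: Q_def rev_scale)
    moreover have "scale (t * e2) (rev X) = scale e2 P" using XP(2) t by auto
    ultimately have rel: "scale (t * e2 * s) (rev a) = rev Q @ gap (t * e2 * k1) @ scale e2 P"
      by (simp add: scale_gap[OF te2])
    show ?thesis
    proof (rule pair_core[OF a _ _ Ec t0(2) rel u(4) e2])
      show "prefix Y (P @ gap (t * k) @ scale (t * t2) (scale t2 (rev V)))" using left by simp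
      show "pars a (scale t2 (rev V))" using t2(2) lV True by simp
      show "prefix Y (Q @ gap (t * e2 * k') @ scale (t * e2 * e) W)" by (fact right)
      show "pars (rev a) W" using W True by simp
      show "odd (length Q)" "even (length P)"
        using lP lX lB True hb(2) ha(3) odd_length_gap[of k1] by (simp_all, presburger+)
    qed (use lY b hb u left in auto)
  qed
  then obtain d h p q where *: "Y = rev a @ gap h @ p" "rev p = p" "Y = q @ gap d @ rev a" "rev q = q" by blast
  have "rev Y = scale t b" by (simp add: Y_def rev_scale)
  then have **: "scale t b = p @ gap h @ a" "scale t b = a @ gap d @ q"
    using * by (metis append_assoc rev_append rev_gap rev_rev_ident)+
  have "t * hd b = hd a" using arg_cong[OF **(2), of hd] ha hb by (simp add: hd_scale)
  then have "t = 1" using ab ha t by auto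
  then have "balanced d h b a" unfolding balanced_def using ** *(2,4) ha(3) by (metis scale_one)
  then show ?thesis by blast
qed

text \<open>Whenever the \<open>a\<close>-parsing has a block ending together with the second
  \<open>b\<close>-block, two \<open>b\<close>-blocks and their gaps can be removed from
  \<open>c\<close>; this is \<open>finish\<close>. The only configuration that escapes is a first
  \<open>b\<close>-gap lying inside an \<open>a\<close>-block, which is
  \<open>pair_inside\<close>.\<close>

lemma common_upper_bound_balanced:
  assumes "pars a c" "pars b c" "even (length c)" "block a" "a \<in> vecs" "block b" "length a < length b" "\<not> pars a b"
  shows "\<exists>d h. balanced d h b a"
  using assms
proof (induction "length c" arbitrary: c rule: less_induct)
  case less
  note pa = less.prems(1) and pb = less.prems(2) and ec = less.prems(3)
  note a = less.prems(4,5) and b = less.prems(6,7) and nab = less.prems(8)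
  have ha: "a \<noteq> []" "hd a \<noteq> 0" "last a \<noteq> 0" "even (length a)" using a by (auto simp: block_def)
  have hb: "b \<noteq> []" "hd b \<noteq> 0" "last b \<noteq> 0" "even (length b)" using b by (auto simp: block_def)
  have ab: "hd b = hd a" using pars_hd[OF pa] pars_hd[OF pb] ha hb by simp
  have "c \<noteq> b" using pa nab by auto
  then obtain k1 e2 R' where c: "c = b @ gap k1 @ scale e2 R'" "unit_sign e2" "k1 = 0 \<longrightarrow> e2 = 1" "pars (rev b) R'"
    using pb pars_iff[of b c] by blast
  have "R' \<noteq> rev b" using c(1) ec hb(4) by auto
  then obtain k2 e3 c' where R': "R' = rev b @ gap k2 @ scale e3 c'" "unit_sign e3" "pars b c'"
    using c(4) pars_iff[of "rev b" R'] by auto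
  define R where "R = gap k2 @ scale e3 c'"
  have R'R: "R' = rev b @ R" using R' by (simp add: R_def)
  have "R \<noteq> []" by (simp add: R_def)
  have cc: "c = b @ gap k1 @ scale e2 (rev b @ R)" using c(1) R'R by simp
  have finish: ?case if "R = gap k @ scale e W" "unit_sign e" "pars a W" for k e W
  proof -
    have "gap k @ scale e W = gap k2 @ scale e3 c'" using that(1) by (simp add: R_def)
    then have "scale e W = scale e3 c'"
      using gap_append_eq nz_pars[OF that(3) _ that(2)] nz_pars[OF R'(3) _ R'(2)] a b by blast
    moreover have "e = e3"
      using arg_cong[OF calculation, of hd] pars_hd[OF that(3)] pars_hd[OF R'(3)] ab ha hb
        pars_neq_Nil[OF that(3)] pars_neq_Nil[OF R'(3)] by (auto simp: hd_scale)
    ultimately have "W = c'" using scale_inj that(2) by blast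
    then have "pars a c'" using that by simp
    moreover have "length c' < length c" "even (length c')"
      using c(1) R' hb(4) ec by auto
    ultimately show ?thesis using less.hyps[of c'] R'(3) a b nab by blast
  qed
  have finish2: ?case if "pars a (scale s1 U)" "odd (length U)" "pars a (scale s2 (U @ R))" "unit_sign s1" "unit_sign s2" for s1 s2 U
    using common_end[OF a(1) that \<open>R \<noteq> []\<close>] finish by blast
  have "in_block a b (gap k1 @ scale e2 R') \<or> in_gap a b (gap k1 @ scale e2 R')"
    using pars_locate[OF pa c(1) _ a(1)] nab by simp
  then show ?case
  proof
    \<comment> \<open>\<open>b\<close> ends properly inside an \<open>a\<close>-gap, so the next
      entry is 0 and \<open>k1 = 0\<close>. Since \<open>b\<close> is mirrored at this 0, the
      \<open>a\<close>-gap is \<open>u, 0, u\<close>; the \<open>a\<close>-parsing of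
      \<open>V\<close> is mirrored as well, so both parsings agree again at the end of
      \<open>rev b\<close>.\<close>
    assume "in_gap a b (gap k1 @ scale e2 R')"
    then obtain V g1 g2 k s W where *: "b = V @ g1" "gap k = g1 @ g2" "g1 \<noteq> []" "g2 \<noteq> []" "pars a V"
       "gap k1 @ scale e2 R' = g2 @ scale s W" "unit_sign s" "pars (if even (length V) then rev a else a) W"
      unfolding in_gap_def by blast
    have "last g1 \<noteq> 0" using *(1,3) hb by simp
    then obtain u v where uv: "g1 = gap u" "g2 = 0 # gap v" using gap_split[OF *(2-4)] by metis
    have "hd (gap k1 @ scale e2 R') = 0" using *(6) uv by simp
    then have "k1 = 0" by (auto simp: sgn_if split: if_splits)
    then have "e2 = 1" using c by simp
    have eq: "rev b @ R = gap v @ scale s W" using *(6) \<open>k1 = 0\<close> \<open>e2 = 1\<close> uv R'R by simp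
    have oV: "odd (length V)" using *(1) uv hb(4) by simp
    then have W: "pars a W" using *(8) by simp
    have "V \<noteq> []" "last V \<noteq> 0" by (fact pars_last[OF *(5) a(1)])+
    have "gap u @ (rev V @ R) = gap v @ scale s W" using eq *(1) uv by simp
    then have "rev V @ R = scale s W"
      using gap_append_eq[of u "rev V @ R" v "scale s W"] nz_pars[OF W _ *(7)] a \<open>V \<noteq> []\<close> \<open>last V \<noteq> 0\<close>
      by (auto simp: nz_def hd_rev)
    then have "W = scale s (rev V @ R)" using *(7) scale_cancel by metis
    obtain t where "unit_sign t" "pars a (scale t (rev V))" using pars_rev[OF *(5) a(1)] oV by auto
    then show ?case using finish2[of t "rev V" s] W \<open>W = scale s (rev V @ R)\<close> oV *(7) by simp
  next
    assume "in_block a b (gap k1 @ scale e2 R')"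
    then obtain L X X' M s where *: "b = L @ X" "gap k1 @ scale e2 R' = X' @ M" "X' \<noteq> []" "unit_sign s"
      "X @ X' = scale s (if even (length L) then a else rev a)"
      "L = [] \<and> s = 1 \<or> (\<exists>V k. L = V @ gap k \<and> pars a V \<and> (k = 0 \<longrightarrow> last V = hd (X @ X')))"
      "M = [] \<or> (\<exists>k e W. M = gap k @ scale e W \<and> unit_sign e \<and> (k = 0 \<longrightarrow> e * hd W = last X') \<and>
         pars (if even (length L) then rev a else a) W)"
      unfolding in_block_def by (elim exE conjE) (rule that; assumption)
    have lXX: "length X + length X' = length a" using arg_cong[OF *(5), of length] by (auto split: if_splits)
    have "L \<noteq> []" using *(1) lXX b(2) by auto
    then obtain V k where L: "L = V @ gap k" "pars a V" "k = 0 \<longrightarrow> last V = hd (X @ X')" using *(6) by blast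
    have "M \<noteq> []"
    proof
      assume "M = []"
      then have "length (gap k1) + length R' = length X'" using arg_cong[OF *(2), of length] by simp
      then show False using R'R lXX b(2) by simp
    qed
    then obtain k' e W where M: "M = gap k' @ scale e W" "unit_sign e" "k' = 0 \<longrightarrow> e * hd W = last X'"
        "pars (if even (length L) then rev a else a) W" using *(7) by blast
    show ?case
    proof (cases "length (gap k1) \<le> length X'")
      case True
      then obtain X'' where X'': "X' = gap k1 @ X''" "scale e2 R' = X'' @ M"
        using *(2) by (auto simp: append_eq_append_conv2)
      have "X @ gap k1 @ X'' = scale s (if even (length L) then a else rev a)" using *(5) X'' by simp
      moreover have "scale e2 (rev b @ R) = X'' @ gap k' @ scale e W" using X'' R'R M by simp
      ultimately show ?thesis
        using pair_inside[OF a b pa pb ec cc c(2) ab *(1) *(4) _ L(1,2) _ M(2,4)] by blast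
    next
      \<comment> \<open>The \<open>b\<close>-gap sticks out of the \<open>a\<close>-block and covers
        the zero gap \<open>k'\<close>, again symmetrically as \<open>u, 0, u\<close>. Here
        \<open>b @ gap u\<close> ends with a complete \<open>a\<close>-block, so its reversal is
        parsed up to sign and \<open>common_end\<close> applies.\<close>
      case False
      then obtain N where N: "gap k1 = X' @ N" "M = N @ scale e2 R'"
        using *(2) by (auto simp: append_eq_append_conv2)
      have "N \<noteq> []" using N False by auto
      have lX': "last X' = last (scale s (if even (length L) then a else rev a))"
        using *(3,5) by (metis last_appendR)
      then have "last X' \<noteq> 0" using ha *(4) by (auto simp: last_scale last_rev)
      then obtain u v where uv: "X' = gap u" "N = 0 # gap v" using gap_split[OF N(1) *(3) \<open>N \<noteq> []\<close>] by metis
      have "hd M = 0" using N uv by simp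
      then have "k' = 0" using M by (auto simp: sgn_if split: if_splits)
      then have eW: "gap v @ scale e2 (rev b @ R) = scale e W" using M N uv R'R by simp
      have oX: "odd (length X)" using lXX uv ha(4) by (metis even_add odd_length_gap)
      then have oL: "odd (length L)" using *(1) hb(4) by simp
      have W: "pars a W" using M(4) oL by simp
      have blockB: "X @ X' = scale s (rev a)" using *(5) oL by simp
      have "last X' = s * hd a" using lX' oL ha by (simp add: last_scale last_rev)
      moreover have "hd W = hd a" using pars_hd[OF W] ha by simp
      ultimately have "e = s" using M(3) \<open>k' = 0\<close> ha by simp
      obtain W1 where W1: "W = a @ W1" using pars_append[OF W] by blast
      have "scale s a = rev X' @ rev X" using arg_cong[OF blockB, of rev] by (simp add: rev_scale)
      then have "gap v @ scale e2 (rev b @ R) = gap u @ rev X @ scale s W1"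
        using eW W1 \<open>e = s\<close> uv by simp
      moreover have "X \<noteq> []" using oX by auto
      moreover have lX: "last X = last b" using *(1) \<open>X \<noteq> []\<close> by simp
      ultimately have "scale e2 (rev b @ R) = rev X @ scale s W1"
        using gap_append_eq[of v "scale e2 (rev b @ R)" u "rev X @ scale s W1"] hb c(2)
        by (auto simp: nz_def hd_scale hd_rev)
      from arg_cong[OF this, of hd] have "e2 = 1"
        using \<open>X \<noteq> []\<close> lX hb by (simp add: hd_scale hd_rev)
      have "u = v"
        using gap_append_eq[of v "scale e2 (rev b @ R)" u "rev X @ scale s W1"] hb c(2) lX \<open>X \<noteq> []\<close>
          \<open>gap v @ scale e2 (rev b @ R) = gap u @ rev X @ scale s W1\<close>
        by (auto simp: nz_def hd_scale hd_rev)
      have W2: "W = scale s ((gap u @ rev b) @ R)"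
        using eW \<open>e2 = 1\<close> \<open>u = v\<close> \<open>e = s\<close> scale_cancel[OF *(4)] by (metis append_assoc scale_one)
      have "pars a (b @ gap u)"
      proof -
        have "pars a (V @ gap k @ scale s (rev a))"
        proof (rule pars_append_pars[OF L(2) a(1) _ *(4)])
          show "pars (if even (length V) then rev a else a) (rev a)"
            using oL L(1) by (simp add: pars.pars_base)
          have "rev a \<noteq> []" using ha by simp
          then show "k = 0 \<longrightarrow> s * hd (rev a) = last V" using L(3) blockB hd_scale by metis
        qed
        then show ?thesis using *(1) L(1) blockB uv by simp
      qed
      then obtain t where "unit_sign t" "pars a (scale t (rev (b @ gap u)))"
        using pars_rev[OF _ a(1), of "b @ gap u"] hb(4) by auto
      then show ?thesis using finish2[of t "gap u @ rev b" s] W W2 *(4) hb(4) by simp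
    qed
  qed
qed

section \<open>Euclidean descent\<close>

text \<open>\<open>j\<close> counts gaps, so \<open>chain e m n (2 * p)\<close> is
  \<open>(w^p, e)\<close> with gap sums \<open>2 * m\<close> and \<open>2 * n\<close>. Odd indices
  are included because a chain can be cut at any of its gaps.\<close>

fun chain :: "int list \<Rightarrow> int \<Rightarrow> int \<Rightarrow> nat \<Rightarrow> int list" where
  "chain e m n 0 = e"
| "chain e m n (Suc j) = e @ gap m @ chain (rev e) n m j"

lemma chain_add:
  "chain e m n (Suc (i + j)) = chain e m n i @ gap (if even i then m else n) @
     (if even i then chain (rev e) n m j else chain e m n j)"
proof (induction i arbitrary: e m n)
  case (Suc i)
  show ?case using Suc[of "rev e" n m] by simp
qed simp

lemma chain_Suc_right:
  "chain e m n (Suc i) = chain e m n i @ gap (if even i then m else n) @ (if even i then rev e else e)"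
  using chain_add[of e m n i 0] by simp

lemma rev_chain: "rev (chain e m n i) = (if even i then chain (rev e) n m i else chain e m n i)"
proof (induction i arbitrary: e m n)
  case (Suc i)
  have "rev (chain e m n (Suc i)) = rev (chain (rev e) n m i) @ gap m @ rev e" by simp
  also have "\<dots> = (if even i then chain e m n i @ gap m @ rev e else chain (rev e) n m i @ gap m @ rev e)"
    using Suc[of "rev e" n m] by auto
  also have "\<dots> = (if even (Suc i) then chain (rev e) n m (Suc i) else chain e m n (Suc i))"
    using chain_Suc_right[of e m n i] chain_Suc_right[of "rev e" n m i] by (simp del: chain.simps)
  finally show ?case .
qed simp

lemma chain_Suc_Suc: "chain e m n (Suc (Suc j)) = e @ gap m @ rev e @ gap n @ chain e m n j"
  by simp

lemma even_length_chain: "even (length (chain e m n (2 * p))) \<longleftrightarrow> even (length e)"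
proof (induction p)
  case (Suc p)
  then show ?case by (auto simp: chain_Suc_Suc simp del: chain.simps)
qed simp

lemma length_chain_less: "i < j \<Longrightarrow> length (chain e m n i) < length (chain e m n j)"
proof -
  assume "i < j"
  then obtain k where "j = Suc (i + k)" using less_iff_Suc_add by auto
  then show ?thesis by (simp add: chain_add del: chain.simps)
qed

text \<open>The exceptional family: for palindromic \<open>f\<close> the even members form a \<open>chain\<close> with gaps \<open>0\<close> and
  \<open>2x\<close>, but the odd ones do not belong to it.\<close>

definition pal_power :: "int list \<Rightarrow> int \<Rightarrow> nat \<Rightarrow> int list" where
  "pal_power f x k = concat (replicate k (f @ gap (2 * x))) @ f @ gap x"

lemma pal_power_0: "pal_power f x 0 = f @ gap x"
  by (simp add: pal_power_def)

lemma pal_power_add: "pal_power f x (i + j) = concat (replicate i (f @ gap (2 * x))) @ pal_power f x j"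
  by (simp add: pal_power_def replicate_add)

lemma length_pal_power_less: "i < j \<Longrightarrow> length (pal_power f x i) < length (pal_power f x j)"
proof -
  assume "i < j"
  then obtain k where "j = Suc k + i" using less_iff_Suc_add by auto
  then show ?thesis using pal_power_add[of f x "Suc k" i] by simp
qed

lemma rev_pal_power:
  assumes "rev f = f" "x \<noteq> 0"
  shows "rev (pal_power f x k) = gap x @ f @ concat (replicate k (gap (2 * x) @ f))"
proof -
  have "rev (concat (replicate k (f @ gap (2 * x)))) = concat (replicate k (gap (2 * x) @ f))"
    using assms by (simp add: rev_concat)
  then show ?thesis using assms by (simp add: pal_power_def)
qed

lemma concat_replicate_shift: "concat (replicate k (a @ b)) @ a = a @ concat (replicate k (b @ a))"
  by (induction k) auto

text \<open>The zero gap fuses the final \<open>gap x\<close> with the first \<open>gap x\<close> of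
  the reversal into \<open>gap (2 * x)\<close>.\<close>

lemma pal_power_0_rev_pal_power:
  assumes "rev f = f" "x \<noteq> 0"
  shows "pal_power f x k @ 0 # rev (pal_power f x j) = concat (replicate (Suc (k + j)) (f @ gap (2 * x))) @ f"
proof -
  have "pal_power f x k @ 0 # rev (pal_power f x j) =
      concat (replicate k (f @ gap (2 * x))) @ f @ gap (2 * x) @ f @ concat (replicate j (gap (2 * x) @ f))"
    unfolding rev_pal_power[OF assms] unfolding gap_double[OF assms(2)] pal_power_def by simp
  also have "\<dots> = concat (replicate k (f @ gap (2 * x))) @ (f @ gap (2 * x)) @ concat (replicate j (f @ gap (2 * x))) @ f"
    by (simp add: concat_replicate_shift)
  also have "\<dots> = concat (replicate (k + (1 + j)) (f @ gap (2 * x))) @ f"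
    by (simp only: replicate_add concat_append) simp
  finally show ?thesis by simp
qed

text \<open>By the same fusion, two factors \<open>(f, 2x)\<close> form one period
  \<open>e, 0, e^-1, 2x\<close> with \<open>e = (f, x)\<close>.\<close>

lemma pal_power_chain:
  assumes "rev f = f" "x \<noteq> 0"
  shows "chain (f @ gap x) 0 (2 * x) (2 * q) = pal_power f x (2 * q)"
proof (induction q)
  case (Suc q)
  have r2: "concat (replicate 2 F) = F @ F" for F :: "int list" by (simp add: numeral_2_eq_2)
  have "chain (f @ gap x) 0 (2 * x) (2 * Suc q) =
      (f @ gap x @ 0 # gap x @ f) @ gap (2 * x) @ chain (f @ gap x) 0 (2 * x) (2 * q)"
    using assms by (simp add: chain_Suc_Suc)
  also have "\<dots> = concat (replicate 2 (f @ gap (2 * x))) @ pal_power f x (2 * q)"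
    using assms by (simp only: Suc r2) (simp add: gap_double)
  also have "\<dots> = pal_power f x (2 + 2 * q)" by (simp only: pal_power_add)
  also have "2 + 2 * q = 2 * Suc q" by simp
  finally show ?case .
qed (simp add: pal_power_0)

section \<open>The vectors balanced in one fixed vector\<close>

definition good :: "int list \<Rightarrow> bool" where
  "good S \<longleftrightarrow> even (length S) \<and> (S \<noteq> [] \<longrightarrow> hd S \<noteq> 0 \<and> last S \<noteq> 0)"

lemma good_rev [simp]: "good (rev S) \<longleftrightarrow> good S"
  by (auto simp: good_def hd_rev last_rev)

lemma balancedE:
  assumes "balanced d h S z" "good S"
  obtains f g where "S = z @ gap d @ g" "S = f @ gap h @ z" "rev f = f" "rev g = g"
    "odd (length f)" "odd (length g)" "nz f" "nz g" "hd f = hd S" "last f \<noteq> 0" "last g \<noteq> 0" "good z"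
    "length z < length S"
proof -
  obtain f g where *: "S = z @ gap d @ g" "S = f @ gap h @ z" "rev f = f" "rev g = g" "even (length z)"
    using assms(1) unfolding balanced_def by blast
  have "even (length S)" using assms(2) by (simp add: good_def)
  then have l: "odd (length f)" "odd (length g)"
    using *(5) arg_cong[OF *(1), of "\<lambda>x. even (length x)"] arg_cong[OF *(2), of "\<lambda>x. even (length x)"]
    by auto
  then have ne: "f \<noteq> []" "g \<noteq> []" "S \<noteq> []" using * by auto
  have "hd f = hd S" "last g = last S" using ne *(2) by (simp, metis *(1) append_assoc last_appendR)
  moreover have "hd f = last f" "hd g = last g" using *(3,4) by (metis hd_rev)+
  ultimately have h: "hd f \<noteq> 0" "hd g \<noteq> 0" "last f \<noteq> 0" "last g \<noteq> 0" "hd f = hd S"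
    using assms(2) ne by (auto simp: good_def)
  have "z \<noteq> [] \<Longrightarrow> hd z = hd S \<and> last z = last S"
    using *(1,2) by (metis append_is_Nil_conv hd_append2 last_appendR)
  then have gz: "good z" using *(5) assms(2) ne by (auto simp: good_def)
  have lz: "length z < length S" using *(1) by simp
  have nz: "nz f" "nz g" using h ne by (auto simp: nz_def)
  show ?thesis by (rule that[OF *(1-4) l nz h(5,3,4) gz lz])
qed

lemma balanced_rev: "balanced d h S z \<Longrightarrow> balanced h d (rev S) (rev z)"
proof -
  assume "balanced d h S z"
  then obtain f g where *: "S = z @ gap d @ g" "S = f @ gap h @ z" "rev f = f" "rev g = g" "even (length z)"
    unfolding balanced_def by blast
  have "rev S = rev z @ gap h @ f" "rev S = g @ gap d @ rev z"
    using *(1-4) by (metis append_assoc rev_append rev_gap)+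
  then show ?thesis unfolding balanced_def using * by (metis length_rev)
qed

lemma even_prefix_gap:
  assumes "gap j = U @ V" "even (length U)" "U \<noteq> []"
  shows "last U = 0"
proof -
  have "last U = gap j ! (length U - 1)" using assms by (simp add: last_conv_nth nth_append)
  moreover have "odd (length U - 1)" using assms(2,3) by (cases "length U") auto
  moreover have "length U - 1 < length (gap j)" using assms by (cases U) auto
  ultimately show ?thesis using nth_gap by simp
qed

lemma append_eq_append_le:
  assumes "xs @ ys = us @ vs" "length us \<le> length xs"
  obtains t where "xs = us @ t" "t @ ys = vs"
  using assms by (auto simp: append_eq_append_conv2)

text \<open>Once \<open>g2 = y @ gap d @ g1\<close>, reversing the palindromes shows that
  \<open>S\<close> ends with \<open>rev y\<close>; it also ends with \<open>z1\<close> and hence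
  with \<open>y\<close>.\<close>

lemma balanced_step:
  assumes S: "S = z1 @ gap d @ g1" "S = z2 @ gap d @ g2" "rev g1 = g1" "rev g2 = g2"
    and z1: "z1 \<noteq> [] \<longrightarrow> last z1 \<noteq> 0" "even (length z1)" "even (length z2)" "length z2 < length z1"
    and suf: "S = f1 @ z1"
  shows "\<exists>y. z1 = z2 @ gap d @ y \<and> rev y = y"
proof -
  have eq: "z1 @ gap d @ g1 = z2 @ gap d @ g2" by (simp only: S(1)[symmetric] S(2)[symmetric])
  obtain U where U: "z1 = z2 @ U" "U @ gap d @ g1 = gap d @ g2"
    by (rule append_eq_append_le[OF eq]) (use z1 in auto)
  have "\<not> length U < length (gap d)"
  proof
    assume lt: "length U < length (gap d)"
    obtain V where "gap d = U @ V"
      by (rule append_eq_append_le[OF U(2)[symmetric]]) (use lt in auto)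
    moreover have "even (length U)" "U \<noteq> []" using U z1 by auto
    ultimately have "last U = 0" using even_prefix_gap by blast
    then show False using U z1 \<open>U \<noteq> []\<close> by auto
  qed
  then obtain y where y0: "U = gap d @ y" "y @ gap d @ g1 = g2"
    using append_eq_append_le[OF U(2)] by (metis not_less)
  then have y: "z1 = z2 @ gap d @ y" using U by simp
  have "g2 = g1 @ gap d @ rev y" using S(3,4) y0(2) by (metis append_assoc rev_append rev_gap)
  then have "S = (z2 @ gap d @ g1 @ gap d) @ rev y" using S(2) by simp
  moreover have "S = (f1 @ z2 @ gap d) @ y" using suf y by simp
  ultimately have "rev y = y" by (metis append_eq_append_conv length_rev)
  then show ?thesis using y by blast
qed

text \<open>\<open>balanced_step\<close> for \<open>S\<close> and for its reversal. Consequently the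
  longest vector balanced in \<open>S\<close> controls all others, so the descent can forget
  \<open>S\<close> and continue with that vector.\<close>

lemma balanced_chain:
  assumes "balanced d h S z1" "balanced d h S z2" "length z2 < length z1" "good S"
  shows "balanced d h z1 z2"
proof -
  obtain f1 g1 where 1: "S = z1 @ gap d @ g1" "S = f1 @ gap h @ z1" "rev f1 = f1" "rev g1 = g1" "good z1"
    using balancedE[OF assms(1,4)] by metis
  obtain f2 g2 where 2: "S = z2 @ gap d @ g2" "S = f2 @ gap h @ z2" "rev f2 = f2" "rev g2 = g2" "good z2"
    using balancedE[OF assms(2,4)] by metis
  have g: "z1 \<noteq> [] \<longrightarrow> last z1 \<noteq> 0" "z1 \<noteq> [] \<longrightarrow> hd z1 \<noteq> 0" "even (length z1)" "even (length z2)"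
    using 1(5) 2(5) by (auto simp: good_def)
  obtain y where y: "z1 = z2 @ gap d @ y" "rev y = y"
    using balanced_step[OF 1(1) 2(1) 1(4) 2(4) g(1,3,4) assms(3), of "f1 @ gap h"] 1(2) by auto
  have r: "rev S = rev z1 @ gap h @ f1" "rev S = rev z2 @ gap h @ f2" "rev S = (g1 @ gap d) @ rev z1"
    using 1(1-4) 2(1-4) by (metis append_assoc rev_append rev_gap)+
  obtain y' where y': "rev z1 = rev z2 @ gap h @ y'" "rev y' = y'"
    using balanced_step[OF r(1,2) 1(3) 2(3) _ _ _ _ r(3)] g assms(3) by (auto simp: last_rev)
  then have "z1 = y' @ gap h @ z2" by (metis append_assoc rev_append rev_gap rev_rev_ident)
  then show ?thesis unfolding balanced_def using y y' g(4) by blast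
qed

text \<open>The quantification over all balanced \<open>z\<close> is what yields one
  \<open>e\<close> for the whole set of knots and not only for each pair.\<close>

definition chain_coherent :: "int \<Rightarrow> int \<Rightarrow> int list \<Rightarrow> bool" where
  "chain_coherent d h S \<longleftrightarrow> (\<exists>e p. S = chain e d h (2 * p) \<and>
     (\<forall>z. balanced d h S z \<longrightarrow> (\<exists>q. z = chain e d h (2 * q))))"

definition pal_power_coherent :: "int \<Rightarrow> int \<Rightarrow> int list \<Rightarrow> bool" where
  "pal_power_coherent d h S \<longleftrightarrow> d = 0 \<and> (\<exists>f x k. x \<noteq> 0 \<and> h = 2 * x \<and> rev f = f \<and> odd (length f) \<and>
     S = pal_power f x k \<and> (\<forall>z. balanced d h S z \<longrightarrow> (\<exists>j. z = pal_power f x j)))"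

definition coherent :: "int \<Rightarrow> int \<Rightarrow> int list \<Rightarrow> bool" where
  "coherent d h S \<longleftrightarrow> chain_coherent d h S \<or> pal_power_coherent d h S \<or> pal_power_coherent h d (rev S)"

lemma chain_coherent_rev: "chain_coherent d h S \<Longrightarrow> chain_coherent h d (rev S)"
proof -
  assume "chain_coherent d h S"
  then obtain e p where S: "S = chain e d h (2 * p)" and z: "\<And>z. balanced d h S z \<Longrightarrow> \<exists>q. z = chain e d h (2 * q)"
    unfolding chain_coherent_def by blast
  have "\<exists>q. z = chain (rev e) h d (2 * q)" if "balanced h d (rev S) z" for z
  proof -
    have "balanced d h S (rev z)" using balanced_rev[OF that] by simp
    then obtain q where "rev z = chain e d h (2 * q)" using z by blast
    then show ?thesis using rev_chain[of e d h "2 * q"] by (metis dvd_triv_left rev_rev_ident)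
  qed
  moreover have "rev S = chain (rev e) h d (2 * p)" using S by (simp add: rev_chain)
  ultimately show ?thesis unfolding chain_coherent_def by blast
qed

lemma coherent_rev: "coherent d h S \<Longrightarrow> coherent h d (rev S)"
  unfolding coherent_def using chain_coherent_rev by auto

text \<open>\<open>f\<close> is the chain of odd index \<open>2 * (p - q) - 1\<close>, and prefixing
  it to \<open>z\<close> with its gap raises the index by \<open>2 * (p - q)\<close>.\<close>

lemma chain_extend1:
  assumes "z = chain e d h (2 * p)" "z2 = chain e d h (2 * q)" "z = f @ gap h @ z2"
  shows "\<exists>r. f @ gap h @ z = chain e d h (2 * r)"
proof -
  have "q < p"
  proof (rule ccontr)
    assume "\<not> q < p"
    then have "p = q \<or> 2 * p < 2 * q" by linarith
    then have "length z \<le> length z2"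
      using length_chain_less[of "2 * p" "2 * q" e d h] assms(1,2) by auto
    then show False using arg_cong[OF assms(3), of length] by simp
  qed
  define i where "i = 2 * (p - q) - 1"
  have i: "odd i" "2 * p = Suc (i + 2 * q)" "2 * (2 * p - q) = Suc (i + 2 * p)"
    using \<open>q < p\<close> by (auto simp: i_def)
  have "z = chain e d h i @ gap h @ z2"
    unfolding assms(1,2) i(2) chain_add using i(1) by simp
  then have "f = chain e d h i" using assms(3) by simp
  then have "f @ gap h @ z = chain e d h (2 * (2 * p - q))"
    unfolding i(3) chain_add using i(1) assms(1) by simp
  then show ?thesis by blast
qed

lemma chain_extend2:
  assumes "z = chain e d h (2 * p)" "u = chain e d h (2 * q)"
  shows "\<exists>r. z @ gap d @ rev u @ gap h @ z = chain e d h (2 * r)"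
proof -
  have "z @ gap d @ rev u = chain e d h (Suc (2 * p + 2 * q))"
    unfolding chain_add using assms by (simp add: rev_chain)
  then have "z @ gap d @ rev u @ gap h @ z = chain e d h (Suc (Suc (2 * p + 2 * q) + 2 * p))"
    unfolding chain_add[of e d h "Suc (2 * p + 2 * q)"] using assms by simp
  also have "Suc (Suc (2 * p + 2 * q) + 2 * p) = 2 * (2 * p + q + 1)" by simp
  finally show ?thesis by blast
qed

lemma pal_power_extend1:
  assumes "z = pal_power f x k" "z2 = pal_power f x j" "z = f' @ gap h @ z2"
  shows "\<exists>r. f' @ gap h @ z = pal_power f x r"
proof -
  have "j < k"
  proof (rule ccontr)
    assume "\<not> j < k"
    then have "j = k \<or> k < j" by linarith
    then have "length z \<le> length z2"
      using length_pal_power_less[of k j f x] assms(1,2) by auto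
    then show False using arg_cong[OF assms(3), of length] by simp
  qed
  then obtain i where k: "k = i + j" by (metis add.commute less_imp_add_positive)
  have "z = concat (replicate i (f @ gap (2 * x))) @ z2" unfolding assms(1,2) k pal_power_add ..
  then have "f' @ gap h = concat (replicate i (f @ gap (2 * x)))" using assms(3) by simp
  then have "f' @ gap h @ z = pal_power f x (i + k)" unfolding pal_power_add assms(1) by (metis append_assoc)
  then show ?thesis by blast
qed

lemma pal_power_extend2:
  assumes "z = pal_power f x k" "u = pal_power f x j" "rev f = f" "x \<noteq> 0"
  shows "\<exists>r. z @ gap 0 @ rev u @ gap (2 * x) @ z = pal_power f x r"
proof -
  have "z @ gap 0 @ rev u @ gap (2 * x) @ z = (z @ 0 # rev u) @ gap (2 * x) @ z" by simp
  also have "\<dots> = concat (replicate (Suc (k + j)) (f @ gap (2 * x))) @ f @ gap (2 * x) @ z"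
    unfolding assms(1,2) pal_power_0_rev_pal_power[OF assms(3,4)] by simp
  also have "\<dots> = pal_power f x (Suc (k + j) + (1 + k))"
    unfolding pal_power_add assms(1) by simp
  finally show ?thesis by blast
qed

text \<open>The two forms of \<open>ext\<close> are the two Euclidean steps, according to whether
  \<open>z\<close> or \<open>f\<close> is the longer one. In both, \<open>S\<close> is assembled
  from members of the family of \<open>z\<close> and therefore belongs to it.\<close>

lemma coherent_extend:
  assumes z: "coherent d h z" and others: "\<And>z'. balanced d h S z' \<Longrightarrow> z' = z \<or> balanced d h z z'"
    and ext: "(\<exists>f g z2. balanced d h z z2 \<and> S = f @ gap h @ z \<and> z = f @ gap h @ z2 \<and> S = z @ gap d @ g \<and> z = z2 @ gap d @ g \<and> rev g = g) \<or>
      (\<exists>u. (u = z \<or> balanced d h z u) \<and> S = z @ gap d @ rev u @ gap h @ z)"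
  shows "coherent d h S"
  using z unfolding coherent_def
proof (elim disjE)
  assume "chain_coherent d h z"
  then obtain e p where e: "z = chain e d h (2 * p)" "\<And>z'. balanced d h z z' \<Longrightarrow> \<exists>q. z' = chain e d h (2 * q)"
    unfolding chain_coherent_def by blast
  have o: "\<exists>q. z' = chain e d h (2 * q)" if "balanced d h S z'" for z'
    using others[OF that] e by blast
  have "\<exists>r. S = chain e d h (2 * r)"
    using ext
  proof (elim disjE exE conjE)
    fix f z2 assume *: "balanced d h z z2" "S = f @ gap h @ z" "z = f @ gap h @ z2"
    obtain q where "z2 = chain e d h (2 * q)" using e(2)[OF *(1)] by blast
    then show ?thesis using chain_extend1[OF e(1) _ *(3)] *(2) by blast
  next
    fix u assume *: "S = z @ gap d @ rev u @ gap h @ z" "u = z"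
    then show ?thesis using chain_extend2[OF e(1) e(1)] by simp
  next
    fix u assume *: "S = z @ gap d @ rev u @ gap h @ z" "balanced d h z u"
    obtain q where "u = chain e d h (2 * q)" using e(2)[OF *(2)] by blast
    then show ?thesis using chain_extend2[OF e(1)] *(1) by blast
  qed
  then show "chain_coherent d h S \<or> pal_power_coherent d h S \<or> pal_power_coherent h d (rev S)"
    unfolding chain_coherent_def using o by blast
next
  assume "pal_power_coherent d h z"
  then obtain f x k where e: "d = 0" "x \<noteq> 0" "h = 2 * x" "rev f = f" "odd (length f)" "z = pal_power f x k"
      "\<And>z'. balanced d h z z' \<Longrightarrow> \<exists>j. z' = pal_power f x j"
    unfolding pal_power_coherent_def by blast
  have o: "\<exists>j. z' = pal_power f x j" if "balanced d h S z'" for z'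
    using others[OF that] e(6,7) by blast
  have "\<exists>r. S = pal_power f x r"
    using ext
  proof (elim disjE exE conjE)
    fix f' z2 assume *: "balanced d h z z2" "S = f' @ gap h @ z" "z = f' @ gap h @ z2"
    obtain q where "z2 = pal_power f x q" using e(7)[OF *(1)] by blast
    then show ?thesis using pal_power_extend1[OF e(6) _ *(3)] *(2) by blast
  next
    fix u assume *: "S = z @ gap d @ rev u @ gap h @ z" "u = z"
    then show ?thesis using pal_power_extend2[OF e(6) e(6,4,2)] e(1,3) by simp
  next
    fix u assume *: "S = z @ gap d @ rev u @ gap h @ z" "balanced d h z u"
    obtain q where "u = pal_power f x q" using e(7)[OF *(2)] by blast
    then show ?thesis using pal_power_extend2[OF e(6) _ e(4,2)] e(1,3) *(1) by blast
  qed
  then show "chain_coherent d h S \<or> pal_power_coherent d h S \<or> pal_power_coherent h d (rev S)"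
    unfolding pal_power_coherent_def using o e by blast
next
  assume "pal_power_coherent h d (rev z)"
  then obtain f x k where e: "h = 0" "x \<noteq> 0" "d = 2 * x" "rev f = f" "odd (length f)" "rev z = pal_power f x k"
      "\<And>z'. balanced h d (rev z) z' \<Longrightarrow> \<exists>j. z' = pal_power f x j"
    unfolding pal_power_coherent_def by blast
  have o: "\<exists>j. z' = pal_power f x j" if "balanced h d (rev S) z'" for z'
  proof -
    have "balanced d h S (rev z')" using balanced_rev[OF that] by simp
    then have "rev z' = z \<or> balanced d h z (rev z')" using others by blast
    then have "z' = rev z \<or> balanced h d (rev z) z'" using balanced_rev[of d h z "rev z'"] by auto
    then show ?thesis using e(6,7) by blast
  qed
  have "\<exists>r. rev S = pal_power f x r"
    using ext
  proof (elim disjE exE conjE)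
    fix g z2 assume *: "balanced d h z z2" "S = z @ gap d @ g" "z = z2 @ gap d @ g" "rev g = g"
    obtain q where "rev z2 = pal_power f x q" using e(7)[OF balanced_rev[OF *(1)]] by blast
    moreover have "rev z = g @ gap d @ rev z2" "rev S = g @ gap d @ rev z"
      using *(2-4) by (metis append_assoc rev_append rev_gap)+
    ultimately show ?thesis using pal_power_extend1[OF e(6)] by metis
  next
    fix u assume *: "S = z @ gap d @ rev u @ gap h @ z" "u = z"
    have "rev S = rev z @ gap 0 @ rev (rev z) @ gap (2 * x) @ rev z" using * e(1,3) by simp
    then show ?thesis using pal_power_extend2[OF e(6) e(6,4,2)] by metis
  next
    fix u assume *: "S = z @ gap d @ rev u @ gap h @ z" "balanced d h z u"
    obtain q where "rev u = pal_power f x q" using e(7)[OF balanced_rev[OF *(2)]] by blast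
    moreover have "rev S = rev z @ gap 0 @ rev (rev u) @ gap (2 * x) @ rev z" using * e(1,3) by simp
    ultimately show ?thesis using pal_power_extend2[OF e(6) _ e(4,2)] by metis
  qed
  then show "chain_coherent d h S \<or> pal_power_coherent d h S \<or> pal_power_coherent h d (rev S)"
    unfolding pal_power_coherent_def using o e by blast
qed

text \<open>\<open>e\<close> is a prefix and a suffix of \<open>f @ gap x\<close>. It does not fit
  into the final gap, because a nonempty even-length end piece of a gap has a 0 at its inner end. So
  \<open>e\<close> ends with all of \<open>gap x\<close>, and its other part is a prefix and a
  suffix of the palindrome \<open>f\<close>.\<close>

lemma chain_pal_power_base:
  assumes p: "chain e 0 (2 * x) (2 * p) = f @ gap x" and f: "rev f = f" "odd (length f)" "nz f" "last f \<noteq> 0" and x: "x \<noteq> 0"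
  shows "\<exists>f2. e = f2 @ gap x \<and> rev f2 = f2 \<and> odd (length f2)"
proof -
  let ?z = "f @ gap x"
  have ee: "even (length e)" using even_length_chain[of e 0 "2 * x" p] p f(2) by simp
  have "\<exists>T. chain e 0 (2 * x) (2 * p) = e @ T" by (cases "2 * p") auto
  then have pre: "prefix e ?z" unfolding p by (auto intro: prefixI)
  have suf: "\<exists>Y. ?z = Y @ e"
  proof (cases "2 * p")
    case (Suc j)
    then have "odd j" by presburger
    then have "chain e 0 (2 * x) (Suc j) = (chain e 0 (2 * x) j @ gap (2 * x)) @ e"
      by (simp add: chain_Suc_right del: chain.simps)
    then have "?z = (chain e 0 (2 * x) j @ gap (2 * x)) @ e" using p Suc by (simp del: chain.simps)
    then show ?thesis by blast
  qed (use p in auto)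
  have fz: "f \<noteq> []" "hd f \<noteq> 0" using f(3) by (auto simp: nz_def)
  have "e \<noteq> []"
  proof
    assume "e = []"
    then have "chain e 0 (2 * x) (2 * p) = [] \<or> hd (chain e 0 (2 * x) (2 * p)) = 0"
      by (cases "2 * p") auto
    then show False unfolding p using fz by simp
  qed
  then have he: "hd e = hd f" using prefix_hd[OF pre] fz by simp
  obtain Y where Y: "f @ gap x = Y @ e" using suf by blast
  have "\<not> length e \<le> length (gap x)"
  proof
    assume "length e \<le> length (gap x)"
    then obtain U where U: "gap x = U @ e" using Y by (auto simp: append_eq_append_conv2)
    then have "gap x = rev e @ rev U" by (metis rev_append rev_gap)
    then have "last (rev e) = 0" using even_prefix_gap ee \<open>e \<noteq> []\<close> by (metis length_rev rev_is_Nil_conv)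
    then show False using he fz \<open>e \<noteq> []\<close> by (simp add: last_rev)
  qed
  then obtain f2 where f2: "e = f2 @ gap x" "f = Y @ f2" using Y by (auto simp: append_eq_append_conv2)
  have "odd (length f2)" using ee f2 by simp
  moreover have "rev f2 = f2"
  proof -
    have "f = rev f2 @ rev Y" using f2(2) f(1) by (metis rev_append)
    moreover obtain T where "f @ gap x = f2 @ T" using pre f2(1) by (auto simp: prefix_def)
    ultimately show ?thesis by (metis append_assoc append_eq_append_conv length_rev)
  qed
  ultimately show ?thesis using f2 by blast
qed

text \<open>Where the exceptional family arises: \<open>z\<close> ends inside \<open>gap h\<close>.
  The 0 behind the cut must be the gap \<open>d\<close>, and as \<open>g\<close> is a palindrome the
  cut halves \<open>gap h\<close>, so \<open>h = 2 * x\<close> and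
  \<open>z = f @ gap x\<close>.\<close>

lemma coherent_collision:
  assumes S: "S = f @ gap h @ z" "S = z @ gap d @ g" "rev f = f" "rev g = g" and f: "odd (length f)" "nz f" "last f \<noteq> 0"
    and z: "good z" "length f < length z" "length z < length f + length (gap h)" "coherent d h z"
    and others: "\<And>z'. balanced d h S z' \<Longrightarrow> z' = z \<or> balanced d h z z'"
  shows "pal_power_coherent d h S"
proof -
  have eq: "z @ gap d @ g = f @ gap h @ z" by (simp only: S(1)[symmetric] S(2)[symmetric])
  obtain K1 where K1: "z = f @ K1" "K1 @ gap d @ g = gap h @ z"
    by (rule append_eq_append_le[OF eq]) (use z(2) in auto)
  have "K1 \<noteq> []" using K1(1) z(2) by auto
  obtain K2 where K2: "gap h = K1 @ K2" "K2 @ z = gap d @ g"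
    by (rule append_eq_append_le[OF K1(2)[symmetric]]) (use z(3) K1(1) in auto)
  have "K2 \<noteq> []" using K2(1) K1(1) z(3) by auto
  have "last K1 \<noteq> 0" using K1(1) \<open>K1 \<noteq> []\<close> z(1) by (auto simp: good_def)
  then obtain u v where uv: "K1 = gap u" "K2 = 0 # gap v" "h = u + v" "u \<noteq> 0"
    using gap_split[OF K2(1) \<open>K1 \<noteq> []\<close> \<open>K2 \<noteq> []\<close>] by metis
  have "hd (gap d @ g) = 0" using K2(2) uv by (metis hd_append list.distinct(1) list.sel(1))
  then have d: "d = 0" by (auto simp: sgn_if split: if_splits)
  have "g = gap v @ f @ gap u" using K2(2) uv K1(1) d by simp
  then have *: "gap v @ (f @ gap u) = gap u @ (f @ gap v)" using S(3,4) by (metis append_assoc rev_append rev_gap)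
  have "nz (f @ X)" for X using f(2) by (simp add: nz_def)
  then have "u = v" using gap_append_eq[OF *] by blast
  define x where "x = u"
  have x: "x \<noteq> 0" "h = 2 * x" "z = f @ gap x" using uv K1(1) \<open>u = v\<close> by (auto simp: x_def)
  have Sx: "S = f @ gap (2 * x) @ f @ gap x" using S(1) x by simp
  consider "chain_coherent d h z" | "pal_power_coherent d h z"
    using z(4) x d unfolding coherent_def pal_power_coherent_def[of h] by auto
  \<comment> \<open>\<open>f\<close> itself need not generate the vectors balanced in
    \<open>z\<close>; \<open>f2\<close> is the root of the family to which they all belong.\<close>
  then have "\<exists>f2 k. rev f2 = f2 \<and> odd (length f2) \<and> z = pal_power f2 x k \<and> (\<forall>z'. balanced d h z z' \<longrightarrow> (\<exists>j. z' = pal_power f2 x j))"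
  proof cases
    case 1
    then obtain e p where e: "z = chain e 0 (2 * x) (2 * p)" "\<And>z'. balanced d h z z' \<Longrightarrow> \<exists>q. z' = chain e 0 (2 * x) (2 * q)"
      unfolding chain_coherent_def d x(2) by blast
    have "\<exists>f2. e = f2 @ gap x \<and> rev f2 = f2 \<and> odd (length f2)"
      using chain_pal_power_base[of e x p f] e(1) x S(3) f by auto
    then obtain f2 where f2: "e = f2 @ gap x" "rev f2 = f2" "odd (length f2)" by blast
    show ?thesis using e f2 pal_power_chain[OF f2(2) x(1)] by metis
  next
    case 2
    then show ?thesis unfolding pal_power_coherent_def using x(2) by auto
  qed
  then obtain f2 k where f2: "rev f2 = f2" "odd (length f2)" "z = pal_power f2 x k" "\<And>z'. balanced d h z z' \<Longrightarrow> \<exists>j. z' = pal_power f2 x j"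
    by blast
  have "f @ gap x = (concat (replicate k (f2 @ gap (2 * x))) @ f2) @ gap x" using f2(3) x(3) by (simp add: pal_power_def)
  then have ff: "f = concat (replicate k (f2 @ gap (2 * x))) @ f2" by simp
  have "S = pal_power f2 x (k + (1 + k))"
    unfolding Sx pal_power_add using ff by (simp add: pal_power_def)
  moreover have "\<exists>j. z' = pal_power f2 x j" if "balanced d h S z'" for z' using others[OF that] f2 by blast
  ultimately show ?thesis unfolding pal_power_coherent_def using d x f2 by blast
qed

text \<open>The induction passes to the longest \<open>z\<close> balanced in \<open>S\<close>. In
  cases A and C the boundaries fit and a Euclidean step is possible; in B and D a boundary falls
  inside a gap, and D is B for the reversed vectors.\<close>

lemma balanced_coherent:
  assumes "good S"
  shows "coherent d h S"
  using assms
proof (induction "length S" arbitrary: S rule: less_induct)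
  case less
  note gS = less.prems
  show ?case
  proof (cases "\<exists>z. balanced d h S z")
    case False
    then have "chain_coherent d h S"
      unfolding chain_coherent_def by (intro exI[of _ S] exI[of _ 0]) auto
    then show ?thesis by (simp add: coherent_def)
  next
    case True
    have "\<forall>z. balanced d h S z \<longrightarrow> length z < length S" using balancedE[OF _ gS] by metis
    then obtain z where z: "balanced d h S z" and mx: "\<And>z'. balanced d h S z' \<Longrightarrow> length z' \<le> length z"
      using True ex_has_greatest_nat[of "balanced d h S" _ length "length S"] by (metis less_imp_le_nat)
    obtain f g where fg: "S = z @ gap d @ g" "S = f @ gap h @ z" "rev f = f" "rev g = g"
      "odd (length f)" "odd (length g)" "nz f" "nz g" "hd f = hd S" "last f \<noteq> 0" "last g \<noteq> 0" "good z"
      "length z < length S"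
      using balancedE[OF z gS] by metis
    have others: "z' = z \<or> balanced d h z z'" if z': "balanced d h S z'" for z'
    proof (cases "length z' < length z")
      case True
      then show ?thesis using balanced_chain[OF z z' _ gS] by blast
    next
      case False
      then have "length z' = length z" using mx[OF z'] by simp
      moreover obtain g' where "S = z' @ gap d @ g'" using z' unfolding balanced_def by blast
      ultimately show ?thesis using fg(1) by (metis append_eq_append_conv)
    qed
    have eq: "z @ gap d @ g = f @ gap h @ z" by (simp only: fg(1)[symmetric] fg(2)[symmetric])
    have cz: "coherent d h z" using less.hyps fg by blast
    have ez: "even (length z)" using fg(12) by (simp add: good_def)
    \<comment> \<open>\<open>f\<close> and \<open>z\<close> cannot have equal length, one being odd
      and the other even.\<close>
    consider (A) "length f + length (gap h) \<le> length z"
      | (B) "length f < length z" "length z < length f + length (gap h)"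
      | (C) "length z + length (gap d) \<le> length f"
      | (D) "length z < length f" "length f < length z + length (gap d)"
      using fg(5) ez by (metis not_le nat_neq_iff)
    then show ?thesis
    proof cases
      case A
      have "z @ gap d @ g = (f @ gap h) @ z" using eq by simp
      then obtain z2 where "z = (f @ gap h) @ z2" "z2 @ gap d @ g = z"
        by (rule append_eq_append_le) (use A in auto)
      then have z2: "z = f @ gap h @ z2" "z = z2 @ gap d @ g" by simp_all
      have "even (length z2)" using arg_cong[OF z2(1), of "\<lambda>x. even (length x)"] ez fg(5) by simp
      then have "balanced d h z z2" unfolding balanced_def using z2 fg(3,4) by metis
      then show ?thesis using coherent_extend[OF cz others] fg z2 by metis
    next
      case B
      then show ?thesis
        using coherent_collision[OF fg(2,1,3,4,5,7,10,12) _ _ cz others] by (simp add: coherent_def)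
    next
      \<comment> \<open>The remainder \<open>u\<close> of \<open>f\<close> is itself balanced in
        \<open>S\<close>, hence is \<open>z\<close> or is balanced in \<open>z\<close>.\<close>
      case C
      have "f @ gap h @ z = (z @ gap d) @ g" using eq by simp
      then obtain v where "f = (z @ gap d) @ v" "v @ gap h @ z = g"
        by (rule append_eq_append_le) (use C in auto)
      then have v: "f = z @ gap d @ v" "g = v @ gap h @ z" by simp_all
      define u where "u = rev v"
      have f1: "f = z @ gap d @ rev u" and g1: "g = rev u @ gap h @ z" using v by (auto simp: u_def)
      have f2: "f = u @ gap d @ rev z" and g2: "g = rev z @ gap h @ u"
        using f1 g1 fg(3,4) by (metis append_assoc rev_append rev_gap rev_rev_ident)+
      have eu: "even (length u)"
        using arg_cong[OF f1, of "\<lambda>x. even (length x)"] ez fg(5) by simp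
      have Su: "S = z @ gap d @ rev u @ gap h @ z" using fg(2) f1 by simp
      have "S = u @ gap d @ (rev z @ gap h @ z)" "S = (z @ gap d @ rev z) @ gap h @ u"
        using fg(1,2) f2 g2 by simp_all
      then have "balanced d h S u" unfolding balanced_def using eu
        by (metis append_assoc rev_append rev_gap rev_rev_ident)
      then have "u = z \<or> balanced d h z u" using others by blast
      then show ?thesis using coherent_extend[OF cz others] Su by blast
    next
      case D
      obtain D1 where D1: "f = z @ D1" "D1 @ gap h @ z = gap d @ g"
        by (rule append_eq_append_le[OF eq[symmetric]]) (use D in auto)
      have "D1 \<noteq> []" using D1(1) D by auto
      obtain D2 where D2: "gap d = D1 @ D2" "D2 @ g = gap h @ z"
        by (rule append_eq_append_le[OF D1(2)[symmetric]]) (use D(2) D1(1) in auto)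
      have "D2 \<noteq> []" using D2(1) D1(1) D(2) by auto
      have "last D1 \<noteq> 0" using D1(1) \<open>D1 \<noteq> []\<close> fg(10) by simp
      then obtain v where v: "D2 = 0 # gap v" using gap_split[OF D2(1) \<open>D1 \<noteq> []\<close> \<open>D2 \<noteq> []\<close>] by metis
      have "hd (gap h @ z) = 0" using D2(2) v by (metis hd_append list.distinct(1) list.sel(1))
      then have h: "h = 0" by (auto simp: sgn_if split: if_splits)
      then have zv: "z = gap v @ g" using D2(2) v by simp
      have r: "rev S = g @ gap d @ rev z" "rev S = rev z @ gap h @ f"
        using fg(1-4) by (metis append_assoc rev_append rev_gap)+
      have "pal_power_coherent h d (rev S)"
      proof (rule coherent_collision[OF r fg(4,3,6,8,11)])
        show "length g < length (rev z)" using zv by simp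
        show "length (rev z) < length g + length (gap d)" using zv D2(1) v by simp
        show "coherent h d (rev z)" using coherent_rev[OF cz] .
        show "z' = rev z \<or> balanced h d (rev z) z'" if "balanced h d (rev S) z'" for z'
          using others[of "rev z'"] balanced_rev[OF that] balanced_rev[of d h z "rev z'"] by auto
      qed (use fg in simp)
      then show ?thesis by (simp add: coherent_def)
    qed
  qed
qed

section \<open>Incompatibility of even and odd exponents in the exceptional family\<close>

lemma pars_chain: "pars e (chain e m n j)"
proof (induction j arbitrary: e m n)
  case 0
  show ?case by (simp add: pars_base)
next
  case (Suc j)
  have "pars e (e @ gap m @ scale 1 (chain (rev e) n m j))"
    by (intro pars_step) (use Suc in auto)
  then show ?case by simp
qed

lemma last_chain: "e \<noteq> [] \<Longrightarrow> last (chain e m n (2 * q)) = last e"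
  by (cases "2 * q") (auto simp: chain_Suc_right simp del: chain.simps(2), presburger+)

text \<open>An instance of transitivity. An even chain ends with the last entry of \<open>e\<close>,
  so the sign rule at zero gaps carries over to the finer blocks.\<close>

lemma pars_trans_chain:
  assumes "pars S Y" "S = chain e m n (2 * q)" "block e"
  shows "pars e Y"
  using assms
proof (induction arbitrary: e m n rule: pars.induct)
  case (pars_base S)
  then show ?case by (simp add: pars_chain)
next
  case (pars_step S W s k)
  have "rev S = chain (rev e) n m (2 * q)" using pars_step.prems by (simp add: rev_chain)
  then have W: "pars (rev e) W" using pars_step.IH pars_step.prems by simp
  have e: "e \<noteq> []" "even (length e)" using pars_step.prems by (auto simp: block_def)
  have "pars e (chain e m n (2 * q) @ gap k @ scale s W)"
  proof (rule pars_append_pars)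
    show "pars (if even (length (chain e m n (2 * q))) then rev e else e) W"
      using W e even_length_chain by simp
    have "hd W = last e" using pars_hd[OF W] e by (simp add: hd_rev)
    then show "k = 0 \<longrightarrow> s * hd W = last (chain e m n (2 * q))"
      using pars_step.hyps(3) e last_chain by simp
  qed (use pars_chain pars_step in auto)
  then show ?case using pars_step.prems by simp
qed

lemma hd_pal_power:
  assumes "f \<noteq> []"
  shows "pal_power f x k \<noteq> []" "hd (pal_power f x k) = hd f"
  using assms by (cases k; auto simp: pal_power_def)+

text \<open>An odd power is a chain with an even number of blocks followed by a surplus half gap
  \<open>gap x\<close>; the contradiction below comes from this surplus.\<close>

lemma pal_power_odd:
  assumes "rev f = f" "x \<noteq> 0"
  shows "pal_power f x (Suc (2 * k)) = chain (f @ gap x) 0 (2 * x) (Suc (2 * k)) @ gap x"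
    "chain (f @ gap x) 0 (2 * x) (Suc (2 * k)) = concat (replicate (Suc (2 * k)) (f @ gap (2 * x))) @ f"
proof -
  have "chain (f @ gap x) 0 (2 * x) (Suc (2 * k)) = pal_power f x (2 * k) @ 0 # rev (pal_power f x 0)"
    using assms by (simp add: chain_Suc_right pal_power_chain pal_power_0 del: chain.simps)
  then show *: "chain (f @ gap x) 0 (2 * x) (Suc (2 * k)) = concat (replicate (Suc (2 * k)) (f @ gap (2 * x))) @ f"
    using pal_power_0_rev_pal_power[OF assms, of "2 * k" 0] by simp
  show "pal_power f x (Suc (2 * k)) = chain (f @ gap x) 0 (2 * x) (Suc (2 * k)) @ gap x"
    unfolding * by (simp add: pal_power_def)
qed

text \<open>\<open>f\<close> begins with \<open>gap d\<close> and, being a palindrome, also ends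
  with it. Cancelling the overlap leaves a block whose leading \<open>gap x\<close> must coincide
  with \<open>gap (2 * x)\<close> up to sign.\<close>

lemma pal_power_conflict_aux:
  assumes f: "rev f = f" "nz f" and x: "x \<noteq> 0" and d: "d \<noteq> 0" and s: "unit_sign s"
    and eq: "gap d @ scale s (gap x @ f @ gap (2 * x) @ C) = f @ gap x @ W1" and C: "nz C"
    and W1: "W1 = [] \<or> (\<exists>k e W. W1 = gap k @ scale e W \<and> unit_sign e \<and> pars (gap x @ f) W)"
  shows False
proof -
  have f0: "f \<noteq> []" "hd f \<noteq> 0" using f(2) by (auto simp: nz_def)
  have lf: "last f \<noteq> 0" using f0 f(1) by (metis hd_rev)
  have "\<not> length f < length (gap d)"
  proof
    assume lt: "length f < length (gap d)"
    obtain V where V: "gap d = f @ V" "V @ scale s (gap x @ f @ gap (2 * x) @ C) = gap x @ W1"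
      by (rule append_eq_append_le[OF eq]) (use lt in auto)
    have "V \<noteq> []" using lt V(1) by auto
    then obtain v where "V = 0 # gap v" using gap_split[OF V(1) f0(1) _ lf] by metis
    then have "hd (gap x @ W1) = 0" using V(2) by (metis append_Cons list.sel(1))
    then show False using x by (auto simp: sgn_if split: if_splits)
  qed
  then obtain f1 where f1: "f = gap d @ f1" "f1 @ gap x @ W1 = scale s (gap x @ f @ gap (2 * x) @ C)"
    using append_eq_append_le[OF eq[symmetric]] by (metis not_less)
  have "f = rev f1 @ gap d" using f1(1) f(1) by (metis rev_append rev_gap)
  then have "scale s (gap x @ f @ gap (2 * x) @ C) = scale s (gap x @ rev f1) @ scale s (gap d @ gap (2 * x) @ C)"
    by simp
  then have "(f1 @ gap x) @ W1 = scale s (gap x @ rev f1) @ scale s (gap d @ gap (2 * x) @ C)"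
    using f1(2) by simp
  then have "W1 = scale s (gap d @ gap (2 * x) @ C)"
    by (subst (asm) append_eq_append_conv) auto
  then have W1e: "W1 = gap (s * d) @ scale s (gap (2 * x) @ C)" using s by (simp add: scale_gap)
  then have "W1 \<noteq> []" by simp
  then obtain k e W where W: "W1 = gap k @ scale e W" "unit_sign e" "pars (gap x @ f) W" using W1 by blast
  obtain T where T: "W = gap x @ f @ T" using pars_append[OF W(3)] by auto
  have n1: "nz (scale e W)" using W(2) x T by (auto simp: nz_def hd_scale sgn_if)
  have n2: "nz (scale s (gap (2 * x) @ C))" using s x by (auto simp: nz_def hd_scale sgn_if)
  have "gap k @ scale e W = gap (s * d) @ scale s (gap (2 * x) @ C)" using W W1e by simp
  then have "scale e W = scale s (gap (2 * x) @ C)" using gap_append_eq n1 n2 by blast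
  then have *: "gap (e * x) @ scale e (f @ T) = gap (s * (2 * x)) @ scale s C"
    using T W(2) s by (simp add: scale_gap)
  have "nz (scale e (f @ T))" "nz (scale s C)"
    using f(2) C W(2) s f0 by (auto simp: nz_def hd_scale hd_append)
  then have "e * x = s * (2 * x)" using gap_append_eq[OF *] by blast
  then show False using x W(2) s by auto
qed

text \<open>If the gap \<open>d\<close> after the first odd power is 0, then \<open>x, 0, x\<close>
  is read as one gap \<open>2x\<close>, the parsing by \<open>f @ gap x\<close> stays in step, and
  two odd powers can be removed. Any other gap is impossible by
  \<open>pal_power_conflict_aux\<close>.\<close>

lemma pal_power_conflict:
  assumes "pars (f @ gap x) c" "pars (pal_power f x (Suc (2 * k))) c" "even (length c)"
    and f: "rev f = f" "nz f" "odd (length f)" and x: "x \<noteq> 0"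
  shows False
  using assms(1-3)
proof (induction "length c" arbitrary: c rule: less_induct)
  case less
  define e where "e = f @ gap x"
  define C where "C = chain e 0 (2 * x) (Suc (2 * k))"
  have pal_powerC: "pal_power f x (Suc (2 * k)) = C @ gap x" and Cf: "C = concat (replicate (Suc (2 * k)) (f @ gap (2 * x))) @ f"
    using pal_power_odd[OF f(1) x] by (simp_all only: C_def e_def)
  have rC: "rev C = C" unfolding C_def rev_chain by simp
  have f0: "f \<noteq> []" "hd f \<noteq> 0" using f(2) by (auto simp: nz_def)
  have be: "block e" using f f0 x by (auto simp: block_def e_def sgn_if)
  have "even (length (C @ gap x)) \<longleftrightarrow> odd (length C)" by simp
  have oC: "odd (length C)" unfolding Cf using f(3) by (simp add: length_concat sum_list_replicate)
  have peC: "pars e C" unfolding C_def by (rule pars_chain)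
  have C0: "C \<noteq> []" "hd C = hd f" using Cf f0 by auto
  have split: "\<exists>k s W. T = gap k @ scale s W \<and> unit_sign s \<and> pars e W" if "pars e (C @ T)" "T \<noteq> []" for T
    using pars_sync[OF peC be that] oC by auto
  have hW: "W \<noteq> [] \<and> hd W = hd f" if "pars e W" for W
    using pars_hd[OF that] pars_neq_Nil[OF that] f0 by (auto simp: e_def)
  have pc: "pars e c" using less.prems(1) by (simp add: e_def)
  \<comment> \<open>A parsing cannot end with a gap: after splitting off a gap, the rest of
    \<open>gap x\<close> starts with 0 and is not a block.\<close>
  have "c \<noteq> C @ gap x"
  proof
    assume "c = C @ gap x"
    then obtain j s W where *: "gap x = gap j @ scale s W" "unit_sign s" "pars e W" using split[of "gap x"] pc by auto
    have "hd (gap x) = hd (gap j)" using *(1) by (metis gap_neq_Nil hd_append2)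
    then have "last (gap j) \<noteq> 0" using x by (auto simp: sgn_if split: if_splits)
    moreover have "scale s W \<noteq> []" using hW[OF *(3)] by simp
    ultimately obtain v where "scale s W = 0 # gap v" using gap_split[OF *(1) gap_neq_Nil] by metis
    then have "hd (scale s W) = 0" by simp
    then show False using hW[OF *(3)] *(2) f0 by (auto simp: hd_scale)
  qed
  then obtain d s2 R' where c: "c = (C @ gap x) @ gap d @ scale s2 R'" "unit_sign s2" "d = 0 \<longrightarrow> s2 = 1" "pars (rev (C @ gap x)) R'"
    using less.prems(2) pars_iff[of "C @ gap x" c] unfolding pal_powerC by blast
  have "R' \<noteq> rev (C @ gap x)" using c(1) less.prems(3) oC by auto
  then obtain d2 s3 c' where R': "R' = gap x @ C @ gap d2 @ scale s3 c'" "unit_sign s3" "pars (C @ gap x) c'"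
    using c(4) pars_iff[of "rev (C @ gap x)" R'] rC by auto
  define Z where "Z = gap d2 @ scale s3 c'"
  have hc': "c' \<noteq> []" "hd c' = hd f" using pars_hd[OF R'(3)] pars_neq_Nil[OF R'(3)] C0 by auto
  have cT: "c = C @ gap x @ gap d @ scale s2 (gap x @ C @ Z)" using c R' by (simp add: Z_def)
  obtain j s W where W: "gap x @ gap d @ scale s2 (gap x @ C @ Z) = gap j @ scale s W" "unit_sign s" "pars e W"
    using split[of "gap x @ gap d @ scale s2 (gap x @ C @ Z)"] pc cT by auto
  have nW: "nz (scale s W)" using hW[OF W(3)] W(2) f0 by (auto simp: nz_def hd_scale)
  show False
  proof (cases "d = 0")
    case True
    then have *: "gap (2 * x) @ (C @ Z) = gap j @ scale s W" using W(1) c(3) x by (simp add: gap_double)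
    have "nz (C @ Z)" using C0 f0 by (simp add: nz_def)
    then have CZ: "C @ Z = scale s W" using gap_append_eq[OF * _ nW] by blast
    from arg_cong[OF this, of hd] have "s = 1"
      using C0 hW[OF W(3)] W(2) f0 by (auto simp: hd_scale)
    then have "pars e (C @ Z)" using CZ W(3) by simp
    then obtain j' s' W' where W': "Z = gap j' @ scale s' W'" "unit_sign s'" "pars e W'" using split[of Z] by (auto simp: Z_def)
    have "gap d2 @ scale s3 c' = gap j' @ scale s' W'" using W'(1) by (simp add: Z_def)
    moreover have "nz (scale s3 c')" "nz (scale s' W')"
      using hc' hW[OF W'(3)] R'(2) W'(2) f0 by (auto simp: nz_def hd_scale)
    ultimately have cW: "scale s3 c' = scale s' W'" using gap_append_eq by blast
    from arg_cong[OF this, of hd] have "s3 = s'"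
      using hc' hW[OF W'(3)] R'(2) W'(2) f0 by (auto simp: hd_scale)
    then have "c' = W'" using cW scale_inj R'(2) by blast
    then have "pars e c'" using W'(3) by simp
    moreover have "length c' < length c" "even (length c')"
      using cT oC less.prems(3) by (simp_all add: Z_def)
    ultimately show False using less.hyps[of c'] R'(3) pal_powerC by (simp add: e_def)
  next
    case False
    have "nz (gap d @ scale s2 (gap x @ C @ Z))" using False by (auto simp: nz_def sgn_if)
    then have eq: "gap d @ scale s2 (gap x @ C @ Z) = scale s W" using gap_append_eq[OF W(1) _ nW] by blast
    obtain W1 where W1: "W = e @ W1" using pars_append[OF W(3)] by blast
    have W1': "W1 = [] \<or> (\<exists>k e W. W1 = gap k @ scale e W \<and> unit_sign e \<and> pars (gap x @ f) W)"
      using W(3) pars_iff[of e W] W1 f(1) by (auto simp: e_def)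
    obtain C' where C': "C = f @ gap (2 * x) @ C'" "nz C'"
    proof -
      have "C = f @ gap (2 * x) @ concat (replicate (2 * k) (f @ gap (2 * x))) @ f" using Cf by simp
      moreover have "nz (concat (replicate (2 * k) (f @ gap (2 * x))) @ f)"
        using f(2) f0 by (cases "2 * k") (auto simp: nz_def)
      ultimately show ?thesis using that by blast
    qed
    have "W = scale s (gap d @ scale s2 (gap x @ C @ Z))" using eq W(2) scale_cancel by metis
    then have eq': "gap (s * d) @ scale (s * s2) (gap x @ f @ gap (2 * x) @ (C' @ Z)) = f @ gap x @ W1"
      using W1 W(2) C'(1) by (simp add: e_def scale_gap)
    have "nz (C' @ Z)" using C'(2) by (auto simp: nz_def)
    moreover have "unit_sign (s * s2)" using W(2) c(2) by auto
    moreover have "s * d \<noteq> 0" using False W(2) by auto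
    ultimately show False using pal_power_conflict_aux[OF f(1,2) x _ _ eq' _ W1'] by blast
  qed
qed

lemma pal_power_parity:
  assumes "pars (pal_power f x i) (scale s c)" "pars (pal_power f x j) (scale t c)" "unit_sign s" "unit_sign t" "even (length c)"
    and f: "rev f = f" "nz f" "odd (length f)" and x: "x \<noteq> 0" and ij: "even i" "odd j"
  shows False
proof -
  have f0: "f \<noteq> []" "hd f \<noteq> 0" using f(2) by (auto simp: nz_def)
  note hp = hd_pal_power[OF f0(1)]
  have "c \<noteq> []" using pars_neq_Nil[OF assms(1)] hp by auto
  then have "s * hd c = hd f" "t * hd c = hd f"
    using pars_hd[OF assms(1)] pars_hd[OF assms(2)] hp by (auto simp: hd_scale)
  then have "s = t" using f0 assms(3,4) by auto
  obtain q where i: "i = 2 * q" using ij by auto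
  obtain k where j: "j = Suc (2 * k)" using ij by (auto elim: oddE)
  have be: "block (f @ gap x)" using f f0 x by (auto simp: block_def sgn_if)
  have "pars (f @ gap x) (scale s c)"
    by (rule pars_trans_chain[OF assms(1) _ be, where m = 0 and n = "2 * x" and q = q])
       (use i pal_power_chain[OF f(1) x, of q] in auto)
  then show False using pal_power_conflict[of f x "scale s c" k] assms(2,5) \<open>s = t\<close> j f x by simp
qed

text \<open>If all exponents are odd, the same vectors are powers of the palindrome
  \<open>(f, 2x, f)\<close> with exponents \<open>k div 2\<close>. This is repeated until some
  exponent is even; then all are, since mixed parities are excluded. The signs \<open>s i\<close>
  are there for the reversed vectors.\<close>

lemma pal_power_family:
  assumes "\<And>i. i \<in> I \<Longrightarrow> a i = pal_power f x (k i)" "\<And>i. i \<in> I \<Longrightarrow> unit_sign (s i) \<and> pars (a i) (scale (s i) c)"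
    and "even (length c)" "rev f = f" "nz f" "odd (length f)" "x \<noteq> 0" "i0 \<in> I"
  shows "\<exists>e q. \<forall>i\<in>I. a i = chain e 0 (2 * x) (2 * q i)"
  using assms
proof (induction "k i0" arbitrary: k f rule: less_induct)
  case less
  note f = less.prems(4-6) and x = less.prems(7)
  consider (e) "\<forall>i\<in>I. even (k i)" | (o) "\<forall>i\<in>I. odd (k i)" | (m) i j where "i \<in> I" "j \<in> I" "even (k i)" "odd (k j)"
    by blast
  then show ?case
  proof cases
    case e
    have "\<forall>i\<in>I. a i = chain (f @ gap x) 0 (2 * x) (2 * (k i div 2))"
      using e pal_power_chain[OF f(1) x] less.prems(1) by (metis dvd_mult_div_cancel)
    then show ?thesis by (intro exI[of _ "f @ gap x"] exI[of _ "\<lambda>i. k i div 2"])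
  next
    case o
    let ?f = "f @ gap (2 * x) @ f"
    have half: "pal_power f x (Suc (2 * j)) = pal_power ?f x j" for j
    proof -
      have "concat (replicate (2 * j) (f @ gap (2 * x))) = concat (replicate j (?f @ gap (2 * x)))"
        by (induction j) auto
      then have "concat (replicate (2 * j + 1) (f @ gap (2 * x))) = concat (replicate j (?f @ gap (2 * x))) @ f @ gap (2 * x)"
        by (simp only: replicate_add concat_append) simp
      then show ?thesis by (simp add: pal_power_def)
    qed
    have "k i = Suc (2 * (k i div 2))" if "i \<in> I" for i using o that by simp
    then have a: "a i = pal_power ?f x (k i div 2)" if "i \<in> I" for i
      using less.prems(1)[OF that] half that by metis
    have "k i0 div 2 < k i0" using o less.prems(8) by (cases "k i0") auto
    moreover have "rev ?f = ?f" "nz ?f" "odd (length ?f)" using f by (auto simp: nz_def)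
    ultimately show ?thesis
      using less.hyps[of "\<lambda>i. k i div 2" ?f] a less.prems(2,3,7,8) by blast
  next
    case m
    have "pars (pal_power f x (k i)) (scale (s i) c)" "pars (pal_power f x (k j)) (scale (s j) c)" "unit_sign (s i)" "unit_sign (s j)"
      using less.prems(1,2) m by metis+
    then show ?thesis using pal_power_parity m f x less.prems(3) by blast
  qed
qed

text \<open>Cancelling the common end \<open>y\<close> in two forms of \<open>S\<close> leaves one
  vector ending with \<open>gap d1\<close> and with \<open>gap d2\<close>. Nonemptiness of
  \<open>z2\<close> provides the nonzero entry needed to read the second gap.\<close>

lemma balanced_same_gap:
  assumes "balanced d1 h1 S z1" "balanced d2 h2 S z2" "balanced d' h' z1 z2" "good S" "z2 \<noteq> []"
  shows "d1 = d2"
proof -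
  obtain f1 g1 where 1: "S = z1 @ gap d1 @ g1" "S = f1 @ gap h1 @ z1" "rev f1 = f1" "rev g1 = g1" "nz g1" "last g1 \<noteq> 0" "good z1"
    using balancedE[OF assms(1,4)] by metis
  obtain f2 g2 where 2: "S = z2 @ gap d2 @ g2" "S = f2 @ gap h2 @ z2" "rev f2 = f2" "rev g2 = g2" "nz g2" "good z2"
    using balancedE[OF assms(2,4)] by metis
  obtain y where 3: "z1 = z2 @ gap d' @ y" "rev y = y" "nz y"
    using balancedE[OF assms(3) 1(7)] by metis
  have e1: "gap d2 @ g2 = gap d' @ (y @ gap d1 @ g1)"
  proof -
    have "z2 @ gap d2 @ g2 = z2 @ gap d' @ y @ gap d1 @ g1"
      by (simp only: 2(1)[symmetric]) (simp only: 1(1) 3(1) append_assoc)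
    then show ?thesis by simp
  qed
  have "nz (y @ gap d1 @ g1)" using 3(3) by (simp add: nz_def)
  then have dd: "d2 = d'" "g2 = y @ gap d1 @ g1" using gap_append_eq[OF e1 2(5)] by auto
  then have "g2 = g1 @ gap d1 @ y" using 1(4) 2(4) 3(2) by (metis append_assoc rev_append rev_gap)
  then have "S = (z2 @ gap d2 @ g1 @ gap d1) @ y" using 2(1) by simp
  moreover have "S = (f1 @ gap h1 @ z2 @ gap d2) @ y" using 1(2) 3(1) dd by simp
  ultimately have "z2 @ gap d2 @ g1 @ gap d1 = f1 @ gap h1 @ z2 @ gap d2" by simp
  then have "gap d1 @ (rev g1 @ gap d2 @ rev z2) = gap d2 @ (rev z2 @ gap h1 @ rev f1)"
    by (metis append_assoc rev_append rev_gap)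
  moreover have "nz (rev g1 @ X)" for X using 1(4,5) by (simp add: nz_def)
  moreover have "nz (rev z2 @ X)" for X using 2(6) assms(5) by (simp add: nz_def good_def hd_rev)
  ultimately show ?thesis using gap_append_eq by blast
qed

lemma balanced_same:
  assumes "balanced d1 h1 S z1" "balanced d2 h2 S z2" "balanced d' h' z1 z2" "good S" "z2 \<noteq> []"
  shows "d1 = d2 \<and> h1 = h2"
  using balanced_same_gap[OF assms] balanced_same_gap[OF assms(1-3)[THEN balanced_rev]] assms(4,5) by simp

text \<open>Each entry is one of the gaps -1, 0, 1 between empty blocks: the unknot lies below every
  knot.\<close>

lemma pars_Nil: "set b \<subseteq> {-2, 0, 2} \<Longrightarrow> pars [] b"
proof (induction b)
  case Nil
  show ?case by (rule pars_base)
next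
  case (Cons y b)
  have 1: "gap (-1) = [-2]" "gap 0 = [0]" "gap 1 = [2]"
    by (rule gap_eqI[symmetric]; simp add: length_gap)+
  have "y = -2 \<or> y = 0 \<or> y = 2" using Cons.prems by auto
  then obtain k where "gap k = [y]" using 1 by metis
  then have "pars [] ([] @ gap k @ scale 1 b)" using Cons by (intro pars_step) auto
  then show ?case using \<open>gap k = [y]\<close> by simp
qed

text \<open>With at least two members, none is empty by \<open>pars_Nil\<close>, and their lengths
  differ because all are prefixes of \<open>c\<close>. Every other member is then balanced in the
  longest one, with the same two gaps throughout.\<close>

lemma common_chain:
  assumes a: "\<And>i. i \<in> I \<Longrightarrow> a i \<in> vecs_even \<and> pars (a i) c" and c: "even (length c)"
    and inc: "\<And>i j. i \<in> I \<Longrightarrow> j \<in> I \<Longrightarrow> i \<noteq> j \<Longrightarrow> \<not> pars (a i) (a j)"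
  shows "\<exists>e m n p. \<forall>i\<in>I. a i = chain e m n (2 * p i)"
proof (cases "\<exists>i\<in>I. \<exists>j\<in>I. i \<noteq> j")
  case False
  show ?thesis
  proof (cases "I = {}")
    case False
    then obtain i where "i \<in> I" by blast
    then have "I = {i}" using \<open>\<not> (\<exists>i\<in>I. \<exists>j\<in>I. i \<noteq> j)\<close> by blast
    then show ?thesis by (intro exI[of _ "a i"] exI[of _ 1] exI[of _ "\<lambda>_. 0"]) auto
  qed auto
next
  case True
  have ne: "a i \<noteq> []" if "i \<in> I" for i
  proof
    assume "a i = []"
    obtain j where j: "j \<in> I" "i \<noteq> j" using True by blast
    have "pars (a i) (a j)" using a[OF j(1)] \<open>a i = []\<close> pars_Nil by (auto simp: vecs_even_def vecs_def)
    then show False using inc[OF that j] by blast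
  qed
  have block: "block (a i)" if "i \<in> I" for i
    using a[OF that] ne[OF that] by (auto simp: block_def vecs_even_def vecs_def)
  have vecs: "a i \<in> vecs" if "i \<in> I" for i using a[OF that] by (simp add: vecs_even_def)
  have len: "length (a i) \<noteq> length (a j)" if "i \<in> I" "j \<in> I" "i \<noteq> j" for i j
  proof
    assume l: "length (a i) = length (a j)"
    have "prefix (a i) c" "prefix (a j) c" using a that pars_prefix by blast+
    then have "a i = a j" using l by (metis prefix_def append_eq_append_conv)
    then show False using inc[OF that] pars_base by simp
  qed
  have pair: "\<exists>d h. balanced d h (a j) (a i)" if "i \<in> I" "j \<in> I" "length (a i) < length (a j)" for i j
    using common_upper_bound_balanced[of "a i" c "a j"] a block vecs inc that c by blast
  obtain i0 where i0: "i0 \<in> I" "\<And>i. i \<in> I \<Longrightarrow> length (a i) \<le> length (a i0)"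
  proof -
    have "\<forall>i. i \<in> I \<longrightarrow> length (a i) < Suc (length c)" using a pars_length_le by (simp add: less_Suc_eq_le)
    then show ?thesis
      using True that ex_has_greatest_nat[of "\<lambda>i. i \<in> I" _ "\<lambda>i. length (a i)" "Suc (length c)"] by metis
  qed
  have less0: "length (a i) < length (a i0)" if "i \<in> I" "i \<noteq> i0" for i
    using i0 len that by (metis le_neq_implies_less)
  obtain j0 where j0: "j0 \<in> I" "j0 \<noteq> i0" using True i0(1) by metis
  define S where "S = a i0"
  have gS: "good S" using block[OF i0(1)] by (auto simp: S_def block_def good_def)
  obtain d h where dh: "balanced d h S (a j0)" using pair[OF j0(1) i0(1) less0[OF j0]] S_def by blast
  have all: "balanced d h S (a i)" if i: "i \<in> I" "i \<noteq> i0" for i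
  proof (cases "i = j0")
    case False
    obtain d' h' where b': "balanced d' h' S (a i)" using pair[OF i(1) i0(1) less0[OF i]] S_def by blast
    consider "length (a i) < length (a j0)" | "length (a j0) < length (a i)"
      using len[OF i(1) j0(1) False] by linarith
    then show ?thesis
    proof cases
      case 1
      then obtain d2 h2 where "balanced d2 h2 (a j0) (a i)" using pair[OF i(1) j0(1)] by blast
      then show ?thesis using balanced_same[OF dh b' _ gS ne[OF i(1)]] b' by blast
    next
      case 2
      then obtain d2 h2 where "balanced d2 h2 (a i) (a j0)" using pair[OF j0(1) i(1)] by blast
      then show ?thesis using balanced_same[OF b' dh _ gS ne[OF j0(1)]] b' by blast
    qed
  qed (use dh in simp)
  have cover: "a i = S \<or> balanced d h S (a i)" if "i \<in> I" for i
    using all[OF that] S_def by (cases "i = i0") auto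
  consider "chain_coherent d h S" | "pal_power_coherent d h S" | "pal_power_coherent h d (rev S)"
    using balanced_coherent[OF gS, of d h] unfolding coherent_def by blast
  then show ?thesis
  proof cases
    case 1
    then obtain e where "\<And>i. i \<in> I \<Longrightarrow> \<exists>q. a i = chain e d h (2 * q)"
      unfolding chain_coherent_def using cover by metis
    then show ?thesis by metis
  next
    case 2
    then obtain f x where f: "d = 0" "x \<noteq> 0" "rev f = f" "odd (length f)" "\<exists>k. S = pal_power f x k"
        "\<And>z. balanced d h S z \<Longrightarrow> \<exists>j. z = pal_power f x j"
      unfolding pal_power_coherent_def by blast
    have "\<exists>k. a i = pal_power f x k" if "i \<in> I" for i using cover[OF that] f by blast
    then obtain k where k: "\<And>i. i \<in> I \<Longrightarrow> a i = pal_power f x (k i)" by metis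
    have "f \<noteq> []" using f(4) by auto
    then have "hd f = hd S" using f(5) hd_pal_power by metis
    then have "nz f" using gS \<open>f \<noteq> []\<close> ne[OF i0(1)] by (auto simp: nz_def good_def S_def)
    have "\<exists>e q. \<forall>i\<in>I. a i = chain e 0 (2 * x) (2 * q i)"
      by (rule pal_power_family[of I a f x k "\<lambda>_. 1" c i0]) (use k a c f \<open>nz f\<close> i0(1) in auto)
    then show ?thesis by blast
  next
    \<comment> \<open>The reversed vectors form the exceptional family; they parse
      \<open>rev c\<close> only up to individual signs.\<close>
    case 3
    then obtain f x where f: "h = 0" "x \<noteq> 0" "rev f = f" "odd (length f)" "\<exists>k. rev S = pal_power f x k"
        "\<And>z. balanced h d (rev S) z \<Longrightarrow> \<exists>j. z = pal_power f x j"
      unfolding pal_power_coherent_def by blast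
    have "\<exists>k. rev (a i) = pal_power f x k" if "i \<in> I" for i using cover[OF that] f balanced_rev by metis
    then obtain k where k: "\<And>i. i \<in> I \<Longrightarrow> rev (a i) = pal_power f x (k i)" by metis
    have "f \<noteq> []" using f(4) by auto
    then have "hd f = hd (rev S)" using f(5) hd_pal_power by metis
    then have "nz f" using gS \<open>f \<noteq> []\<close> ne[OF i0(1)] by (auto simp: nz_def good_def S_def hd_rev)
    have "\<exists>s. unit_sign s \<and> pars (rev (a i)) (scale s (rev c))" if "i \<in> I" for i
      using pars_rev[of "a i" c] a[OF that] block[OF that] c by auto
    then obtain s where s: "\<And>i. i \<in> I \<Longrightarrow> unit_sign (s i) \<and> pars (rev (a i)) (scale (s i) (rev c))" by metis
    have "\<exists>e q. \<forall>i\<in>I. rev (a i) = chain e 0 (2 * x) (2 * q i)"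
      by (rule pal_power_family[of I "\<lambda>i. rev (a i)" f x k s "rev c" i0]) (use k s c f \<open>nz f\<close> i0(1) in auto)
    then obtain e q where "\<And>i. i \<in> I \<Longrightarrow> rev (a i) = chain e 0 (2 * x) (2 * q i)" by blast
    then have "a i = chain (rev e) (2 * x) 0 (2 * q i)" if "i \<in> I" for i
      using rev_chain[of e 0 "2 * x" "2 * q i"] that by (metis dvd_triv_left rev_rev_ident)
    then show ?thesis by blast
  qed
qed

section \<open>Denominators\<close>

text \<open>With \<open>T = u^2 + u^-2\<close> the closed form is
  \<open>(u^(2p+1) + u^-(2p+1)) / (u + u^-1)\<close>, which explains the odd numbers 2p + 1.\<close>

fun lucas :: "int \<Rightarrow> nat \<Rightarrow> int" where
  "lucas T 0 = 1"
| "lucas T (Suc 0) = T - 1"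
| "lucas T (Suc (Suc p)) = T * lucas T (Suc p) - lucas T p"

text \<open>As a function of \<open>j\<close> the sum obeys the same recurrence, with initial values
  \<open>2 * lucas T q\<close> and \<open>T * lucas T q\<close>.\<close>

lemma lucas_reflect: "j \<le> q \<Longrightarrow> lucas T q dvd lucas T (q + j) + lucas T (q - j)"
proof (induction j rule: induct_nat_012)
  case 1
  then obtain q' where "q = Suc q'" by (cases q) auto
  then show ?case by simp
next
  case (ge2 j)
  obtain r where q: "q = r + Suc (Suc j)" using ge2.prems le_Suc_ex by (metis add.commute)
  have 1: "lucas T (q + Suc (Suc j)) = T * lucas T (q + Suc j) - lucas T (q + j)" by simp
  have "q - Suc (Suc j) = r" "q - Suc j = Suc r" "q - j = Suc (Suc r)" using q by auto
  then have 2: "lucas T (q - Suc (Suc j)) = T * lucas T (q - Suc j) - lucas T (q - j)" by simp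
  have eq: "lucas T (q + Suc (Suc j)) + lucas T (q - Suc (Suc j)) =
      T * (lucas T (q + Suc j) + lucas T (q - Suc j)) - (lucas T (q + j) + lucas T (q - j))"
    unfolding 1 2 by (simp only: algebra_simps)
  show ?case unfolding eq using ge2 by (intro dvd_diff dvd_mult) auto
qed simp

text \<open>The sequence extended to negative indices is invariant under \<open>p -> -1 - p\<close>.
  Combined with the reflection at \<open>q\<close>, this gives a shift by 2q + 1 with a change of
  sign modulo \<open>lucas T q\<close>.\<close>

lemma lucas_shift: "lucas T q dvd lucas T (2 * q + 1 + r) + lucas T r"
proof (cases q)
  case (Suc q')
  have a: "lucas T q dvd lucas T (2 * q) + 1"
    using lucas_reflect[of q q T] by (simp add: mult_2)
  have b: "lucas T q dvd lucas T (2 * q - 1) + (T - 1)"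
    using lucas_reflect[of q' q T] Suc by (simp add: mult_2)
  have e: "lucas T (2 * q + 1) = T * lucas T (2 * q) - lucas T (2 * q - 1)"
    using Suc by simp
  have c: "lucas T q dvd lucas T (2 * q + 1) + 1"
  proof -
    have eq: "lucas T (2 * q + 1) + 1 = T * (lucas T (2 * q) + 1) - (lucas T (2 * q - 1) + (T - 1))"
      unfolding e by (simp only: algebra_simps)
    show ?thesis unfolding eq using a b by (intro dvd_diff dvd_mult)
  qed
  show ?thesis
  proof (induction r rule: induct_nat_012)
    case 1
    have eq: "lucas T (2 * q + 1 + 1) + lucas T 1 = T * (lucas T (2 * q + 1) + 1) - (lucas T (2 * q) + 1)"
      by (simp add: algebra_simps)
    show ?case unfolding One_nat_def[symmetric] eq using a c by (intro dvd_diff dvd_mult)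
  next
    case (ge2 r)
    have eq: "lucas T (2 * q + 1 + Suc (Suc r)) + lucas T (Suc (Suc r)) =
      T * (lucas T (2 * q + 1 + Suc r) + lucas T (Suc r)) - (lucas T (2 * q + 1 + r) + lucas T r)"
      by (simp add: algebra_simps)
    show ?case unfolding eq using ge2 by (intro dvd_diff dvd_mult)
  qed (use c in simp)
qed simp

text \<open>The hypotheses give |T| >= 2 and |T - 1| > 1; they exclude T = 2, for which the sequence
  is constant.\<close>

lemma lucas_mono:
  assumes "T = 2 + 4 * s" "s \<noteq> 0"
  shows "\<bar>lucas T p\<bar> < \<bar>lucas T (Suc p)\<bar>"
proof (induction p)
  case 0
  show ?case using assms by auto
next
  case (Suc p)
  have T: "2 \<le> \<bar>T\<bar>" using assms by auto
  have "2 * \<bar>lucas T (Suc p)\<bar> \<le> \<bar>T\<bar> * \<bar>lucas T (Suc p)\<bar>"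
    using T by (intro mult_right_mono) auto
  also have "\<dots> = \<bar>T * lucas T (Suc p)\<bar>" by (simp add: abs_mult)
  finally show ?case using Suc by simp
qed

lemma lucas_strict_mono:
  assumes "T = 2 + 4 * s" "s \<noteq> 0" "p < q"
  shows "\<bar>lucas T p\<bar> < \<bar>lucas T q\<bar>"
  using lift_Suc_mono_less[of "\<lambda>p. \<bar>lucas T p\<bar>"] lucas_mono[OF assms(1,2)] assms(3) by blast

text \<open>A shift by 2q + 1 or a reflection at \<open>q\<close> lowers the index and keeps
  divisibility by \<open>lucas T q\<close>; an index below \<open>q\<close> contradicts strict
  growth.\<close>

lemma lucas_dvd:
  assumes T: "T = 2 + 4 * s" "s \<noteq> 0"
  shows "lucas T q dvd lucas T p \<Longrightarrow> 2 * q + 1 dvd 2 * p + 1"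
proof (induction p rule: less_induct)
  case (less p)
  have small: False if "r < q" "lucas T q dvd lucas T r" for r
  proof -
    have "lucas T r \<noteq> 0"
      using lucas_strict_mono[OF T, of 0 r] by (cases r) auto
    then have "\<bar>lucas T q\<bar> \<le> \<bar>lucas T r\<bar>" using that(2) dvd_imp_le_int by blast
    then show False using lucas_strict_mono[OF T that(1)] by simp
  qed
  consider "p < q" | "p = q" | "q < p" "p \<le> 2 * q" | "2 * q + 1 \<le> p" by linarith
  then show ?case
  proof cases
    case 1
    then show ?thesis using small less.prems by blast
  next
    case 3
    have "lucas T q dvd lucas T (q + (p - q)) + lucas T (q - (p - q))"
      by (rule lucas_reflect) (use 3 in simp)
    then have "lucas T q dvd lucas T (q - (p - q))"
      using less.prems 3 by (simp add: dvd_add_right_iff)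
    moreover have "q - (p - q) < q" using 3 by simp
    ultimately show ?thesis using small by blast
  next
    case 4
    then obtain r where r: "p = 2 * q + 1 + r" using le_Suc_ex by blast
    then have "lucas T q dvd lucas T r"
      using lucas_shift[of T q r] less.prems by (simp add: dvd_add_right_iff)
    then have "2 * q + 1 dvd 2 * r + 1" using less.IH[of r] r by simp
    moreover have "2 * p + 1 = 2 * (2 * q + 1) + (2 * r + 1)" using r by simp
    ultimately show ?thesis by (metis dvd_add dvd_triv_right)
  qed auto
qed

section \<open>Continued fraction matrices and denominators\<close>

fun mmul :: "int \<times> int \<times> int \<times> int \<Rightarrow> int \<times> int \<times> int \<times> int \<Rightarrow> int \<times> int \<times> int \<times> int" where
  "mmul (a, b, c, d) (a', b', c', d') = (a * a' + b * c', a * b' + b * d', c * a' + d * c', c * b' + d * d')"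

lemma cmat_append: "cmat (a @ b) = mmul (cmat a) (cmat b)"
proof (induction a)
  case Nil
  show ?case by (cases "cmat b") simp
next
  case (Cons t a)
  then show ?case by (cases "cmat a"; cases "cmat b") (simp add: algebra_simps)
qed

lemma gap_Suc: "0 < j \<Longrightarrow> gap (j + 1) = 2 # 0 # gap j"
  by (rule gap_eqI[symmetric]) (auto simp: length_gap nth_Cons nth_gap nat_add_distrib split: nat.splits)

lemma gap_1: "gap 1 = [2]"
  by (rule gap_eqI[symmetric]) (auto simp: length_gap)

lemma cmat_scale: "cmat (scale (-1) a) =
    (case cmat a of (w, x, y, z) \<Rightarrow> let s = (-1) ^ length a in (s * w, - s * x, - s * y, s * z))"
  by (induction a) (auto split: prod.splits simp: Let_def scale_def algebra_simps)

text \<open>A zero entry in a continued fraction adds its two neighbours, so a gap acts like the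
  single entry \<open>2 * k\<close>.\<close>

lemma cmat_gap: "cmat (gap k) = (0, 1, 1, 2 * k)"
proof -
  have pos: "cmat (gap (int (Suc n))) = (0, 1, 1, 2 * int (Suc n))" for n
  proof (induction n)
    case (Suc n)
    have "gap (int (Suc (Suc n))) = 2 # 0 # gap (int (Suc n))"
      using gap_Suc[of "int (Suc n)"] by (simp add: algebra_simps)
    then show ?case using Suc by simp
  qed (simp add: gap_1)
  consider "k = 0" | n where "k = int (Suc n)" | n where "k = - int (Suc n)"
    by (metis int_cases3 gr0_implies_Suc)
  then show ?thesis
  proof cases
    case 3
    then have "gap k = scale (-1) (gap (int (Suc n)))" by (simp add: scale_gap)
    then show ?thesis using pos[of n] 3 odd_length_gap[of "int (Suc n)"] by (simp add: cmat_scale Let_def)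
  qed (use pos in auto)
qed

definition den :: "int list \<Rightarrow> int" where
  "den a = snd (snd (snd (cmat a)))"

lemma den_rev: "den (rev a) = den a"
  by (simp add: den_def cmat_rev split: prod.splits)

lemma abs_den_scale: "unit_sign e \<Longrightarrow> \<bar>den (scale e a)\<bar> = \<bar>den a\<bar>"
  by (auto simp: den_def cmat_scale Let_def abs_mult power_abs split: prod.splits)

text \<open>The denominator of the concatenation has two summands: one contains
  \<open>z = den S\<close>, the other the denominator \<open>z'\<close> of the rest. The rest is
  parsed by \<open>rev S\<close>, which has the same denominator \<open>z\<close>.\<close>

lemma pars_den: "pars S Y \<Longrightarrow> den S dvd den Y"
proof (induction rule: pars.induct)
  case (pars_step S W e k)
  obtain w x y z where S: "cmat S = (w, x, y, z)" by (metis prod.exhaust)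
  obtain w' x' y' z' where W: "cmat (scale e W) = (w', x', y', z')" by (metis prod.exhaust)
  have "z dvd den (scale e W)"
    using pars_step abs_den_scale[of e W] S
    by (metis den_rev den_def dvd_abs_iff snd_conv)
  then have "z dvd z'" using W by (simp add: den_def)
  moreover have "den (S @ gap k @ scale e W) = y * z' + z * (x' + 2 * k * z')"
    using S W by (simp add: den_def cmat_append cmat_gap algebra_simps)
  ultimately show ?case using S by (simp add: den_def)
qed simp

text \<open>One period \<open>W\<close> acts by a matrix of determinant 1 whose trace is the
  parameter of \<open>lucas\<close>; the recurrence is Cayley-Hamilton.\<close>

lemma den_chain:
  assumes e: "cmat e = (w, x, y, z)" "w * z - x * y = 1"
  shows "den (chain e m n (2 * p)) = z * lucas (2 + 4 * ((m * z + y) * (n * z + x))) p"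
proof -
  define T where "T = 2 + 4 * ((m * z + y) * (n * z + x))"
  define W where "W = e @ gap m @ rev e @ gap n"
  obtain A B C D where W: "cmat W = (A, B, C, D)" by (metis prod.exhaust)
  have ABCD: "A = x * y + (w + 2 * m * x) * z" "B = x * w + (w + 2 * m * x) * x + 2 * n * A"
      "C = z * y + (y + 2 * m * z) * z" "D = z * w + (y + 2 * m * z) * x + 2 * n * C"
    using W e(1) unfolding W_def by (auto simp: cmat_append cmat_gap cmat_rev algebra_simps)
  define X where "X p = fst (snd (cmat (chain e m n (2 * p))))" for p
  define Z where "Z p = den (chain e m n (2 * p))" for p
  have rec: "X (Suc p) = A * X p + B * Z p" "Z (Suc p) = C * X p + D * Z p" for p
  proof -
    have "chain e m n (2 * Suc p) = W @ chain e m n (2 * p)" by (simp add: W_def)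
    then have "cmat (chain e m n (2 * Suc p)) = mmul (A, B, C, D) (cmat (chain e m n (2 * p)))"
      using W by (simp only: cmat_append)
    then show "X (Suc p) = A * X p + B * Z p" "Z (Suc p) = C * X p + D * Z p"
      by (cases "cmat (chain e m n (2 * p))"; simp add: X_def Z_def den_def)+
  qed
  have det: "A * D - B * C = 1"
    unfolding ABCD using e(2) by algebra
  have tr: "A + D = T" unfolding T_def ABCD using e(2) by algebra
  have Z0: "Z 0 = z" "X 0 = x" by (simp_all add: Z_def X_def den_def e)
  have Z1: "Z 1 = (T - 1) * z"
    using rec(2)[of 0] Z0 unfolding T_def ABCD using e(2) by (simp, algebra)
  have "Z (Suc (Suc p)) = T * Z (Suc p) - Z p" for p
  proof -
    have "C * X (Suc p) = A * (Z (Suc p) - D * Z p) + B * C * Z p" using rec[of p] by algebra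
    then show ?thesis using rec(2)[of "Suc p"] det tr by algebra
  qed
  note Zrec = this
  have "Z p = z * lucas T p"
  proof (induction p rule: induct_nat_012)
    case (ge2 p)
    then show ?case unfolding Zrec by (simp add: algebra_simps)
  qed (use Z0 Z1 in simp_all)
  then show ?thesis by (simp add: Z_def T_def)
qed

text \<open>The \<open>lucas\<close> parameter has to differ from 2. For nonempty \<open>e\<close>
  the fractions \<open>x / z\<close> and \<open>y / z\<close> of \<open>e\<close> and
  \<open>rev e\<close> are nonzero and less than 1 in absolute value, so neither factor vanishes;
  for empty \<open>e\<close> the factors are \<open>m\<close> and \<open>n\<close>.\<close>

lemma lucas_chain_dvd:
  assumes e: "e \<in> vecs_even" and ne: "e \<noteq> [] \<or> m \<noteq> 0 \<and> n \<noteq> 0"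
    and dvd: "den (chain e m n (2 * q)) dvd den (chain e m n (2 * p))"
  shows "2 * q + 1 dvd 2 * p + 1"
proof -
  obtain w x y z where c: "cmat e = (w, x, y, z)" by (metis prod.exhaust)
  note E = cfrac_vecs_even[OF e c]
  have z: "z \<noteq> 0" using E(2) by auto
  have small: "b \<noteq> 0 \<and> \<bar>b\<bar> < \<bar>z\<bar>" if "u \<in> vecs_even" "u \<noteq> []" "cmat u = (a', b, c', z)" for u a' b c'
  proof -
    have "suffixes_ok u" "hd u \<noteq> 0" using that vecs_suffixes_ok by (auto simp: vecs_even_def vecs_def)
    then have b: "\<bar>cfrac u\<bar> < 1" "sgn (cfrac u) = of_int (sgn (hd u))" using cfrac_bound(1) that by blast+
    have "cfrac u = of_int b / of_int z" using cfrac_vecs_even(1)[OF that(1,3)] .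
    then have 1: "\<bar>of_int b / of_int z :: rat\<bar> < 1" and 2: "(of_int b / of_int z :: rat) \<noteq> 0"
      using b \<open>hd u \<noteq> 0\<close> by (auto simp: sgn_if split: if_splits)
    have "\<bar>of_int b :: rat\<bar> < \<bar>of_int z\<bar>" using 1 z by (simp add: abs_divide divide_less_eq)
    then have "\<bar>b\<bar> < \<bar>z\<bar>" by (simp flip: of_int_abs)
    then show ?thesis using 2 by auto
  qed
  have nonzero: "t * z + b \<noteq> 0" if "b \<noteq> 0 \<and> \<bar>b\<bar> < \<bar>z\<bar>" for b t
  proof
    assume "t * z + b = 0"
    then have "z dvd b" by (metis add.commute add_eq_0_iff dvd_minus_iff dvd_triv_right)
    then have "\<bar>z\<bar> \<le> \<bar>b\<bar>" using that dvd_imp_le_int by blast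
    then show False using that by simp
  qed
  have "(m * z + y) * (n * z + x) \<noteq> 0"
  proof (cases "e = []")
    case True
    then show ?thesis using c ne by auto
  next
    case False
    have "rev e \<in> vecs_even" using e rev_vecs by (simp add: vecs_even_def)
    moreover have "cmat (rev e) = (w, y, x, z)" using c by (simp add: cmat_rev)
    ultimately show ?thesis using nonzero small[OF e False c] small[of "rev e"] False by auto
  qed
  moreover have "lucas (2 + 4 * ((m * z + y) * (n * z + x))) q dvd lucas (2 + 4 * ((m * z + y) * (n * z + x))) p"
    using dvd z unfolding den_chain[OF c E(5)] by simp
  ultimately show ?thesis by (rule lucas_dvd[OF refl])
qed

section \<open>Parsing of classes and injectivity of the knot map\<close>

lemma pars_scale: "pars S Y \<Longrightarrow> unit_sign e \<Longrightarrow> pars (scale e S) (scale e Y)"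
proof (induction rule: pars.induct)
  case (pars_base S)
  show ?case by (rule pars.pars_base)
next
  case (pars_step S W s k)
  have "pars (scale e S) (scale e S @ gap (e * k) @ scale s (scale e W))"
    by (intro pars.pars_step) (use pars_step in \<open>auto simp: rev_scale\<close>)
  then show ?case using pars_step.prems by (simp add: scale_gap mult.commute)
qed

definition blocks :: "nat \<Rightarrow> (nat \<Rightarrow> int) \<Rightarrow> (nat \<Rightarrow> int) \<Rightarrow> int list \<Rightarrow> int list" where
  "blocks n \<epsilon> k a =
     concat (map (\<lambda>i. scale (\<epsilon> i) (if odd i then a else rev a) @ bold (2 * k i)) [1..<n]) @
     scale (\<epsilon> n) (if odd n then a else rev a)"

lemma blocks_1: "blocks 1 \<epsilon> k a = scale (\<epsilon> 1) a"
  by (simp add: blocks_def)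

lemma blocks_Suc:
  assumes "1 \<le> n"
  shows "blocks (Suc n) \<epsilon> k a =
    scale (\<epsilon> 1) a @ gap (k 1) @ blocks n (\<lambda>i. \<epsilon> (Suc i)) (\<lambda>i. k (Suc i)) (rev a)"
proof -
  have up: "[1..<Suc n] = 1 # map Suc [1..<n]"
    using assms by (simp add: upt_conv_Cons map_Suc_upt del: upt_Suc)
  have alt: "(if odd (Suc i) then a else rev a) = (if odd i then rev a else rev (rev a))" for i
    by simp
  show ?thesis
    unfolding blocks_def up list.map concat.simps map_map comp_def alt gap_def by simp
qed

lemma scale_concat: "scale e (concat xs) = concat (map (scale e) xs)"
  by (induction xs) auto

lemma scale_blocks:
  assumes "unit_sign e"
  shows "scale e (blocks n \<epsilon> k a) = blocks n (\<lambda>i. e * \<epsilon> i) (\<lambda>i. e * k i) a"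
proof -
  have "scale e (bold (2 * j)) = bold (2 * (e * j))" for j
    using scale_gap[OF assms] by (simp add: gap_def)
  then show ?thesis
    unfolding blocks_def scale_append scale_concat map_map comp_def scale_scale by simp
qed

lemma blocks_cong:
  assumes "\<And>i. 1 \<le> i \<Longrightarrow> \<epsilon> i = \<epsilon>' i" "\<And>i. 1 \<le> i \<Longrightarrow> k i = k' i" "1 \<le> n"
  shows "blocks n \<epsilon> k a = blocks n \<epsilon>' k' a"
proof -
  have *: "map (\<lambda>i. scale (\<epsilon> i) (if odd i then a else rev a) @ bold (2 * k i)) [1..<n] =
      map (\<lambda>i. scale (\<epsilon>' i) (if odd i then a else rev a) @ bold (2 * k' i)) [1..<n]"
    by (rule map_cong[OF refl]) (simp add: assms)
  show ?thesis unfolding blocks_def * assms(1)[OF assms(3)] ..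
qed

text \<open>Block signs are absolute here but relative to the preceding block in
  \<open>pars\<close>. The factor \<open>\<epsilon> 1\<close> normalises, since the tail of a block
  sequence may begin with sign -1.\<close>

lemma pars_of_blocks:
  assumes "1 \<le> n" "\<forall>i\<in>{1..n}. \<epsilon> i \<in> {-1, 1}" "\<forall>i\<in>{1..<n}. k i = 0 \<longrightarrow> \<epsilon> i = \<epsilon> (Suc i)"
  shows "pars a (scale (\<epsilon> 1) (blocks n \<epsilon> k a))"
  using assms
proof (induction n arbitrary: a \<epsilon> k rule: nat_induct_at_least)
  case base
  then have "\<epsilon> 1 * \<epsilon> 1 = 1" by auto
  then show ?case by (simp only: blocks_1 scale_scale scale_one pars_base)
next
  case (Suc n)
  define E where "E i = \<epsilon> (Suc i)" for i
  define R where "R = blocks n E (\<lambda>i. k (Suc i)) (rev a)"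
  have "\<forall>i\<in>{1..n}. E i \<in> {-1, 1}" "\<forall>i\<in>{1..<n}. k (Suc i) = 0 \<longrightarrow> E i = E (Suc i)"
    using Suc.prems by (auto simp: E_def)
  then have IH: "pars (rev a) (scale (E 1) R)" unfolding R_def by (rule Suc.IH)
  have e: "unit_sign (\<epsilon> 1)" "unit_sign (E 1)"
    using Suc.prems(1) Suc.hyps by (auto simp: E_def)
  have k1: "k 1 = 0 \<longrightarrow> \<epsilon> 1 = E 1" using Suc.prems(2) Suc.hyps by (auto simp: E_def)
  have "pars a (a @ gap (\<epsilon> 1 * k 1) @ scale (\<epsilon> 1 * E 1) (scale (E 1) R))"
    by (rule pars_step[OF IH]) (use e k1 in auto)
  moreover have "scale (\<epsilon> 1 * E 1) (scale (E 1) R) = scale (\<epsilon> 1) R"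
    using e by auto
  ultimately have "pars a (scale (\<epsilon> 1) (scale (\<epsilon> 1) a @ gap (k 1) @ R))"
    unfolding scale_append scale_cancel[OF e(1)] scale_gap[OF e(1)] by simp
  then show ?case unfolding blocks_Suc[OF Suc.hyps] R_def E_def .
qed

lemma blocks_of_pars:
  assumes "pars a c"
  shows "\<exists>n \<epsilon> k. 1 \<le> n \<and> \<epsilon> 1 = 1 \<and> (\<forall>i\<in>{1..n}. \<epsilon> i \<in> {-1, 1}) \<and>
        (\<forall>i\<in>{1..<n}. k i = 0 \<longrightarrow> \<epsilon> i = \<epsilon> (Suc i)) \<and> c = blocks n \<epsilon> k a"
  using assms
proof (induction rule: pars.induct)
  case (pars_base S)
  show ?case
    by (intro exI[of _ 1] exI[of _ "\<lambda>_. 1"] exI[of _ "\<lambda>_. 0"]) (simp add: blocks_1[simplified])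
next
  case (pars_step S W e k0)
  then obtain n \<epsilon> k where *: "1 \<le> n" "\<epsilon> 1 = 1" "\<forall>i\<in>{1..n}. \<epsilon> i \<in> {-1, 1}"
        "\<forall>i\<in>{1..<n}. k i = 0 \<longrightarrow> \<epsilon> i = \<epsilon> (Suc i)" "W = blocks n \<epsilon> k (rev S)" by blast
  define \<epsilon>' where "\<epsilon>' i = (if i = 1 then 1 else e * \<epsilon> (i - 1))" for i
  define k' where "k' i = (if i = 1 then k0 else e * k (i - 1))" for i :: nat
  have "scale e W = blocks n (\<lambda>i. \<epsilon>' (Suc i)) (\<lambda>i. k' (Suc i)) (rev S)"
    unfolding *(5) scale_blocks[OF pars_step.hyps(2)]
    by (rule blocks_cong) (use *(1) in \<open>auto simp: \<epsilon>'_def k'_def\<close>)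
  then have "S @ gap k0 @ scale e W = blocks (Suc n) \<epsilon>' k' S"
    unfolding blocks_Suc[OF *(1)] by (simp add: \<epsilon>'_def k'_def)
  moreover have "\<forall>i\<in>{1..Suc n}. \<epsilon>' i \<in> {-1, 1}"
  proof
    fix i assume "i \<in> {1..Suc n}"
    then have "i = 1 \<or> i - 1 \<in> {1..n}" by auto
    then show "\<epsilon>' i \<in> {-1, 1}" using *(3) pars_step.hyps(2) by (force simp: \<epsilon>'_def)
  qed
  moreover have "\<forall>i\<in>{1..<Suc n}. k' i = 0 \<longrightarrow> \<epsilon>' i = \<epsilon>' (Suc i)"
  proof
    fix i assume i: "i \<in> {1..<Suc n}"
    show "k' i = 0 \<longrightarrow> \<epsilon>' i = \<epsilon>' (Suc i)"
    proof (cases "i = 1")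
      case True
      then show ?thesis using pars_step.hyps(3) *(2) by (simp add: \<epsilon>'_def k'_def)
    next
      case False
      then have "i - 1 \<in> {1..<n}" "Suc (i - 1) = i" using i by auto
      then show ?thesis using *(4) pars_step.hyps(2) False by (auto simp: \<epsilon>'_def k'_def)
    qed
  qed
  moreover have "\<epsilon>' 1 = 1" "1 \<le> Suc n" by (simp_all add: \<epsilon>'_def)
  ultimately show ?case by blast
qed

lemma parses_iff_pars: "parses c a \<longleftrightarrow> c \<in> vecs \<and> a \<in> vecs \<and> pars a c"
proof -
  have "parses c a \<longleftrightarrow> c \<in> vecs \<and> a \<in> vecs \<and>
     (\<exists>n \<epsilon> k. 1 \<le> n \<and> \<epsilon> 1 = 1 \<and> (\<forall>i\<in>{1..n}. \<epsilon> i \<in> {-1, 1}) \<and>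
        (\<forall>i\<in>{1..<n}. k i = 0 \<longrightarrow> \<epsilon> i = \<epsilon> (Suc i)) \<and> c = blocks n \<epsilon> k a)"
    unfolding parses_def blocks_def Let_def ..
  moreover have "pars a (blocks n \<epsilon> k a)"
    if "1 \<le> n" "\<epsilon> 1 = 1" "\<forall>i\<in>{1..n}. \<epsilon> i \<in> {-1, 1}" "\<forall>i\<in>{1..<n}. k i = 0 \<longrightarrow> \<epsilon> i = \<epsilon> (Suc i)" for n \<epsilon> k
    using pars_of_blocks[OF that(1,3,4), of a] that(2) by simp
  ultimately show ?thesis using blocks_of_pars by blast
qed

text \<open>The fraction reveals the first entry: absolute value above 1 means 0, and below 1 the
  sign separates 2 from -2.\<close>

lemma cfrac_inject:
  assumes "suffixes_ok a" "suffixes_ok b" "cfrac a = cfrac b"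
  shows "a = b"
  using assms
proof (induction a arbitrary: b)
  case Nil
  show ?case
  proof (cases b)
    case (Cons v b')
    then have "cfrac b \<noteq> 0"
      using cfrac_bound[OF Nil.prems(2)] by (cases "v = 0") (auto simp: sgn_if split: if_splits)
    then show ?thesis using Nil.prems by simp
  qed simp
next
  case (Cons u a)
  have "cfrac (u # a) \<noteq> 0"
    using cfrac_bound[OF Cons.prems(1)] by (cases "u = 0") (auto simp: sgn_if split: if_splits)
  then obtain v b' where b: "b = v # b'" using Cons.prems(3) by (cases b) auto
  note A = cfrac_bound[OF Cons.prems(1)] suffixes_ok_Cons(1,2)[OF Cons.prems(1)]
  note B = cfrac_bound[OF Cons.prems(2)[unfolded b]] suffixes_ok_Cons(1,2)[OF Cons.prems(2)[unfolded b]]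
  have eq: "cfrac (u # a) = cfrac (v # b')" using Cons.prems(3) b by simp
  have "u = 0 \<longleftrightarrow> v = 0"
    using A(1,2) B(1,2) eq by (cases "u = 0"; cases "v = 0") (auto simp del: cfrac.simps)
  moreover have "u \<noteq> 0 \<Longrightarrow> v \<noteq> 0 \<Longrightarrow> sgn u = sgn v"
    using A(1) B(1) eq by (simp del: cfrac.simps)
  ultimately have "u = v" using A(4) B(4) by (auto simp: sgn_if split: if_splits)
  then have "cfrac a = cfrac b'" using eq by simp
  then show ?case using Cons.IH[OF A(3) B(3)] b \<open>u = v\<close> by simp
qed

lemma vecs_even_rev: "a \<in> vecs_even \<Longrightarrow> rev a \<in> vecs_even"
  using rev_vecs by (simp add: vecs_even_def)

lemma vecs_even_scale:
  assumes "a \<in> vecs_even" "unit_sign e"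
  shows "scale e a \<in> vecs_even"
proof -
  have "scale (-1) a \<in> vecs"
    using assms(1) by (auto simp: vecs_even_def vecs_def scale_def hd_map last_map)
  then show ?thesis using assms by (auto simp: vecs_even_def)
qed

lemma cmat_vecs_even_bounds:
  assumes a: "a \<in> vecs_even" "cmat a = (w, x, y, z)"
  shows "even x" "\<bar>x\<bar> < \<bar>z\<bar>" "even y" "\<bar>y\<bar> < \<bar>z\<bar>"
proof -
  have *: "even x \<and> \<bar>x\<bar> < \<bar>z\<bar>" if "a \<in> vecs_even" "cmat a = (w, x, y, z)" for a w x y z
  proof -
    have "suffixes_ok a" "even (length a)" using that vecs_suffixes_ok by (auto simp: vecs_even_def)
    then have "\<forall>b\<in>set a. even b" by (auto simp: suffixes_ok_def)
    then have "even x" using cmat_parity that(2) \<open>even (length a)\<close> by blast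
    moreover have "\<bar>x\<bar> < \<bar>z\<bar>"
    proof (cases "a = []")
      case False
      have z: "z \<noteq> 0" using cfrac_vecs_even(2)[OF that] by auto
      have "hd a \<noteq> 0" using that False by (auto simp: vecs_even_def vecs_def)
      then have "\<bar>cfrac a\<bar> < 1" using cfrac_bound(1)[OF \<open>suffixes_ok a\<close> False] by blast
      then have "\<bar>of_int x / of_int z :: rat\<bar> < 1" using cfrac_vecs_even(1)[OF that] by simp
      then have "\<bar>of_int x :: rat\<bar> < \<bar>of_int z\<bar>" using z by (simp add: abs_divide divide_less_eq)
      then show ?thesis by (simp flip: of_int_abs)
    qed (use that in auto)
    ultimately show ?thesis by blast
  qed
  show "even x" "\<bar>x\<bar> < \<bar>z\<bar>" using *[OF a] by auto
  have "cmat (rev a) = (w, y, x, z)" using a by (simp add: cmat_rev)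
  then show "even y" "\<bar>y\<bar> < \<bar>z\<bar>" using *[OF vecs_even_rev[OF a(1)]] by auto
qed

lemma cong_even_eq:
  fixes a b z :: int
  assumes "[a = b] (mod z)" "even a" "even b" "odd z" "\<bar>a\<bar> < \<bar>z\<bar>" "\<bar>b\<bar> < \<bar>z\<bar>"
  shows "a = b"
proof -
  obtain t where t: "a - b = z * t" using assms(1) by (auto simp: cong_iff_dvd_diff elim: dvdE)
  moreover have "even (a - b)" using assms(2,3) by simp
  ultimately have "even t" using assms(4) by simp
  then obtain r where r: "t = 2 * r" by blast
  have "\<bar>z\<bar> * \<bar>t\<bar> < 2 * \<bar>z\<bar>" using assms(5,6) t by (simp flip: abs_mult)
  then have "\<bar>t\<bar> < 2" using mult_less_cancel_left_pos[of "\<bar>z\<bar>" "\<bar>t\<bar>" 2] assms(5) by (simp add: mult.commute)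
  then have "t = 0" using r by (simp add: abs_if split: if_splits)
  then show ?thesis using t by simp
qed

text \<open>If \<open>cfrac a = x / z\<close>, then \<open>rev a\<close> has the fraction
  \<open>y / z\<close>, and \<open>x * y\<close> is -1 modulo \<open>z\<close> by the determinant.
  So \<open>same_knot\<close> says that \<open>x'\<close> is congruent to plus or minus
  \<open>x\<close> or \<open>y\<close>; all are even and smaller than |z|, which turns congruence
  into equality.\<close>

lemma Phi_inject:
  assumes a: "a \<in> vecs_even" and b: "b \<in> vecs_even" and eq: "Phi (vclass a) = Phi (vclass b)"
  shows "(a, b) \<in> vec_rel"
proof -
  obtain w x y z where A: "cmat a = (w, x, y, z)" by (metis prod.exhaust)
  obtain w' x' y' z' where B: "cmat b = (w', x', y', z')" by (metis prod.exhaust)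
  note A' = cfrac_vecs_even[OF a A] and B' = cfrac_vecs_even[OF b B]
  note A2 = cmat_vecs_even_bounds[OF a A] and B2 = cmat_vecs_even_bounds[OF b B]
  have z: "z \<noteq> 0" "z' \<noteq> 0" using A'(2) B'(2) by auto
  have refl: "same_knot r r" if "r = of_int p / of_int q" "coprime p q" "odd q" for r p q
    using same_knot_iff[of p q p q] that by auto
  have odd: "odd (snd (quotient_of r))" if "same_knot r r" for r
    using that by (auto simp: same_knot_def split: prod.splits)
  have "knot (cfrac a) = knot (cfrac b)" using eq Phi_vclass a b by simp
  then have "same_knot (cfrac a) (cfrac b)"
    using knot_eq_iff[OF odd odd] refl A'(1,2,3) B'(1,2,3) by blast
  then have zz: "\<bar>z'\<bar> = \<bar>z\<bar>" and c: "[x' = x] (mod z) \<or> [x' * x = 1] (mod z) \<or> [x' = - x] (mod z) \<or> [x' * x = - 1] (mod z)"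
    using same_knot_iff[of x z x' z'] A' B' z by auto
  have xy: "[x * y = - 1] (mod z)"
    using A'(5) by (metis cong_iff_dvd_diff diff_minus_eq_add dvd_triv_right diff_eq_eq add.commute)
  have toy: "[x' = - u * y] (mod z)" if "[x' * x = u] (mod z)" for u
  proof -
    have "[x' * x * y = u * y] (mod z)" using that by (rule cong_scalar_right)
    moreover have "[x' * (x * y) = x' * - 1] (mod z)" using xy by (rule cong_scalar_left)
    ultimately have "[- x' = u * y] (mod z)" by (metis cong_sym cong_trans mult.assoc mult_minus1_right)
    then show ?thesis using cong_minus_minus_iff by fastforce
  qed
  have "\<exists>e t. unit_sign e \<and> (t = x \<or> t = y) \<and> x' = e * t"
  proof -
    have "\<exists>e t. unit_sign e \<and> (t = x \<or> t = y) \<and> [x' = e * t] (mod z)"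
      using c toy[of 1] toy[of "-1"] by (metis minus_minus mult_1 mult_minus1)
    then obtain e t where e: "unit_sign e" "t = x \<or> t = y" "[x' = e * t] (mod z)" by blast
    have "x' = e * t"
      by (rule cong_even_eq[OF e(3)]) (use e A2 B2 zz A'(2) in \<open>auto simp: abs_mult\<close>)
    then show ?thesis using e by blast
  qed
  then obtain e t where e: "unit_sign e" "t = x \<or> t = y" "x' = e * t" by blast
  \<comment> \<open>Denominators produced by \<open>cmat\<close> may be negative, hence the sign
    \<open>s\<close>.\<close>
  obtain s where s: "unit_sign s" "z' = s * z" using zz by (metis abs_eq_iff mult_1 mult_minus1)
  define a' where "a' = (if t = x then a else rev a)"
  have a': "a' \<in> vecs_even" using a vecs_even_rev by (simp add: a'_def)
  have "cfrac a' = of_int t / of_int z"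
    using A'(1) cfrac_vecs_even(1)[OF vecs_even_rev[OF a], of w y x z] A e(2) by (auto simp: a'_def cmat_rev)
  then have "cfrac b = of_int (e * s) * cfrac a'" using B'(1) e(1,3) s by auto
  moreover have es: "unit_sign (e * s)" using e s by auto
  ultimately have "cfrac b = cfrac (scale (e * s) a')" using cfrac_scale[of "e * s" a'] by auto
  then have "b = scale (e * s) a'"
    using cfrac_inject vecs_suffixes_ok b vecs_even_scale[OF a' es] by (simp add: vecs_even_def)
  then have "a' = scale (e * s) b" using scale_cancel[OF es] by metis
  then have "a = scale (e * s) b \<or> a = scale (e * s) (rev b)"
    unfolding a'_def by (metis rev_rev_ident rev_scale)
  then show ?thesis using a b es unfolding vec_rel_def vecs_even_def by blast
qed

section \<open>Incomparable knots with an upper bound\<close>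

lemma vecs_append:
  assumes "u \<in> vecs" "v \<in> vecs"
  shows "u @ v \<in> vecs"
proof (cases "u = [] \<or> v = []")
  case False
  then have ne: "u \<noteq> []" "v \<noteq> []" by auto
  have U: "set u \<subseteq> {-2, 0, 2}" "hd u \<noteq> 0" "last u \<noteq> 0"
    "\<And>i. 0 < i \<Longrightarrow> Suc i < length u \<Longrightarrow> u ! i = 0 \<Longrightarrow> u ! (i - 1) = u ! Suc i \<and> u ! Suc i \<in> {-2, 2}"
    using assms(1) ne unfolding vecs_def by auto
  have V: "set v \<subseteq> {-2, 0, 2}" "hd v \<noteq> 0" "last v \<noteq> 0"
    "\<And>i. 0 < i \<Longrightarrow> Suc i < length v \<Longrightarrow> v ! i = 0 \<Longrightarrow> v ! (i - 1) = v ! Suc i \<and> v ! Suc i \<in> {-2, 2}"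
    using assms(2) ne unfolding vecs_def by auto
  have "(u @ v) ! (i - 1) = (u @ v) ! Suc i \<and> (u @ v) ! Suc i \<in> {-2, 2}"
    if i: "0 < i" "Suc i < length (u @ v)" "(u @ v) ! i = 0" for i
  proof -
    consider "Suc i < length u" | "Suc i = length u" | "i = length u" | "length u < i" by linarith
    then show ?thesis
    proof cases
      case 1
      then show ?thesis using U(4)[OF i(1) 1] i by (auto simp: nth_append)
    next
      case 2
      then have "u ! i = last u" "i < length u" using ne(1) by (auto simp: last_conv_nth simp flip: 2)
      then show ?thesis using i(3) U(3) by (simp add: nth_append)
    next
      case 3
      then show ?thesis using i(3) V(2) ne(2) by (simp add: nth_append hd_conv_nth)
    next
      case 4
      define j where "j = i - length u"
      have j: "0 < j" "Suc j < length v" "i = length u + j" using 4 i(2) by (auto simp: j_def)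
      then have "(u @ v) ! i = v ! j" "(u @ v) ! Suc i = v ! Suc j" "(u @ v) ! (i - 1) = v ! (j - 1)"
        by (auto simp: nth_append)
      then show ?thesis using V(4)[OF j(1,2)] i(3) by simp
    qed
  qed
  then show ?thesis using U(1,2) V(1,3) ne unfolding vecs_def by auto
qed (use assms in auto)

lemma vecs_append_0:
  assumes "u \<in> vecs" "v \<in> vecs" "u \<noteq> []" "v \<noteq> []" "last u = hd v"
  shows "u @ 0 # v \<in> vecs"
proof -
  have U: "set u \<subseteq> {-2, 0, 2}" "hd u \<noteq> 0" "last u \<noteq> 0"
    "\<And>i. 0 < i \<Longrightarrow> Suc i < length u \<Longrightarrow> u ! i = 0 \<Longrightarrow> u ! (i - 1) = u ! Suc i \<and> u ! Suc i \<in> {-2, 2}"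
    using assms unfolding vecs_def by auto
  have V: "set v \<subseteq> {-2, 0, 2}" "hd v \<noteq> 0" "last v \<noteq> 0"
    "\<And>i. 0 < i \<Longrightarrow> Suc i < length v \<Longrightarrow> v ! i = 0 \<Longrightarrow> v ! (i - 1) = v ! Suc i \<and> v ! Suc i \<in> {-2, 2}"
    using assms unfolding vecs_def by auto
  let ?c = "u @ 0 # v"
  have "?c ! (i - 1) = ?c ! Suc i \<and> ?c ! Suc i \<in> {-2, 2}"
    if i: "0 < i" "Suc i < length ?c" "?c ! i = 0" for i
  proof -
    consider "Suc i < length u" | "Suc i = length u" | "i = length u" | "i = Suc (length u)" | "Suc (length u) < i"
      by linarith
    then show ?thesis
    proof cases
      case 1
      then show ?thesis using U(4)[OF i(1) 1] i by (auto simp: nth_append)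
    next
      case 2
      then have "u ! i = last u" "i < length u" using assms(3) by (auto simp: last_conv_nth simp flip: 2)
      then show ?thesis using i(3) U(3) by (simp add: nth_append)
    next
      case 3
      have "?c ! (i - 1) = last u" using 3 i(1) assms(3) by (simp add: nth_append last_conv_nth)
      moreover have "?c ! Suc i = hd v" using 3 assms(4) by (simp add: nth_append hd_conv_nth)
      moreover have "hd v \<in> {-2, 2}" using V(1,2) hd_in_set[OF assms(4)] by blast
      ultimately show ?thesis using assms(5) by simp
    next
      case 4
      then show ?thesis using i(3) V(2) assms(4) by (simp add: nth_append hd_conv_nth)
    next
      case 5
      define j where "j = i - Suc (length u)"
      have j: "0 < j" "Suc j < length v" "i = Suc (length u + j)" using 5 i(2) by (auto simp: j_def)
      then have "?c ! i = v ! j" "?c ! Suc i = v ! Suc j" "?c ! (i - 1) = v ! (j - 1)"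
        by (auto simp: nth_append nth_Cons')
      then show ?thesis using V(4)[OF j(1,2)] i(3) by simp
    qed
  qed
  then show ?thesis using U(1,2) V(1,3) assms(3,4) unfolding vecs_def by auto
qed

lemma gap_vecs:
  assumes "m \<noteq> 0"
  shows "gap m \<in> vecs"
proof -
  have "gap m ! i \<in> {-2, 0, 2}" if "i < length (gap m)" for i
    using nth_gap[OF that] by (auto simp: sgn_if)
  then have "set (gap m) \<subseteq> {-2, 0, 2}" by (metis in_set_conv_nth subsetI)
  moreover have "gap m ! (i - 1) = gap m ! Suc i \<and> gap m ! Suc i \<in> {-2, 2}"
    if "0 < i" "Suc i < length (gap m)" "gap m ! i = 0" for i
    using that assms by (auto simp: nth_gap sgn_if split: if_splits)
  ultimately show ?thesis using assms unfolding vecs_def by (auto simp: sgn_if)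
qed

text \<open>A zero gap needs equal nonzero neighbours; these are \<open>last e\<close> and
  \<open>hd (rev e)\<close>, available only for nonempty \<open>e\<close>.\<close>

lemma chain_vecs:
  assumes "e \<in> vecs" "e = [] \<Longrightarrow> m \<noteq> 0 \<and> n \<noteq> 0"
  shows "chain e m n j \<in> vecs"
  using assms
proof (induction j arbitrary: e m n)
  case (Suc j)
  have IH: "chain (rev e) n m j \<in> vecs" using Suc rev_vecs by auto
  show ?case
  proof (cases "m = 0")
    case True
    then have e: "e \<noteq> []" using Suc.prems by auto
    then obtain R where R: "chain (rev e) n m j = rev e @ R" by (cases j) auto
    have "e @ 0 # chain (rev e) n m j \<in> vecs"
      by (rule vecs_append_0) (use Suc.prems(1) IH e R in \<open>auto simp: hd_rev\<close>)
    then show ?thesis using True by simp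
  next
    case False
    then show ?thesis using IH Suc.prems(1) by (simp add: gap_vecs vecs_append)
  qed
qed simp

lemma chain_vecs_even:
  assumes "e \<in> vecs_even" "e = [] \<Longrightarrow> m \<noteq> 0 \<and> n \<noteq> 0"
  shows "chain e m n (2 * p) \<in> vecs_even"
  using chain_vecs[of e m n] assms even_length_chain by (simp add: vecs_even_def)

text \<open>The larger chain has (2p + 1)(r + 1) blocks. In groups of 2p + 1, an odd number,
  consecutive groups are mirror images of each other.\<close>

lemma pars_chain_mult: "pars (chain e m n (2 * p)) (chain e m n (2 * p + (2 * p + 1) * r))"
proof (induction r arbitrary: e m n)
  case (Suc r)
  have idx: "2 * p + (2 * p + 1) * Suc r = Suc (2 * p + (2 * p + (2 * p + 1) * r))" by simp
  have "pars (rev (chain e m n (2 * p))) (chain (rev e) n m (2 * p + (2 * p + 1) * r))"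
    using Suc[of "rev e" n m] by (simp add: rev_chain)
  then have "pars (chain e m n (2 * p))
      (chain e m n (2 * p) @ gap m @ scale 1 (chain (rev e) n m (2 * p + (2 * p + 1) * r)))"
    by (rule pars_step) auto
  then show ?case unfolding idx chain_add by simp
qed (simp add: pars_base)

lemma pars_chain_dvd:
  assumes "2 * p + 1 dvd 2 * q + 1"
  shows "pars (chain e m n (2 * p)) (chain e m n (2 * q))"
proof -
  obtain s where s: "2 * q + 1 = (2 * p + 1) * s" using assms by (elim dvdE)
  then obtain r where "s = Suc r" by (cases s) auto
  then have "2 * q = 2 * p + (2 * p + 1) * r" using s by simp
  then show ?thesis using pars_chain_mult by metis
qed

lemma chain_replicate:
  "chain e m n (2 * p) = concat (replicate p (e @ bold (2 * m) @ rev e @ bold (2 * n))) @ e"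
proof (induction p)
  case (Suc p)
  then show ?case by (simp add: gap_def)
qed simp

section \<open>Passing from knots and classes to representatives\<close>

lemma vec_relE:
  assumes "(a, b) \<in> vec_rel"
  obtains e where "unit_sign e" "a = scale e b \<or> a = scale e (rev b)"
  using assms unfolding vec_rel_def by blast

lemma vec_rel_sym:
  assumes "(a, b) \<in> vec_rel"
  shows "(b, a) \<in> vec_rel"
proof -
  obtain e where e: "unit_sign e" "a = scale e b \<or> a = scale e (rev b)"
    using assms by (rule vec_relE)
  then have "b = scale e a \<or> b = scale e (rev a)" by (metis rev_rev_ident rev_scale scale_cancel)
  then show ?thesis using assms e(1) unfolding vec_rel_def by auto
qed

lemma Phi_cong: "(a, b) \<in> vec_rel \<Longrightarrow> a \<in> vecs_even \<Longrightarrow> Phi (vclass a) = Phi (vclass b)"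
  using Phi_vclass knot_cfrac_cong vec_rel_even by metis

lemma ors_ge_iff:
  "ors_ge J K \<longleftrightarrow>
    (\<exists>c\<in>vecs_even. \<exists>a\<in>vecs_even. J = Phi (vclass c) \<and> K = Phi (vclass a) \<and> pars a c)"
proof
  assume "ors_ge J K"
  then obtain c0 a0 c a where *: "c0 \<in> vecs_even" "a0 \<in> vecs_even" "J = Phi (vclass c0)" "K = Phi (vclass a0)"
      "(c0, c) \<in> vec_rel" "(a0, a) \<in> vec_rel" "parses c a"
    unfolding ors_ge_def class_parses_def vclasses_even_def vclass_def quotient_def by auto
  then show "\<exists>c\<in>vecs_even. \<exists>a\<in>vecs_even. J = Phi (vclass c) \<and> K = Phi (vclass a) \<and> pars a c"
    using vec_rel_even Phi_cong parses_iff_pars by metis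
next
  assume "\<exists>c\<in>vecs_even. \<exists>a\<in>vecs_even. J = Phi (vclass c) \<and> K = Phi (vclass a) \<and> pars a c"
  then obtain c a where *: "c \<in> vecs_even" "a \<in> vecs_even" "J = Phi (vclass c)" "K = Phi (vclass a)" "pars a c"
    by blast
  have refl: "b \<in> vclass b" if "b \<in> vecs_even" for b
    using that scale_1[of b] unfolding vclass_def vec_rel_def vecs_even_def by fastforce
  have "parses c a" using * by (simp add: parses_iff_pars vecs_even_def)
  then have "class_parses (vclass c) (vclass a)" unfolding class_parses_def using refl * by blast
  moreover have "vclass b \<in> vclasses_even" if "b \<in> vecs_even" for b
    using that by (simp add: vclasses_even_def vclass_def quotientI)
  ultimately show "ors_ge J K" unfolding ors_ge_def using * by blast
qed

text \<open>Lets one representative of the upper bound serve for all knots: a change of it is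
  absorbed by the representative of the smaller knot.\<close>

lemma pars_vec_rel:
  assumes "a \<in> vecs_even" "c \<in> vecs_even" "pars a c" "(c, d) \<in> vec_rel"
  shows "\<exists>b. (a, b) \<in> vec_rel \<and> b \<in> vecs_even \<and> pars b d"
proof -
  obtain e where e: "unit_sign e" "d = scale e c \<or> d = scale e (rev c)"
    using vec_rel_sym[OF assms(4)] by (rule vec_relE)
  have d: "d \<in> vecs" using assms(4) by (simp add: vec_rel_def)
  have scaled: "\<exists>b. (a, b) \<in> vec_rel \<and> b \<in> vecs_even \<and> pars b d"
    if "unit_sign s" "b0 = a \<or> b0 = rev a" "pars (scale s b0) d" for s b0
  proof -
    have "scale s b0 \<in> vecs_even" using that assms(1) vecs_even_rev vecs_even_scale by blast
    moreover have "(scale s b0, a) \<in> vec_rel"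
      using that calculation assms(1) unfolding vec_rel_def vecs_even_def by blast
    ultimately show ?thesis using that vec_rel_sym by blast
  qed
  show ?thesis
  proof (cases "a = []")
    case True
    then show ?thesis using scaled[of 1 a] pars_Nil[of d] d by (simp add: vecs_def)
  next
    case False
    then have "block a" using assms(1) by (auto simp: block_def vecs_even_def vecs_def)
    from e(2) show ?thesis
    proof
      assume "d = scale e c"
      then show ?thesis using scaled[OF e(1), of a] pars_scale[OF assms(3) e(1)] by simp
    next
      assume d: "d = scale e (rev c)"
      obtain s where s: "unit_sign s" "pars (rev a) (scale s (rev c))"
        using pars_rev[OF assms(3) \<open>block a\<close>] assms(2) by (auto simp: vecs_even_def)
      have es: "unit_sign (e * s)" using e s by auto
      have "scale (e * s) (scale s (rev c)) = d" using d s(1) by auto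
      then show ?thesis using scaled[OF es, of "rev a"] pars_scale[OF s(2) es] by simp
    qed
  qed
qed

lemma den_vec_rel: "(a, b) \<in> vec_rel \<Longrightarrow> \<bar>den a\<bar> = \<bar>den b\<bar>"
  by (auto simp: vec_rel_def abs_den_scale den_rev)

text \<open>By \<open>Phi_inject\<close> the denominator up to sign depends on the knot alone, so
  any even representatives may be used.\<close>

lemma ors_ge_den:
  assumes "ors_ge (Phi (vclass c)) (Phi (vclass a))" "c \<in> vecs_even" "a \<in> vecs_even"
  shows "den a dvd den c"
proof -
  obtain c' a' where *: "c' \<in> vecs_even" "a' \<in> vecs_even" "Phi (vclass c) = Phi (vclass c')"
      "Phi (vclass a) = Phi (vclass a')" "pars a' c'"
    using assms(1) unfolding ors_ge_iff by blast
  have "\<bar>den c\<bar> = \<bar>den c'\<bar>" "\<bar>den a\<bar> = \<bar>den a'\<bar>"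
    using den_vec_rel Phi_inject * assms by blast+
  then show ?thesis using pars_den[OF *(5)] by (metis abs_dvd_iff dvd_abs_iff)
qed

text \<open>For empty \<open>e\<close> the chain begins with \<open>gap m\<close> and ends with
  \<open>gap n\<close>, and the ends of a vector are nonzero.\<close>

lemma chain_vecs_nonzero:
  assumes "chain [] m n (2 * p) \<in> vecs" "0 < p"
  shows "m \<noteq> 0 \<and> n \<noteq> 0"
proof -
  have "chain [] m n (2 * p) \<noteq> []" "hd (chain [] m n (2 * p)) = 2 * sgn m"
    using assms(2) by (cases p; simp)+
  moreover have "last (chain [] m n (2 * p)) = 2 * sgn n"
  proof -
    obtain k where "2 * p = Suc k" "odd k" using assms(2) by (metis Suc_pred even_Suc even_mult_iff even_numeral mult_pos_pos zero_less_numeral)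
    then show ?thesis by (simp add: chain_Suc_right del: chain.simps)
  qed
  ultimately show ?thesis using assms by (auto simp: vecs_def)
qed

theorem theorem11:
  fixes K :: "nat \<Rightarrow> two_bridge_knot" and l :: nat
  shows "((\<forall>i\<in>{1..l}. \<forall>j\<in>{1..l}. i \<noteq> j \<longrightarrow> incomparable (K i) (K j)) \<and>
          (\<exists>J. upper_bound J (K ` {1..l})))
     \<longleftrightarrow>
     (\<exists>(a :: nat \<Rightarrow> int list) (p :: nat \<Rightarrow> nat) (e :: int list) (w :: int list) (m :: int) (n :: int).
        e \<in> vecs_even \<and> even m \<and> even n \<and>
        w = e @ bold m @ rev e @ bold n \<and>
        (\<forall>i\<in>{1..l}. a i \<in> vecs_even \<and> K i = Phi (vclass (a i)) \<and>
                    a i = concat (replicate (p i) w) @ e) \<and>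
        (\<forall>i\<in>{1..l}. \<forall>j\<in>{1..l}. i \<noteq> j \<longrightarrow> \<not> (2 * p i + 1) dvd (2 * p j + 1)))"
    (is "?L \<longleftrightarrow> ?R")
proof
  assume L: ?L
  then have inc: "\<not> ors_ge (K j) (K i)" if "i \<in> {1..l}" "j \<in> {1..l}" "i \<noteq> j" for i j
    using that unfolding incomparable_def by blast
  obtain J where J: "ors_ge J (K i)" if "i \<in> {1..l}" for i
    using L unfolding upper_bound_def by blast
  have nil: "[] \<in> vecs_even" by (simp add: vecs_even_def vecs_def)
  show ?R
  proof (cases "l = 0")
    case True
    then show ?thesis using nil by (intro exI[of _ "\<lambda>_. []"] exI[of _ "\<lambda>_. 0"] exI[of _ "[]"] exI conjI) auto
  next
    case False
    then have one: "1 \<in> {1..l}" by simp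
    obtain c where c: "c \<in> vecs_even" "J = Phi (vclass c)" using J[OF one] unfolding ors_ge_iff by blast
    have "\<exists>b. b \<in> vecs_even \<and> K i = Phi (vclass b) \<and> pars b c" if i: "i \<in> {1..l}" for i
    proof -
      obtain c' a where *: "c' \<in> vecs_even" "a \<in> vecs_even" "J = Phi (vclass c')" "K i = Phi (vclass a)" "pars a c'"
        using J[OF i] unfolding ors_ge_iff by blast
      then have "(c', c) \<in> vec_rel" using Phi_inject c by metis
      then obtain b where "(a, b) \<in> vec_rel" "b \<in> vecs_even" "pars b c" using pars_vec_rel * by blast
      then show ?thesis using Phi_cong * by metis
    qed
    then obtain a where a: "\<And>i. i \<in> {1..l} \<Longrightarrow> a i \<in> vecs_even \<and> K i = Phi (vclass (a i)) \<and> pars (a i) c"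
      by metis
    have inc': "\<not> pars (a i) (a j)" if "i \<in> {1..l}" "j \<in> {1..l}" "i \<noteq> j" for i j
      using inc[OF that] a that unfolding ors_ge_iff by blast
    have "\<exists>e m n p. \<forall>i\<in>{1..l}. a i = chain e m n (2 * p i)"
      by (rule common_chain[where c = c]) (use a c inc' in \<open>auto simp: vecs_even_def\<close>)
    then obtain e m n p where p: "\<And>i. i \<in> {1..l} \<Longrightarrow> a i = chain e m n (2 * p i)" by blast
    \<comment> \<open>\<open>e\<close> is an initial piece of the chain \<open>a 1\<close> and has
      the same last entry, so it inherits the conditions of an expanded even vector.\<close>
    have "e \<in> vecs_even"
    proof -
      have a1: "a 1 \<in> vecs_even" "a 1 = chain e m n (2 * p 1)" using a[OF one] p[OF one] by auto
      then have "even (length e)" using even_length_chain by (metis (mono_tags) mem_Collect_eq vecs_even_def)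
      moreover have "e \<in> vecs" if e: "e \<noteq> []"
      proof -
        obtain R where R: "a 1 = e @ R" using pars_prefix[OF pars_chain, of e m n "2 * p 1"] a1(2)
          by (auto simp: prefix_def)
        have a1': "set (a 1) \<subseteq> {-2, 0, 2}" "hd (a 1) \<noteq> 0" "last (a 1) \<noteq> 0"
          "\<And>i. 0 < i \<Longrightarrow> Suc i < length (a 1) \<Longrightarrow> a 1 ! i = 0 \<Longrightarrow>
             a 1 ! (i - 1) = a 1 ! Suc i \<and> a 1 ! Suc i \<in> {-2, 2}"
          using a1(1) e R unfolding vecs_even_def vecs_def by auto
        have "last e \<noteq> 0" using a1'(3) a1(2) last_chain[OF e] by simp
        moreover have "e ! (i - 1) = e ! Suc i \<and> e ! Suc i \<in> {-2, 2}"
          if "0 < i" "Suc i < length e" "e ! i = 0" for i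
          using a1'(4)[of i] that R by (auto simp: nth_append split: if_splits)
        ultimately show ?thesis using a1'(1,2) R e unfolding vecs_def by auto
      qed
      ultimately show ?thesis using nil by (auto simp: vecs_even_def)
    qed
    moreover have "\<not> 2 * p i + 1 dvd 2 * p j + 1" if "i \<in> {1..l}" "j \<in> {1..l}" "i \<noteq> j" for i j
      using inc'[OF that] pars_chain_dvd[of "p i" "p j" e m n] p that by auto
    moreover have "a i = concat (replicate (p i) (e @ bold (2 * m) @ rev e @ bold (2 * n))) @ e"
      if "i \<in> {1..l}" for i
      using p[OF that] chain_replicate by simp
    ultimately show ?thesis using a
      by (intro exI[of _ a] exI[of _ p] exI[of _ e] exI[of _ "e @ bold (2 * m) @ rev e @ bold (2 * n)"]
          exI[of _ "2 * m"] exI[of _ "2 * n"]) auto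
  qed
next
  assume ?R
  then obtain a p e w and M N :: int where e: "e \<in> vecs_even" and MN: "even M" "even N"
    and w: "w = e @ bold M @ rev e @ bold N"
    and a: "\<And>i. i \<in> {1..l} \<Longrightarrow> a i \<in> vecs_even" "\<And>i. i \<in> {1..l} \<Longrightarrow> K i = Phi (vclass (a i))"
      "\<And>i. i \<in> {1..l} \<Longrightarrow> a i = concat (replicate (p i) w) @ e"
    and ndvd: "\<And>i j. i \<in> {1..l} \<Longrightarrow> j \<in> {1..l} \<Longrightarrow> i \<noteq> j \<Longrightarrow> \<not> (2 * p i + 1) dvd (2 * p j + 1)"
    by (elim exE conjE) blast
  obtain m n where mn: "M = 2 * m" "N = 2 * n" using MN by (elim evenE)
  have ch: "a i = chain e m n (2 * p i)" if "i \<in> {1..l}" for i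
    using a(3)[OF that] w mn chain_replicate by simp
  have nonzero: "m \<noteq> 0 \<and> n \<noteq> 0" if "i \<in> {1..l}" "0 < p i" "e = []" for i
  proof -
    have "chain e m n (2 * p i) \<in> vecs_even" using a(1)[OF that(1)] ch[OF that(1)] by metis
    then show ?thesis using chain_vecs_nonzero[of m n "p i"] that by (simp add: vecs_even_def)
  qed
  have not_ge: "\<not> ors_ge (K i) (K j)" if ij: "i \<in> {1..l}" "j \<in> {1..l}" "i \<noteq> j" for i j
  proof
    assume "ors_ge (K i) (K j)"
    then have "den (a j) dvd den (a i)" using ors_ge_den a(1,2) ij(1,2) by metis
    \<comment> \<open>Two zero exponents would give 1 dividing 1. A positive exponent makes
      \<open>m\<close> and \<open>n\<close> nonzero in case \<open>e\<close> is empty, as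
      \<open>lucas_chain_dvd\<close> requires.\<close>
    moreover have "0 < p i \<or> 0 < p j" using ndvd[OF ij] by auto
    ultimately have "2 * p j + 1 dvd 2 * p i + 1"
      using lucas_chain_dvd[OF e, of m n "p j" "p i"] nonzero ij ch by auto
    then show False using ndvd[of j i] ij by auto
  qed
  have "odd (\<Prod>i\<in>{1..l}. 2 * p i + 1)" by (induction l) auto
  then obtain q where q: "(\<Prod>i\<in>{1..l}. 2 * p i + 1) = 2 * q + 1" by (elim oddE)
  define c where "c = chain e m n (2 * q)"
  have "c \<in> vecs_even"
  \<comment> \<open>For empty \<open>e\<close> the gaps of \<open>c\<close> must be nonzero, which
    is known only from some \<open>a i\<close> with \<open>0 < p i\<close>. Without such an
    \<open>i\<close> the product is 1 and \<open>c\<close> is just \<open>e\<close>.\<close>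
  proof (cases "q = 0")
    case True
    then show ?thesis using e by (simp add: c_def)
  next
    case False
    then have "\<exists>i\<in>{1..l}. 0 < p i" using q by (metis (mono_tags, lifting) add_0 bot_nat_0.not_eq_extremum
          mult_0_right mult_eq_0_iff prod.neutral add_cancel_left_left zero_neq_numeral)
    then show ?thesis unfolding c_def using chain_vecs_even e nonzero by blast
  qed
  moreover have "pars (a i) c" if "i \<in> {1..l}" for i
    using pars_chain_dvd[of "p i" q e m n] ch[OF that] that
      dvd_prodI[of "{1..l}" i "\<lambda>i. 2 * p i + 1"] q by (simp add: c_def)
  ultimately have "upper_bound (Phi (vclass c)) (K ` {1..l})"
    unfolding upper_bound_def ors_ge_iff using a by blast
  then show ?L using not_ge unfolding incomparable_def by blast
qed

end
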